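(* Let $n\ge 1$, $s>0$, $1<p<\infty$ and $\lambda>1$. If $s=\frac12\bigl(\frac{n}{p}+m\bigr)$ for an integer $m\ge 0$, then there is a continuous embedding $$\mathcal{L}^{p}_{s+\ln,\lambda}(\mathbb R^n)\hookrightarrow C_0^m(\mathbb R^n).$$ Moreover, for any $u\in\mathcal{L}^{p}_{s+\ln,\lambda}(\mathbb R^n)$ and any multi-index $\gamma$ with $|\gamma|=m$, the weak derivative $\partial^\gamma u$ belongs to $C_0(\mathbb R^n)$ and satisfies the logarithmic modulus of continuity $$\|\partial^\gamma u(\cdot+h)-\partial^\gamma u(\cdot)\|_{L^\infty}\le C\,\|u\|_{\mathcal L^{p}_{s+\ln,\lambda}}\,|\ln|h||^{-\frac1p}$$ for $|h|$ sufficiently small, where $C=C(n,p,s,\lambda)>0$.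
   Context: The Fourier transform is $\widehat u(\xi)=\int_{\mathbb{R}^n}u(x)e^{-2\pi i x\cdot\xi}\,dx$, extended to $\mathcal S'(\mathbb R^n)$. For $s>0$, $\lambda>1$, $(\lambda I-\Delta)^{s+\ln}$ is the Fourier multiplier on $\mathcal S'(\mathbb R^n)$ with symbol $(\lambda+4\pi^2|\xi|^2)^s\ln(\lambda+4\pi^2|\xi|^2)$, and $\mathcal L^{p}_{s+\ln,\lambda}(\mathbb R^n)=\{u\in\mathcal S'(\mathbb R^n):(\lambda I-\Delta)^{s+\ln}u\in L^p(\mathbb R^n)\}$ with norm $\|u\|_{\mathcal L^{p}_{s+\ln,\lambda}}=\|(\lambda I-\Delta)^{s+\ln}u\|_{L^p}$. $C_0(\mathbb R^n)$ is the space of continuous functions on $\mathbb R^n$ vanishing at infinity with the supremum norm; $C_0^m(\mathbb R^n)$ is the space of $C^m$ functions all of whose derivatives of order at most $m$ belong to $C_0(\mathbb R^n)$, with the norm $\sum_{|\gamma|\le m}\|\partial^\gamma u\|_{L^\infty}$ (so $C_0^0=C_0$). *)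

theory Defs
  imports "HOL-Analysis.Analysis"
begin

section \<open>Partial derivatives and multi-indices\<close>

text \<open>
  \<open>\<real>\<^sup>n\<close> is \<open>real ^ 'n\<close> with \<open>n = CARD('n)\<close>, and a multi-index is a function \<open>'n \<Rightarrow> nat\<close>.
\<close>

definition partial_deriv ::
  "'n::finite \<Rightarrow> (real ^ 'n \<Rightarrow> complex) \<Rightarrow> real ^ 'n \<Rightarrow> complex"
  where "partial_deriv i f x = vector_derivative (\<lambda>t. f (x + t *\<^sub>R axis i 1)) (at 0)"

primrec Cm :: "nat \<Rightarrow> (real ^ 'n::finite \<Rightarrow> complex) \<Rightarrow> bool"
  where
    "Cm 0 f \<longleftrightarrow> continuous_on UNIV f"
  | "Cm (Suc k) f \<longleftrightarrow>
       continuous_on UNIV f \<and>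
       (\<forall>i. (\<forall>x. (\<lambda>t. f (x + t *\<^sub>R axis i 1)) differentiable at 0) \<and> Cm k (partial_deriv i f))"

definition mi_order :: "('n::finite \<Rightarrow> nat) \<Rightarrow> nat"
  where "mi_order \<gamma> = (\<Sum>i\<in>UNIV. \<gamma> i)"

definition monomial :: "('n::finite \<Rightarrow> nat) \<Rightarrow> real ^ 'n \<Rightarrow> real"
  where "monomial \<alpha> x = (\<Prod>i\<in>UNIV. (x $ i) ^ \<alpha> i)"

text \<open>
  The type \<open>'n\<close> carries no order, so the partial derivatives in \<open>\<partial>\<^sup>\<gamma>\<close> are taken along a fixed but
  arbitrary enumeration of the coordinates.  The operator is only applied to functions of class
  \<open>C\<^sup>k\<close> with \<open>|\<gamma>| \<le> k\<close>, for which the order is irrelevant.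
\<close>

definition coords :: "'n::finite list"
  where "coords = (SOME xs. distinct xs \<and> set xs = UNIV)"

definition mderiv ::
  "('n::finite \<Rightarrow> nat) \<Rightarrow> (real ^ 'n \<Rightarrow> complex) \<Rightarrow> real ^ 'n \<Rightarrow> complex"
  where "mderiv \<gamma> = fold (\<lambda>i. partial_deriv i ^^ \<gamma> i) coords"


section \<open>The spaces $C_0$ and $C_0^m$\<close>

text \<open>
  The supremum is meaningful for bounded functions only, in particular on $C_0$; there it
  coincides with the $L^\infty$ norm.
\<close>

definition sup_norm :: "(real ^ 'n::finite \<Rightarrow> complex) \<Rightarrow> real"
  where "sup_norm f = (SUP x. norm (f x))"

definition C0 :: "(real ^ 'n::finite \<Rightarrow> complex) set"
  where "C0 = {f. continuous_on UNIV f \<and> (f \<longlongrightarrow> 0) at_infinity}"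

definition C0m :: "nat \<Rightarrow> (real ^ 'n::finite \<Rightarrow> complex) set"
  where "C0m m = {f. Cm m f \<and> (\<forall>\<gamma>. mi_order \<gamma> \<le> m \<longrightarrow> mderiv \<gamma> f \<in> C0)}"

definition C0m_norm :: "nat \<Rightarrow> (real ^ 'n::finite \<Rightarrow> complex) \<Rightarrow> real"
  where "C0m_norm m f = (\<Sum>\<gamma> | mi_order \<gamma> \<le> m. sup_norm (mderiv \<gamma> f))"


section \<open>Schwartz functions and tempered distributions\<close>

definition schwartz :: "(real ^ 'n::finite \<Rightarrow> complex) set"
  where "schwartz =
    {\<phi>. (\<forall>k. Cm k \<phi>) \<and>
        (\<forall>\<alpha> \<beta>. bounded (range (\<lambda>x. monomial \<alpha> x *\<^sub>R mderiv \<beta> \<phi> x)))}"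

definition schwartz_seminorm ::
  "('n::finite \<Rightarrow> nat) \<Rightarrow> ('n \<Rightarrow> nat) \<Rightarrow> (real ^ 'n \<Rightarrow> complex) \<Rightarrow> real"
  where "schwartz_seminorm \<alpha> \<beta> \<phi> = (SUP x. norm (monomial \<alpha> x *\<^sub>R mderiv \<beta> \<phi> x))"

text \<open>The locally convex topology on the Schwartz space defined by these seminorms.\<close>

definition schwartz_topology :: "(real ^ 'n::finite \<Rightarrow> complex) topology"
  where "schwartz_topology = topology_generated_by
    {{\<psi> \<in> schwartz. schwartz_seminorm \<alpha> \<beta> (\<lambda>x. \<psi> x - \<phi> x) < \<epsilon>} | \<alpha> \<beta> \<phi> \<epsilon>.
       \<phi> \<in> schwartz \<and> \<epsilon> > 0}"

text \<open>
  Functionals are \<open>extensional\<close>, i.e. \<open>undefined\<close> off the Schwartz space, so that equality of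
  functionals in HOL is equality of distributions.
\<close>

type_synonym 'n functional = "(real ^ 'n \<Rightarrow> complex) \<Rightarrow> complex"

definition tempered_distributions :: "'n::finite functional set"
  where "tempered_distributions =
    {u \<in> extensional schwartz.
       (\<forall>\<phi>\<in>schwartz. \<forall>\<psi>\<in>schwartz. u (\<lambda>x. \<phi> x + \<psi> x) = u \<phi> + u \<psi>) \<and>
       (\<forall>c. \<forall>\<phi>\<in>schwartz. u (\<lambda>x. c * \<phi> x) = c * u \<phi>) \<and>
       continuous_map schwartz_topology euclidean u}"

definition dist_of :: "(real ^ 'n::finite \<Rightarrow> complex) \<Rightarrow> 'n functional"
  where "dist_of f = (\<lambda>\<phi>\<in>schwartz. LINT x|lborel. f x * \<phi> x)"

definition dist_deriv :: "('n::finite \<Rightarrow> nat) \<Rightarrow> 'n functional \<Rightarrow> 'n functional"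
  where "dist_deriv \<gamma> u = (\<lambda>\<phi>\<in>schwartz. (-1) ^ mi_order \<gamma> * u (mderiv \<gamma> \<phi>))"

definition dist_mult :: "(real ^ 'n::finite \<Rightarrow> complex) \<Rightarrow> 'n functional \<Rightarrow> 'n functional"
  where "dist_mult a u = (\<lambda>\<phi>\<in>schwartz. u (\<lambda>\<xi>. a \<xi> * \<phi> \<xi>))"


section \<open>Fourier transform and Fourier multipliers\<close>

definition fourier :: "(real ^ 'n::finite \<Rightarrow> complex) \<Rightarrow> real ^ 'n \<Rightarrow> complex"
  where "fourier f \<xi> = (LINT x|lborel. f x * exp (- 2 * pi * \<i> * complex_of_real (x \<bullet> \<xi>)))"

definition inv_fourier :: "(real ^ 'n::finite \<Rightarrow> complex) \<Rightarrow> real ^ 'n \<Rightarrow> complex"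
  where "inv_fourier f x = (LINT \<xi>|lborel. f \<xi> * exp (2 * pi * \<i> * complex_of_real (x \<bullet> \<xi>)))"

definition dist_fourier :: "'n::finite functional \<Rightarrow> 'n functional"
  where "dist_fourier u = (\<lambda>\<phi>\<in>schwartz. u (fourier \<phi>))"

definition dist_inv_fourier :: "'n::finite functional \<Rightarrow> 'n functional"
  where "dist_inv_fourier u = (\<lambda>\<phi>\<in>schwartz. u (inv_fourier \<phi>))"

definition fourier_multiplier ::
  "(real ^ 'n::finite \<Rightarrow> complex) \<Rightarrow> 'n functional \<Rightarrow> 'n functional"
  where "fourier_multiplier a u = dist_inv_fourier (dist_mult a (dist_fourier u))"

definition sln_symbol :: "real \<Rightarrow> real \<Rightarrow> real ^ 'n::finite \<Rightarrow> real"
  where "sln_symbol s lam \<xi> =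
    (lam + 4 * pi\<^sup>2 * (norm \<xi>)\<^sup>2) powr s * ln (lam + 4 * pi\<^sup>2 * (norm \<xi>)\<^sup>2)"

definition sln_op :: "real \<Rightarrow> real \<Rightarrow> 'n::finite functional \<Rightarrow> 'n functional"
  where "sln_op s lam = fourier_multiplier (\<lambda>\<xi>. complex_of_real (sln_symbol s lam \<xi>))"


section \<open>Lebesgue spaces and the spaces $\mathcal{L}^p_{s+\ln,\lambda}$\<close>

definition Lp :: "real \<Rightarrow> (real ^ 'n::finite \<Rightarrow> complex) set"
  where "Lp p = {g \<in> borel_measurable lborel. integrable lborel (\<lambda>x. norm (g x) powr p)}"

definition Lp_norm :: "real \<Rightarrow> (real ^ 'n::finite \<Rightarrow> complex) \<Rightarrow> real"
  where "Lp_norm p g = (LINT x|lborel. norm (g x) powr p) powr (1 / p)"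

text \<open>
  A distribution in $L^p$ determines the function representing it up to a null set, so the norm
  does not depend on the representative chosen.
\<close>

definition dist_Lp_norm :: "real \<Rightarrow> 'n::finite functional \<Rightarrow> real"
  where "dist_Lp_norm p v = Lp_norm p (SOME g. g \<in> Lp p \<and> v = dist_of g)"

definition Lsln :: "real \<Rightarrow> real \<Rightarrow> real \<Rightarrow> 'n::finite functional set"
  where "Lsln p s lam = {u \<in> tempered_distributions. sln_op s lam u \<in> dist_of ` Lp p}"

definition Lsln_norm :: "real \<Rightarrow> real \<Rightarrow> real \<Rightarrow> 'n::finite functional \<Rightarrow> real"
  where "Lsln_norm p s lam u = dist_Lp_norm p (sln_op s lam u)"

end

theory Submission
  imports Defs "HOL-Probability.Probability"
begin

text \<open>
  Write \<open>a(\<xi>) = (\<lambda> + 4\<pi>\<^sup>2|\<xi>|\<^sup>2)\<^sup>s ln (\<lambda> + 4\<pi>\<^sup>2|\<xi>|\<^sup>2)\<close> for the symbol, \<open>g\<close> for the \<open>L\<^sup>p\<close> function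
  \<open>(\<lambda>I - \<Delta>)\<^bsup>s+ln\<^esup> u\<close>, and \<open>q\<close> for the conjugate exponent of \<open>p\<close>. Then \<open>u = K * g\<close>, where \<open>K\<close> is
  the inverse Fourier transform of \<open>1/a\<close>, and the theorem is a statement about the singularity of
  \<open>K\<close> at the origin.

  The kernel is a superposition of heat kernels \<open>H\<^sub>r\<close>. From \<open>1 / ln \<mu> = \<integral>\<^sub>0\<^sup>\<infinity> \<mu>\<^bsup>-t\<^esup> dt\<close> and
  the Gamma integral one obtains \<open>1/a(\<xi>) = \<integral> exp (-4\<pi>\<^sup>2r|\<xi>|\<^sup>2) d\<nu>(r)\<close> for a finite positive measure
  \<open>\<nu>\<close> on \<open>(0,\<infinity>)\<close> (\<open>nn_integral_nu_exp\<close>). Its density is \<open>O(r\<^bsup>s-1\<^esup>/|ln r|)\<close> as \<open>r \<rightarrow> 0\<close>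
  (\<open>log_weight_le\<close>), which is the whole effect of the logarithm in the symbol, and all its moments
  at infinity are finite because \<open>\<lambda> > 1\<close>.

  Derivatives of order \<open>k\<close> of \<open>H\<^sub>r\<close> are \<open>r\<^bsup>-(n+k)/2\<^esup>\<close> times a rapidly decreasing function of
  \<open>x/\<surd>r\<close>. Integrating over \<open>r\<close> with \<open>2s = n/p + m\<close> and \<open>k \<le> m\<close> shows that the derivative of order
  \<open>k\<close> of \<open>K\<close> is at most a constant times \<open>|x|\<^bsup>-n/q\<^esup> / |ln |x||\<close> near the origin
  (\<open>nu_gauss_majorant\<close>, \<open>Ker_majorant\<close>). This is just in \<open>L\<^sup>q\<close>: in polar coordinates its
  \<open>q\<close>-th power is \<open>1 / (\<rho> |ln \<rho>|\<^sup>q)\<close>, and the ball of radius \<open>\<delta>\<close> contributes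
  \<open>|ln \<delta>|\<^bsup>1-q\<^esup>\<close>, the \<open>q\<close>-th root of which is \<open>|ln \<delta>|\<^bsup>-1/p\<^esup>\<close>. Hoelder's inequality bounds the
  derivatives of \<open>u\<close> by the \<open>L\<^sup>p\<close> norm of \<open>g\<close>. For the modulus of continuity the difference of the
  kernel and its translate by \<open>h\<close> is split at \<open>|x| = 2|h|\<close>: the inner part gives
  \<open>|ln |h||\<^bsup>-1/p\<^esup>\<close>, and the outer part, estimated with one more derivative, gives the smaller
  \<open>|ln |h||\<^bsup>-1\<^esup>\<close> (\<open>conv_diff_bound\<close>). Continuity of the derivatives follows from the modulus, and
  their decay at infinity from the tails of \<open>g\<close> and of the majorant.

  On the side of distributions, let \<open>\<psi>\<close> be a Schwartz function. Then \<open>\<phi> = K * \<psi>\<close> is the Fourier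
  transform of \<open>a\<^sup>-\<^sup>1\<close> times the inverse transform of \<open>\<psi>\<close>, so it is a Schwartz function, and the
  multiplier takes \<open>\<phi>\<close> back to \<open>\<psi>\<close>. Hence \<open>u(\<psi>) = \<integral> g (K * \<psi>) = \<integral> (K * g) \<psi>\<close>
  (\<open>Lsln_representation\<close>). This rests on the invariance of the Schwartz space under the Fourier
  transform and under multiplication by powers of the symbol and of its logarithm, and on Fourier
  inversion, which is obtained by Gaussian regularisation.
\<close>

section \<open>Smooth functions\<close>

text \<open>
  Differentiability along the coordinate axes is all that iterated partial derivatives see; the
  continuity of the partial derivatives replaces the Frechet derivative throughout.
\<close>

definition axis_diff :: "(real ^ 'n::finite \<Rightarrow> complex) \<Rightarrow> bool"
  where "axis_diff f \<longleftrightarrow> (\<forall>i x. (\<lambda>t. f (x + t *\<^sub>R axis i 1)) differentiable at 0)"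

lemma axis_diff_has_vector_derivative:
  assumes "axis_diff f"
  shows "((\<lambda>t. f (x + t *\<^sub>R axis i 1)) has_vector_derivative
           partial_deriv i f (x + t *\<^sub>R axis i 1)) (at t)"
proof -
  let ?y = "x + t *\<^sub>R axis i 1"
  have *: "((\<lambda>s. f (?y + s *\<^sub>R axis i 1)) has_vector_derivative partial_deriv i f ?y) (at (t - t))"
    using assms by (simp add: axis_diff_def partial_deriv_def vector_derivative_works[symmetric])
  have "((\<lambda>s. s - t) has_vector_derivative 1) (at t)"
    by (auto intro!: derivative_eq_intros)
  from vector_diff_chain_at[OF this *] show ?thesis
    by (simp add: o_def algebra_simps scaleR_diff_left)
qed

lemma axis_diffI:
  assumes "\<And>i x. ((\<lambda>t. f (x + t *\<^sub>R axis i 1)) has_vector_derivative D i x) (at 0)"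
  shows "axis_diff f" and "partial_deriv i f = D i"
  using assms by (auto simp: axis_diff_def partial_deriv_def fun_eq_iff
      intro: differentiableI_vector vector_derivative_at)

lemma axis_diff_has_vector_derivative_0:
  assumes "axis_diff f"
  shows "((\<lambda>t. f (x + t *\<^sub>R axis i 1)) has_vector_derivative partial_deriv i f x) (at 0)"
  using axis_diff_has_vector_derivative[OF assms, of x i 0] by simp

text \<open>
  The largest class of functions with property \<open>B\<close> that is closed under partial derivatives.
  Coinduction reduces closure properties of Schwartz functions to checks of a single derivative,
  without multi-indices.
\<close>

coinductive all_derivs :: "((real ^ 'n \<Rightarrow> complex) \<Rightarrow> bool) \<Rightarrow> (real ^ 'n::finite \<Rightarrow> complex) \<Rightarrow> bool"
  for B where
  "\<lbrakk>B f; axis_diff f; \<And>i. all_derivs B (partial_deriv i f)\<rbrakk> \<Longrightarrow> all_derivs B f"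

lemma all_derivsD:
  assumes "all_derivs B f"
  shows "B f" "axis_diff f" "all_derivs B (partial_deriv i f)"
  using assms by (auto elim: all_derivs.cases)

lemmas all_derivs_base = all_derivsD(1)
  and all_derivs_axis_diff = all_derivsD(2)
  and all_derivs_partial = all_derivsD(3)

lemma all_derivs_mono:
  assumes "all_derivs B f" "\<And>g. B g \<Longrightarrow> B' g"
  shows "all_derivs B' f"
  using assms(1)
proof (coinduction arbitrary: f)
  case (all_derivs f)
  show ?case
    by (rule exI[of _ f]) (use all_derivsD[OF all_derivs(1)] assms(2) in auto)
qed

abbreviation "smooth \<equiv> all_derivs (continuous_on UNIV)"

lemma continuous_on_axis:
  fixes f :: "real ^ 'n::finite \<Rightarrow> complex"
  assumes "continuous_on UNIV f"
  shows "continuous_on S (\<lambda>t::real. f (x + t *\<^sub>R axis i 1))"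
  by (rule continuous_on_compose2[OF assms]) (auto intro!: continuous_intros)

text \<open>
  Symmetry of second derivatives. The fundamental theorem of calculus writes
  \<open>f (x + s e\<^sub>i + t e\<^sub>j) - f (x + t e\<^sub>j)\<close> as the integral of \<open>\<partial>\<^sub>i f\<close> over a segment of length \<open>s\<close>;
  differentiate it in \<open>t\<close> under the integral, and the result in \<open>s\<close> at the left end point.
\<close>

lemma partial_deriv_commute:
  fixes f :: "real ^ 'n::finite \<Rightarrow> complex"
  assumes "smooth f"
  shows "partial_deriv i (partial_deriv j f) = partial_deriv j (partial_deriv i f)"
proof
  fix x
  let ?i = "axis i 1 :: real ^ 'n" and ?j = "axis j 1 :: real ^ 'n"
  define A where "A = partial_deriv j (partial_deriv i f)"
  have contA: "continuous_on UNIV A" unfolding A_def by (rule all_derivs_base, intro all_derivs_partial assms)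
  have ax: "axis_diff f" "axis_diff (partial_deriv i f)" "axis_diff (partial_deriv j f)"
    by (intro all_derivs_axis_diff[where B = "continuous_on UNIV"] all_derivs_partial assms)+
  have conti: "continuous_on UNIV (partial_deriv i f)"
    by (rule all_derivs_base, intro all_derivs_partial assms)
  have int: "partial_deriv j f (x + s *\<^sub>R ?i) - partial_deriv j f x = integral {0..s} (\<lambda>\<sigma>. A (x + \<sigma> *\<^sub>R ?i))"
    if "0 \<le> s" for s
  proof -
    have ftc: "f (x + t *\<^sub>R ?j + s *\<^sub>R ?i) - f (x + t *\<^sub>R ?j) =
        integral (cbox 0 s) (\<lambda>\<sigma>. partial_deriv i f (x + t *\<^sub>R ?j + \<sigma> *\<^sub>R ?i))" for t
    proof -
      have "((\<lambda>\<sigma>. partial_deriv i f (x + t *\<^sub>R ?j + \<sigma> *\<^sub>R ?i)) has_integral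
          (f (x + t *\<^sub>R ?j + s *\<^sub>R ?i) - f (x + t *\<^sub>R ?j + 0 *\<^sub>R ?i))) {0..s}"
        by (rule fundamental_theorem_of_calculus[OF that])
           (rule has_vector_derivative_at_within[OF axis_diff_has_vector_derivative[OF ax(1)]])
      then show ?thesis by (simp add: integral_unique)
    qed
    have "((\<lambda>t. integral (cbox 0 s) (\<lambda>\<sigma>. partial_deriv i f (x + t *\<^sub>R ?j + \<sigma> *\<^sub>R ?i)))
        has_vector_derivative integral (cbox 0 s) (\<lambda>\<sigma>. A (x + 0 *\<^sub>R ?j + \<sigma> *\<^sub>R ?i))) (at 0 within UNIV)"
    proof (rule leibniz_rule_vector_derivative[where U = UNIV and
          fx = "\<lambda>t \<sigma>. A (x + t *\<^sub>R ?j + \<sigma> *\<^sub>R ?i)"])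
      fix t \<sigma> :: real
      show "((\<lambda>t. partial_deriv i f (x + t *\<^sub>R ?j + \<sigma> *\<^sub>R ?i)) has_vector_derivative
          A (x + t *\<^sub>R ?j + \<sigma> *\<^sub>R ?i)) (at t within UNIV)"
        using axis_diff_has_vector_derivative[OF ax(2), of "x + \<sigma> *\<^sub>R ?i" j t]
        by (simp add: A_def add_ac)
    next
      fix t :: real
      show "(\<lambda>\<sigma>. partial_deriv i f (x + t *\<^sub>R ?j + \<sigma> *\<^sub>R ?i)) integrable_on cbox 0 s"
        by (intro integrable_continuous continuous_on_axis conti)
    next
      show "continuous_on (UNIV \<times> cbox 0 s) (\<lambda>(t, \<sigma>). A (x + t *\<^sub>R ?j + \<sigma> *\<^sub>R ?i))"
        unfolding split_beta
        by (rule continuous_on_compose2[OF contA]) (auto intro!: continuous_intros)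
    qed auto
    then have "((\<lambda>t. f (x + t *\<^sub>R ?j + s *\<^sub>R ?i) - f (x + t *\<^sub>R ?j)) has_vector_derivative
        integral {0..s} (\<lambda>\<sigma>. A (x + \<sigma> *\<^sub>R ?i))) (at 0)"
      unfolding ftc[symmetric] by simp
    moreover have "((\<lambda>t. f (x + t *\<^sub>R ?j + s *\<^sub>R ?i) - f (x + t *\<^sub>R ?j)) has_vector_derivative
        partial_deriv j f (x + s *\<^sub>R ?i) - partial_deriv j f x) (at 0)"
      using has_vector_derivative_diff[OF axis_diff_has_vector_derivative_0[OF ax(1), of "x + s *\<^sub>R ?i" j]
        axis_diff_has_vector_derivative_0[OF ax(1), of x j]] by (simp add: add_ac)
    ultimately show ?thesis by (rule vector_derivative_unique_at[symmetric])
  qed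
  have "((\<lambda>s. integral {0..s} (\<lambda>\<sigma>. A (x + \<sigma> *\<^sub>R ?i))) has_vector_derivative A (x + 0 *\<^sub>R ?i))
      (at 0 within {0..1})"
    by (rule integral_has_vector_derivative) (auto intro!: continuous_on_axis contA)
  then have "((\<lambda>s. integral {0..s} (\<lambda>\<sigma>. A (x + \<sigma> *\<^sub>R ?i))) has_vector_derivative A x)
      (at 0 within {0..1})" by simp
  then have "((\<lambda>s. partial_deriv j f (x + s *\<^sub>R ?i) - partial_deriv j f x) has_vector_derivative A x)
      (at 0 within {0..1})"
    by (rule has_vector_derivative_transform[rotated 2]) (auto simp: int)
  moreover have "((\<lambda>s. partial_deriv j f (x + s *\<^sub>R ?i) - partial_deriv j f x) has_vector_derivative
      partial_deriv i (partial_deriv j f) x) (at 0 within {0..1})"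
    using has_vector_derivative_diff[OF axis_diff_has_vector_derivative_0[OF ax(3), of x i]
       has_vector_derivative_const[of "partial_deriv j f x"]]
    by (auto intro: has_vector_derivative_at_within)
  ultimately show "partial_deriv i (partial_deriv j f) x = partial_deriv j (partial_deriv i f) x"
    unfolding A_def[symmetric]
    by (metis vector_derivative_unique_within_closed_interval[of 0 1 0] atLeastAtMost_iff cbox_interval
        order_refl zero_less_one zero_le_one)
qed

section \<open>Iterated partial derivatives\<close>

text \<open>
  A multi-index as a list of coordinates, so that iterated derivatives compose by appending lists and
  the induction is on lists.
\<close>

definition mi_list :: "('n::finite \<Rightarrow> nat) \<Rightarrow> 'n list"
  where "mi_list \<gamma> = concat (map (\<lambda>i. replicate (\<gamma> i) i) coords)"

lemma coords: "distinct (coords :: 'n::finite list)" "set (coords :: 'n list) = UNIV"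
proof -
  have "\<exists>xs :: 'n list. distinct xs \<and> set xs = UNIV"
    using finite_distinct_list[of "UNIV :: 'n set"] by auto
  from someI_ex[OF this] show "distinct (coords :: 'n list)" "set (coords :: 'n list) = UNIV"
    by (auto simp: coords_def)
qed

lemma mderiv_eq_fold: "mderiv \<gamma> = fold partial_deriv (mi_list \<gamma>)"
proof -
  have "fold (\<lambda>i. partial_deriv i ^^ \<gamma> i) xs = fold partial_deriv (concat (map (\<lambda>i. replicate (\<gamma> i) i) xs))" for xs
  proof (induction xs)
    case (Cons a xs)
    have "partial_deriv a ^^ k = fold partial_deriv (replicate k a)" for k
      by (induction k) (auto simp: funpow_swap1 fun_eq_iff)
    then show ?case using Cons by (simp add: fun_eq_iff)
  qed auto
  then show ?thesis by (simp add: mderiv_def mi_list_def)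
qed

lemma length_mi_list: "length (mi_list \<gamma>) = mi_order \<gamma>"
  using sum_list_distinct_conv_sum_set[of coords \<gamma>] coords[where 'n='a]
  by (simp add: mi_list_def mi_order_def length_concat o_def)

lemma mset_mi_list: "count (mset (mi_list \<gamma>)) i = \<gamma> i"
proof -
  have "count (mset (concat (map (\<lambda>i. replicate (\<gamma> i) i) xs))) i = (if i \<in> set xs then \<gamma> i else 0)"
    if "distinct xs" for xs
    using that by (induction xs) auto
  then show ?thesis using coords[where 'n='a] by (simp add: mi_list_def)
qed

lemma all_derivs_fold: "all_derivs B f \<Longrightarrow> all_derivs B (fold partial_deriv l f)"
  by (induction l arbitrary: f) (auto intro: all_derivs_partial)

lemma fold_partial_deriv_commute:
  assumes "smooth f"
  shows "fold partial_deriv l (partial_deriv i f) = partial_deriv i (fold partial_deriv l f)"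
  using assms
proof (induction l arbitrary: f)
  case (Cons a l)
  have "fold partial_deriv l (partial_deriv a (partial_deriv i f))
      = fold partial_deriv l (partial_deriv i (partial_deriv a f))"
    by (simp add: partial_deriv_commute[OF Cons.prems, of a i])
  also have "\<dots> = partial_deriv i (fold partial_deriv l (partial_deriv a f))"
    by (rule Cons.IH) (rule all_derivs_partial[OF Cons.prems])
  finally show ?case by simp
qed auto

text \<open>
  By the symmetry of second derivatives, the first coordinate of one list can be moved to the front of
  the other.
\<close>

lemma fold_partial_deriv_mset:
  assumes "smooth f" "mset l = mset l'"
  shows "fold partial_deriv l f = fold partial_deriv l' f"
  using assms
proof (induction l arbitrary: f l')
  case (Cons i l)
  from Cons.prems(2) have "i \<in> set l'" by (metis list.set_intros(1) set_mset_mset)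
  then obtain u v where l': "l' = u @ i # v" by (meson split_list)
  have "fold partial_deriv l (partial_deriv i f) = fold partial_deriv (u @ v) (partial_deriv i f)"
    by (rule Cons.IH) (use Cons.prems l' all_derivs_partial in auto)
  also have "\<dots> = fold partial_deriv l' f"
    using l' by (simp add: fold_partial_deriv_commute[OF Cons.prems(1)])
  finally show ?case by simp
qed auto

lemma smooth_iff_Cm: "smooth f \<longleftrightarrow> (\<forall>k. Cm k f)"
proof
  assume "smooth f"
  have "Cm k g" if "smooth g" for k g
    using that
  proof (induction k arbitrary: g)
    case 0 then show ?case using all_derivs_base[OF 0] by simp
  next
    case (Suc k)
    show ?case using all_derivsD[OF Suc.prems] Suc.IH by (auto simp: axis_diff_def)
  qed
  then show "\<forall>k. Cm k f" using \<open>smooth f\<close> by auto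
next
  assume "\<forall>k. Cm k f"
  then show "smooth f"
  proof (coinduction arbitrary: f)
    case (all_derivs f)
    then have "Cm (Suc k) f" for k by auto
    then show ?case by (intro exI[of _ f]) (auto simp: axis_diff_def)
  qed
qed

section \<open>Rapidly decreasing functions\<close>

definition decay :: "(real ^ 'n::finite \<Rightarrow> complex) \<Rightarrow> bool"
  where "decay f \<longleftrightarrow> continuous_on UNIV f \<and> (\<forall>k. \<exists>C. \<forall>x. norm x ^ k * norm (f x) \<le> C)"

abbreviation "rapid \<equiv> all_derivs decay"

lemma rapid_smooth: "rapid f \<Longrightarrow> smooth f"
  by (erule all_derivs_mono) (simp add: decay_def)

lemma norm_monomial_le: "\<bar>monomial \<alpha> x\<bar> \<le> norm x ^ mi_order \<alpha>"
proof -
  have "\<bar>monomial \<alpha> x\<bar> = (\<Prod>i\<in>UNIV. \<bar>x $ i\<bar> ^ \<alpha> i)"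
    by (simp add: monomial_def abs_prod power_abs)
  also have "\<dots> \<le> (\<Prod>i\<in>UNIV. norm x ^ \<alpha> i)"
    by (intro prod_mono conjI power_mono component_le_norm_cart) auto
  also have "\<dots> = norm x ^ mi_order \<alpha>" by (simp add: mi_order_def power_sum)
  finally show ?thesis .
qed

lemma norm_power_le_sum_components:
  fixes x :: "real ^ 'n::finite"
  shows "norm x ^ k \<le> real CARD('n) ^ k * (\<Sum>i\<in>UNIV. \<bar>x $ i\<bar> ^ k)"
proof -
  obtain j where j: "\<And>i. \<bar>x $ i\<bar> \<le> \<bar>x $ j\<bar>"
  proof -
    have "Max (range (\<lambda>i. \<bar>x $ i\<bar>)) \<in> range (\<lambda>i. \<bar>x $ i\<bar>)" by (rule Max_in) auto
    then obtain j where "Max (range (\<lambda>i. \<bar>x $ i\<bar>)) = \<bar>x $ j\<bar>" by (rule rangeE)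
    moreover have "\<bar>x $ i\<bar> \<le> Max (range (\<lambda>i. \<bar>x $ i\<bar>))" for i by (rule Max_ge) auto
    ultimately show ?thesis using that by metis
  qed
  have "norm x \<le> (\<Sum>i\<in>UNIV. \<bar>x $ i\<bar>)" by (rule norm_le_l1_cart)
  also have "\<dots> \<le> real CARD('n) * \<bar>x $ j\<bar>"
    using sum_bounded_above[of UNIV "\<lambda>i. \<bar>x $ i\<bar>" "\<bar>x $ j\<bar>"] j by auto
  finally have "norm x ^ k \<le> (real CARD('n) * \<bar>x $ j\<bar>) ^ k" by (intro power_mono) auto
  also have "\<dots> = real CARD('n) ^ k * \<bar>x $ j\<bar> ^ k" by (rule power_mult_distrib)
  also have "\<dots> \<le> real CARD('n) ^ k * (\<Sum>i\<in>UNIV. \<bar>x $ i\<bar> ^ k)"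
    by (intro mult_left_mono member_le_sum) auto
  finally show ?thesis .
qed

lemma monomial_single: "monomial (\<lambda>j. if j = i then k else 0) x = (x $ i) ^ k"
proof -
  have "(x $ j) ^ (if j = i then k else 0) = (if j = i then (x $ i) ^ k else 1)" for j by simp
  then show ?thesis by (simp add: monomial_def prod.delta)
qed

text \<open>
  Powers of single coordinates control every weight, since \<open>|x|\<^sup>k \<le> n\<^sup>k \<Sum>\<^sub>i |x\<^sub>i|\<^sup>k\<close>.
\<close>

lemma decay_if_bounded_components:
  fixes f :: "real ^ 'n::finite \<Rightarrow> complex"
  assumes "continuous_on UNIV f" "\<And>i k. \<exists>C. \<forall>x. \<bar>x $ i\<bar> ^ k * norm (f x) \<le> C"
  shows "decay f"
  unfolding decay_def
proof (intro conjI allI assms(1))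
  fix k
  have "\<exists>C. \<forall>x. \<bar>x $ i\<bar> ^ k * norm (f x) \<le> C" for i by (rule assms(2))
  then obtain C where C: "\<And>i x. \<bar>x $ i\<bar> ^ k * norm (f x) \<le> C i" by metis
  have "norm x ^ k * norm (f x) \<le> real CARD('n) ^ k * (\<Sum>i\<in>UNIV. C i)" for x
  proof -
    have "norm x ^ k * norm (f x) \<le> (real CARD('n) ^ k * (\<Sum>i\<in>UNIV. \<bar>x $ i\<bar> ^ k)) * norm (f x)"
      by (intro mult_right_mono norm_power_le_sum_components) auto
    also have "\<dots> = real CARD('n) ^ k * (\<Sum>i\<in>UNIV. \<bar>x $ i\<bar> ^ k * norm (f x))"
      by (simp add: sum_distrib_right mult.assoc)
    also have "\<dots> \<le> real CARD('n) ^ k * (\<Sum>i\<in>UNIV. C i)"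
      by (intro mult_left_mono sum_mono C) auto
    finally show ?thesis .
  qed
  then show "\<exists>C. \<forall>x. norm x ^ k * norm (f x) \<le> C" by blast
qed

text \<open>
  The Schwartz seminorms differentiate in one fixed order of the coordinates. Closure under \<open>\<partial>\<^sub>i\<close> is
  therefore the point of the second direction: \<open>\<partial>\<^sup>\<beta>\<partial>\<^sub>i = \<partial>\<^bsup>\<beta>+e\<^sub>i\<^esup>\<close> on smooth functions.
\<close>

lemma schwartz_iff_rapid: "\<phi> \<in> schwartz \<longleftrightarrow> rapid \<phi>"
proof
  assume r: "rapid \<phi>"
  have "bounded (range (\<lambda>x. monomial \<alpha> x *\<^sub>R mderiv \<beta> \<phi> x))" for \<alpha> \<beta>
  proof -
    have "decay (mderiv \<beta> \<phi>)" unfolding mderiv_eq_fold by (rule all_derivs_base[OF all_derivs_fold[OF r]])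
    then obtain C where C: "\<And>x. norm x ^ mi_order \<alpha> * norm (mderiv \<beta> \<phi> x) \<le> C"
      unfolding decay_def by metis
    have "norm (monomial \<alpha> x *\<^sub>R mderiv \<beta> \<phi> x) \<le> C" for x
      using mult_right_mono[OF norm_monomial_le norm_ge_zero, of \<alpha> x "mderiv \<beta> \<phi> x"] C[of x] by simp
    then show ?thesis by (auto simp: bounded_iff)
  qed
  then show "\<phi> \<in> schwartz" using rapid_smooth[OF r] by (auto simp: schwartz_def smooth_iff_Cm)
next
  assume "\<phi> \<in> schwartz"
  then show "rapid \<phi>"
  proof (coinduction arbitrary: \<phi>)
    case (all_derivs \<phi>)
    then have sm: "smooth \<phi>"
      and b: "\<And>\<alpha> \<beta>. bounded (range (\<lambda>x. monomial \<alpha> x *\<^sub>R mderiv \<beta> \<phi> x))"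
      by (auto simp: schwartz_def smooth_iff_Cm)
    have "mi_list (\<lambda>_::'a. 0) = []" using length_mi_list[of "\<lambda>_::'a. 0"] by (simp add: mi_order_def)
    then have b0: "bounded (range (\<lambda>x. monomial \<alpha> x *\<^sub>R \<phi> x))" for \<alpha>
      using b[of \<alpha> "\<lambda>_. 0"] by (simp add: mderiv_eq_fold)
    have "\<exists>C. \<forall>x. \<bar>x $ i\<bar> ^ k * norm (\<phi> x) \<le> C" for i k
      using b0[of "\<lambda>j. if j = i then k else 0"]
      by (auto simp: bounded_iff monomial_single power_abs)
    then have "decay \<phi>"
      by (intro decay_if_bounded_components all_derivs_base[OF sm])
    moreover have "partial_deriv i \<phi> \<in> schwartz" for i
    proof -
      have "mderiv \<beta> (partial_deriv i \<phi>) = mderiv (\<beta>(i := Suc (\<beta> i))) \<phi>" for \<beta>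
      proof -
        have "mset (i # mi_list \<beta>) = mset (mi_list (\<beta>(i := Suc (\<beta> i))))"
          by (rule multiset_eqI) (simp only: mset.simps count_add_mset mset_mi_list, simp)
        from fold_partial_deriv_mset[OF sm this] show ?thesis by (simp add: mderiv_eq_fold)
      qed
      then show ?thesis
        using b all_derivsD(3)[OF sm] by (auto simp: schwartz_def smooth_iff_Cm[symmetric])
    qed
    ultimately show ?case using all_derivsD(2)[OF sm] by auto
  qed
qed

text \<open>
  The hull of a class of functions under multiplication by coordinates and linear combinations. It
  contains the derivatives of a Gaussian, and those of a Schwartz function times a power of the symbol.
\<close>

inductive poly_span :: "((real ^ 'n \<Rightarrow> complex) \<Rightarrow> bool) \<Rightarrow> (real ^ 'n::finite \<Rightarrow> complex) \<Rightarrow> bool"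
  for A where
  base: "A f \<Longrightarrow> poly_span A f"
| coord: "poly_span A f \<Longrightarrow> poly_span A (\<lambda>x. of_real (x $ i) * f x)"
| scale: "poly_span A f \<Longrightarrow> poly_span A (\<lambda>x. c * f x)"
| add: "poly_span A f \<Longrightarrow> poly_span A g \<Longrightarrow> poly_span A (\<lambda>x. f x + g x)"

lemma decay_coord: "decay f \<Longrightarrow> decay (\<lambda>x. of_real (x $ i) * f x)"
  unfolding decay_def
proof (intro conjI allI; elim conjE)
  fix k
  assume "\<forall>k. \<exists>C. \<forall>x. norm x ^ k * norm (f x) \<le> C"
  then obtain C where C: "\<And>x. norm x ^ Suc k * norm (f x) \<le> C" by metis
  have "norm x ^ k * norm (of_real (x $ i) * f x) \<le> C" for x
  proof -
    have "norm x ^ k * norm (of_real (x $ i) * f x) = norm x ^ k * \<bar>x $ i\<bar> * norm (f x)"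
      by (simp add: norm_mult)
    also have "\<dots> \<le> norm x ^ k * norm x * norm (f x)"
      by (intro mult_right_mono mult_left_mono component_le_norm_cart) auto
    also have "\<dots> \<le> C" using C[of x] by (simp add: mult_ac)
    finally show ?thesis .
  qed
  then show "\<exists>C. \<forall>x. norm x ^ k * norm (of_real (x $ i) * f x) \<le> C" by blast
qed (auto intro!: continuous_intros)

lemma decay_scale: "decay f \<Longrightarrow> decay (\<lambda>x. c * f x)"
  unfolding decay_def
proof (intro conjI allI; elim conjE)
  fix k
  assume "\<forall>k. \<exists>C. \<forall>x. norm x ^ k * norm (f x) \<le> C"
  then obtain C where C: "\<And>x. norm x ^ k * norm (f x) \<le> C" by metis
  have "norm x ^ k * norm (c * f x) \<le> norm c * C" for x
    using mult_left_mono[OF C[of x] norm_ge_zero[of c]] by (simp add: norm_mult mult_ac)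
  then show "\<exists>C. \<forall>x. norm x ^ k * norm (c * f x) \<le> C" by blast
qed (auto intro!: continuous_intros)

lemma decay_add: "decay f \<Longrightarrow> decay g \<Longrightarrow> decay (\<lambda>x. f x + g x)"
  unfolding decay_def
proof (intro conjI allI; elim conjE)
  fix k
  assume "\<forall>k. \<exists>C. \<forall>x. norm x ^ k * norm (f x) \<le> C" "\<forall>k. \<exists>C. \<forall>x. norm x ^ k * norm (g x) \<le> C"
  then obtain C D where C: "\<And>x. norm x ^ k * norm (f x) \<le> C" and D: "\<And>x. norm x ^ k * norm (g x) \<le> D"
    by metis
  have "norm x ^ k * norm (f x + g x) \<le> C + D" for x
    using mult_left_mono[OF norm_triangle_ineq[of "f x" "g x"], of "norm x ^ k"] C[of x] D[of x]
    by (simp add: distrib_left)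
  then show "\<exists>C. \<forall>x. norm x ^ k * norm (f x + g x) \<le> C" by blast
qed (auto intro!: continuous_intros)

text \<open>
  If the first derivatives of the generators lie in the hull, then by the product rule the hull is
  closed under differentiation, and decay passes from the generators to the hull.
\<close>

lemma rapid_poly_span:
  assumes A: "\<And>f. A f \<Longrightarrow> decay f" "\<And>f. A f \<Longrightarrow> axis_diff f"
    "\<And>f i. A f \<Longrightarrow> poly_span A (partial_deriv i f)"
  shows "poly_span A f \<Longrightarrow> rapid f"
proof (coinduction arbitrary: f)
  case (all_derivs f)
  then have "decay f \<and> axis_diff f \<and> (\<forall>i. poly_span A (partial_deriv i f))"
  proof induction
    case (base f)
    then show ?case using A by blast
  next
    case (coord f j)
    have D: "((\<lambda>t. of_real ((x + t *\<^sub>R axis i 1) $ j) * f (x + t *\<^sub>R axis i 1)) has_vector_derivative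
        ((if i = j then 1 else 0) * f x + of_real (x $ j) * partial_deriv i f x)) (at 0)" for i x
    proof -
      have "((\<lambda>t. of_real ((x + t *\<^sub>R axis i 1) $ j) :: complex) has_vector_derivative
           of_real (if i = j then 1 else 0)) (at 0)"
        by (rule has_vector_derivative_of_real)
           (auto intro!: derivative_eq_intros simp: axis_def has_real_derivative_iff_has_vector_derivative[symmetric])
      from has_vector_derivative_mult[OF this axis_diff_has_vector_derivative_0[of f x i]] coord.IH
      show ?thesis by (auto simp: add_ac)
    qed
    show ?case
      unfolding axis_diffI(2)[OF D]
      using coord
      by (intro conjI allI decay_coord axis_diffI(1)[OF D] poly_span.add poly_span.scale poly_span.coord) auto
  next
    case (scale f c)
    have D: "((\<lambda>t. c * f (x + t *\<^sub>R axis i 1)) has_vector_derivative c * partial_deriv i f x) (at 0)" for i x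
      using has_vector_derivative_mult_right[OF axis_diff_has_vector_derivative_0[of f x i]] scale.IH by blast
    show ?case
      unfolding axis_diffI(2)[OF D]
      using scale
      by (intro conjI allI decay_scale axis_diffI(1)[OF D] poly_span.scale) auto
  next
    case (add f g)
    have D: "((\<lambda>t. f (x + t *\<^sub>R axis i 1) + g (x + t *\<^sub>R axis i 1)) has_vector_derivative
         partial_deriv i f x + partial_deriv i g x) (at 0)" for i x
      using has_vector_derivative_add axis_diff_has_vector_derivative_0 add.IH by blast
    show ?case
      unfolding axis_diffI(2)[OF D]
      using add
      by (intro conjI allI decay_add axis_diffI(1)[OF D] poly_span.add) auto
  qed
  then show ?case by auto
qed

lemma rapid_poly_span_rapid: "poly_span rapid f \<Longrightarrow> rapid f"
  by (erule rapid_poly_span[rotated -1]) (auto intro: poly_span.base all_derivs_partial all_derivs_axis_diff all_derivs_base)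

lemma rapid_coord: "rapid f \<Longrightarrow> rapid (\<lambda>x. of_real (x $ i) * f x)"
  and rapid_scale: "rapid f \<Longrightarrow> rapid (\<lambda>x. c * f x)"
  by (auto intro!: rapid_poly_span_rapid intro: poly_span.intros)

section \<open>Interchanging integrals and derivatives\<close>

lemma integrable_pairI:
  fixes f :: "'a \<Rightarrow> 'b \<Rightarrow> 'c::{banach, second_countable_topology}"
  assumes "sigma_finite_measure M2"
    and meas: "(\<lambda>(x, y). f x y) \<in> borel_measurable (M1 \<Otimes>\<^sub>M M2)"
    and fin: "(\<integral>\<^sup>+x. \<integral>\<^sup>+y. norm (f x y) \<partial>M2 \<partial>M1) < \<infinity>"
  shows "integrable (M1 \<Otimes>\<^sub>M M2) (\<lambda>(x, y). f x y)"
proof (rule integrableI_bounded[OF meas])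
  interpret sigma_finite_measure M2 by fact
  have "(\<integral>\<^sup>+z. norm (case z of (x, y) \<Rightarrow> f x y) \<partial>(M1 \<Otimes>\<^sub>M M2)) = (\<integral>\<^sup>+x. \<integral>\<^sup>+y. norm (f x y) \<partial>M2 \<partial>M1)"
    using meas by (subst nn_integral_fst[symmetric]) (auto intro!: measurable_compose[OF _ measurable_ennreal] borel_measurable_norm)
  with fin show "(\<integral>\<^sup>+z. norm (case z of (x, y) \<Rightarrow> f x y) \<partial>(M1 \<Otimes>\<^sub>M M2)) < \<infinity>" by simp
qed

lemma integral_swap:
  fixes f :: "'a \<Rightarrow> 'b \<Rightarrow> 'c::{banach, second_countable_topology}"
  assumes "sigma_finite_measure M1" "sigma_finite_measure M2"
    and "(\<lambda>(x, y). f x y) \<in> borel_measurable (M1 \<Otimes>\<^sub>M M2)"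
    and "(\<integral>\<^sup>+x. \<integral>\<^sup>+y. norm (f x y) \<partial>M2 \<partial>M1) < \<infinity>"
  shows "(\<integral>x. \<integral>y. f x y \<partial>M2 \<partial>M1) = (\<integral>y. \<integral>x. f x y \<partial>M1 \<partial>M2)"
proof -
  interpret pair_sigma_finite M1 M2 using assms by (simp add: pair_sigma_finite_def)
  show ?thesis by (rule Fubini_integral[symmetric]) (rule integrable_pairI assms)+
qed

text \<open>
  Differentiation under the integral sign with a uniform bound on the \<open>L\<^sup>1\<close> norms of the derivatives
  in place of a pointwise dominating function, as needed for kernels whose singularity moves with
  \<open>t\<close>. By Fubini's theorem the increments of the integral are integrals over \<open>t\<close> of the candidate
  derivative, which is continuous.
\<close>

lemma has_vector_derivative_lebesgue_integral:
  fixes k k' :: "real \<Rightarrow> 'w \<Rightarrow> complex"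
  assumes sf: "sigma_finite_measure M"
    and meas: "(\<lambda>(t, w). k' t w) \<in> borel_measurable (borel \<Otimes>\<^sub>M M)"
    and int: "\<And>t. integrable M (k t)"
    and der: "\<And>t w. w \<in> space M \<Longrightarrow> ((\<lambda>t. k t w) has_vector_derivative k' t w) (at t)"
    and contk': "\<And>w. w \<in> space M \<Longrightarrow> continuous_on UNIV (\<lambda>t. k' t w)"
    and bd: "\<And>t. (\<integral>\<^sup>+w. norm (k' t w) \<partial>M) \<le> ennreal B"
    and cont: "continuous_on UNIV (\<lambda>t. \<integral>w. k' t w \<partial>M)"
  shows "((\<lambda>t. \<integral>w. k t w \<partial>M) has_vector_derivative (\<integral>w. k' t w \<partial>M)) (at t)"
proof -
  define G where "G t = (\<integral>w. k' t w \<partial>M)" for t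
  define J where "J t = (\<integral>w. k t w \<partial>M)" for t
  have contG: "continuous_on S G" for S using cont continuous_on_subset unfolding G_def by blast
  have J: "J b = J a + integral {a..b} G" if ab: "a \<le> b" for a b
  proof -
    have "J b - J a = (\<integral>w. k b w - k a w \<partial>M)"
      unfolding J_def by (rule Bochner_Integration.integral_diff[symmetric]) (rule int)+
    also have "\<dots> = (\<integral>w. (\<integral>\<tau>. indicator {a..b} \<tau> *\<^sub>R k' \<tau> w \<partial>lborel) \<partial>M)"
    proof (rule Bochner_Integration.integral_cong[OF refl])
      fix w assume w: "w \<in> space M"
      show "k b w - k a w = (\<integral>\<tau>. indicator {a..b} \<tau> *\<^sub>R k' \<tau> w \<partial>lborel)"
        by (rule integral_FTC_Icc[OF ab, symmetric])
           (auto intro: has_vector_derivative_at_within der[OF w] continuous_on_subset[OF contk'[OF w]])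
    qed
    also have "\<dots> = (\<integral>\<tau>. (\<integral>w. indicator {a..b} \<tau> *\<^sub>R k' \<tau> w \<partial>M) \<partial>lborel)"
    proof (rule integral_swap[symmetric])
      show "(\<lambda>(\<tau>, w). indicator {a..b} \<tau> *\<^sub>R k' \<tau> w) \<in> borel_measurable (lborel \<Otimes>\<^sub>M M)"
      proof -
        have [measurable]: "(\<lambda>z. k' (fst z) (snd z)) \<in> borel_measurable (borel \<Otimes>\<^sub>M M)"
          using meas by (simp add: split_beta)
        have "(\<lambda>z. indicator {a..b} (fst z) *\<^sub>R k' (fst z) (snd z)) \<in> borel_measurable (borel \<Otimes>\<^sub>M M)"
          by measurable
        then show ?thesis by (simp add: split_beta cong: measurable_cong_sets sets_pair_measure_cong)
      qed
      have "(\<integral>\<^sup>+\<tau>. \<integral>\<^sup>+w. norm (indicator {a..b} \<tau> *\<^sub>R k' \<tau> w) \<partial>M \<partial>lborel)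
          \<le> (\<integral>\<^sup>+\<tau>. ennreal B * indicator {a..b} \<tau> \<partial>lborel)"
        using bd by (intro nn_integral_mono) (auto simp: indicator_def)
      also have "\<dots> = ennreal B * ennreal (b - a)" using ab by (subst nn_integral_cmult_indicator) auto
      also have "\<dots> < \<infinity>" by (simp add: ennreal_mult_less_top)
      finally show "(\<integral>\<^sup>+\<tau>. \<integral>\<^sup>+w. norm (indicator {a..b} \<tau> *\<^sub>R k' \<tau> w) \<partial>M \<partial>lborel) < \<infinity>" .
    qed (auto intro: sf sigma_finite_lborel)
    also have "\<dots> = (\<integral>\<tau>. indicator {a..b} \<tau> *\<^sub>R G \<tau> \<partial>lborel)" by (simp add: G_def)
    also have "\<dots> = integral {a..b} G"
      using set_borel_integral_eq_integral(2)[of "{a..b}" G]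
        borel_integrable_atLeastAtMost'[OF contG, of a b]
      by (simp add: set_lebesgue_integral_def)
    finally show ?thesis by (simp add: algebra_simps)
  qed
  \<comment> \<open>Any interval with \<open>t\<close> in its interior turns the one-sided increments into a two-sided derivative.\<close>
  have "((\<lambda>u. integral {t-1..u} G) has_vector_derivative G t) (at t within {t-1..t+1})"
    by (rule integral_has_vector_derivative) (auto intro: contG)
  then have "((\<lambda>u. J (t-1) + integral {t-1..u} G) has_vector_derivative G t) (at t within {t-1..t+1})"
    by (auto intro!: derivative_eq_intros)
  then have "(J has_vector_derivative G t) (at t within {t-1..t+1})"
    by (rule has_vector_derivative_transform[rotated 2]) (auto intro: J)
  moreover have "at t within {t-1..t+1} = at t" by (rule at_within_interior) simp
  ultimately show ?thesis unfolding J_def[abs_def] G_def by (simp only:)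
qed

section \<open>Lebesgue measure and integration by parts\<close>

lemma lborel_integral_plus:
  fixes f :: "real ^ 'n::finite \<Rightarrow> 'b::{banach, second_countable_topology}"
  assumes "f \<in> borel_measurable borel"
  shows "(\<integral>x. f (x + c) \<partial>lborel) = (\<integral>x. f x \<partial>lborel)"
proof -
  have "(\<integral>x. f x \<partial>lborel) = (\<integral>x. f x \<partial>distr lborel borel ((+) c))" by (simp only: lborel_distr_plus)
  also have "\<dots> = (\<integral>x. f (c + x) \<partial>lborel)" using assms by (intro integral_distr) auto
  finally show ?thesis by (simp add: add.commute)
qed

lemma lborel_nn_integral_plus:
  fixes f :: "real ^ 'n::finite \<Rightarrow> ennreal"
  assumes "f \<in> borel_measurable borel"
  shows "(\<integral>\<^sup>+x. f (x + c) \<partial>lborel) = (\<integral>\<^sup>+x. f x \<partial>lborel)"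
proof -
  have "(\<integral>\<^sup>+x. f x \<partial>lborel) = (\<integral>\<^sup>+x. f x \<partial>distr lborel borel ((+) c))" by (simp only: lborel_distr_plus)
  also have "\<dots> = (\<integral>\<^sup>+x. f (c + x) \<partial>lborel)" using assms by (intro nn_integral_distr) auto
  finally show ?thesis by (simp add: add.commute)
qed

lemma lborel_integrable_plus:
  fixes f :: "real ^ 'n::finite \<Rightarrow> 'b::{banach, second_countable_topology}"
  assumes "integrable lborel f"
  shows "integrable lborel (\<lambda>x. f (x + c))"
proof -
  have "integrable (distr lborel borel ((+) c)) f" using assms by (simp only: lborel_distr_plus)
  then have "integrable lborel (\<lambda>x. f (c + x))" by (rule integrable_distr[rotated]) auto
  then show ?thesis by (simp add: add.commute)
qed

lemma lborel_nn_integral_minus: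
  fixes f :: "real ^ 'n::finite \<Rightarrow> ennreal"
  assumes "f \<in> borel_measurable borel"
  shows "(\<integral>\<^sup>+x. f (c - x) \<partial>lborel) = (\<integral>\<^sup>+x. f x \<partial>lborel)"
proof -
  have "(\<integral>\<^sup>+x. f x \<partial>lborel)
      = (\<integral>\<^sup>+x. f x \<partial>density (distr lborel borel (\<lambda>x. c + (-1) *\<^sub>R x)) (\<lambda>x. ennreal (\<bar>-1\<bar> ^ DIM(real ^ 'n))))"
    by (subst lborel_affine[of "-1" c]) simp_all
  also have "\<dots> = (\<integral>\<^sup>+x. f x \<partial>distr lborel borel (\<lambda>x. c + (-1) *\<^sub>R x))"
    using assms by (subst nn_integral_density) auto
  also have "\<dots> = (\<integral>\<^sup>+x. f (c + (-1) *\<^sub>R x) \<partial>lborel)" using assms by (intro nn_integral_distr) auto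
  finally show ?thesis by simp
qed

lemma lborel_integral_affine:
  fixes f :: "real ^ 'n::finite \<Rightarrow> 'b::{banach, second_countable_topology}"
  assumes "c \<noteq> 0" and [measurable]: "f \<in> borel_measurable borel"
  shows "(\<integral>x. f x \<partial>lborel) = \<bar>c\<bar> ^ CARD('n) *\<^sub>R (\<integral>x. f (t + c *\<^sub>R x) \<partial>lborel)"
proof -
  have "(\<integral>x. f x \<partial>lborel)
      = (\<integral>x. f x \<partial>density (distr lborel borel (\<lambda>x. t + c *\<^sub>R x)) (\<lambda>x. ennreal (\<bar>c\<bar> ^ CARD('n))))"
    by (subst lborel_affine[OF assms(1), of t]) simp
  also have "\<dots> = (\<integral>x. \<bar>c\<bar> ^ CARD('n) *\<^sub>R f x \<partial>distr lborel borel (\<lambda>x. t + c *\<^sub>R x))"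
    by (rule integral_density) auto
  also have "\<dots> = (\<integral>x. \<bar>c\<bar> ^ CARD('n) *\<^sub>R f (t + c *\<^sub>R x) \<partial>lborel)"
    by (rule integral_distr) auto
  finally show ?thesis by simp
qed

text \<open>
  By translation invariance \<open>\<integral> F (x + t e\<^sub>i) dx\<close> is constant in \<open>t\<close>, and the claim is that its
  derivative vanishes. This is integration by parts on the whole space.
\<close>

lemma integral_partial_deriv:
  fixes F :: "real ^ 'n::finite \<Rightarrow> complex"
  assumes ax: "axis_diff F" and int: "integrable lborel F" "integrable lborel (partial_deriv i F)"
    and cont: "continuous_on UNIV (partial_deriv i F)"
  shows "(\<integral>x. partial_deriv i F x \<partial>lborel) = 0"
proof -
  let ?e = "axis i 1 :: real ^ 'n"
  have [measurable]: "partial_deriv i F \<in> borel_measurable borel"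
    using cont by (rule borel_measurable_continuous_onI)
  have Fm: "F \<in> borel_measurable borel" using borel_measurable_integrable[OF int(1)] by simp
  have "((\<lambda>t. \<integral>x. F (x + t *\<^sub>R ?e) \<partial>lborel) has_vector_derivative
     (\<integral>x. partial_deriv i F (x + 0 *\<^sub>R ?e) \<partial>lborel)) (at 0)"
  proof (rule has_vector_derivative_lebesgue_integral[where B = "\<integral>x. norm (partial_deriv i F x) \<partial>lborel"])
    show "(\<lambda>(t, x). partial_deriv i F (x + t *\<^sub>R ?e)) \<in> borel_measurable (borel \<Otimes>\<^sub>M lborel)"
      by measurable
    show "integrable lborel (\<lambda>x. F (x + t *\<^sub>R ?e))" for t by (rule lborel_integrable_plus[OF int(1)])
    show "((\<lambda>t. F (x + t *\<^sub>R ?e)) has_vector_derivative partial_deriv i F (x + t *\<^sub>R ?e)) (at t)" for t x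
      by (rule axis_diff_has_vector_derivative[OF ax])
    show "continuous_on UNIV (\<lambda>t. partial_deriv i F (x + t *\<^sub>R ?e))" for x
      by (rule continuous_on_axis[OF cont])
    show "(\<integral>\<^sup>+x. norm (partial_deriv i F (x + t *\<^sub>R ?e)) \<partial>lborel) \<le> ennreal (\<integral>x. norm (partial_deriv i F x) \<partial>lborel)" for t
      using lborel_nn_integral_plus[of "\<lambda>x. norm (partial_deriv i F x)" "t *\<^sub>R ?e"] int(2)
      by (simp add: nn_integral_eq_integral)
    show "continuous_on UNIV (\<lambda>t. \<integral>x. partial_deriv i F (x + t *\<^sub>R ?e) \<partial>lborel)"
      unfolding lborel_integral_plus[OF \<open>partial_deriv i F \<in> borel_measurable borel\<close>]
      by (rule continuous_on_const)
  qed (rule sigma_finite_lborel)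
  then have "((\<lambda>t::real. \<integral>x. F x \<partial>lborel) has_vector_derivative (\<integral>x. partial_deriv i F x \<partial>lborel)) (at 0)"
    by (simp only: lborel_integral_plus[OF Fm] scaleR_zero_left add_0_right)
  from vector_derivative_unique_at[OF this has_vector_derivative_const] show ?thesis .
qed

section \<open>Integrability of rapidly decreasing functions\<close>

lemma decay_bounded: "decay f \<Longrightarrow> \<exists>C. \<forall>x. norm (f x) \<le> C"
proof -
  assume "decay f"
  then obtain C where "\<forall>x. norm x ^ 0 * norm (f x) \<le> C" unfolding decay_def by blast
  then show ?thesis by auto
qed

lemma decay_bound:
  assumes "decay f"
  shows "\<exists>C\<ge>0. \<forall>x. norm (f x) \<le> C / (1 + (norm x)\<^sup>2) ^ N"
proof -
  obtain A B where A: "\<And>x. norm x ^ 0 * norm (f x) \<le> A" and B: "\<And>x. norm x ^ (2 * N) * norm (f x) \<le> B"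
    using assms unfolding decay_def by blast
  have "norm (f x) \<le> (2 ^ N * (A + B)) / (1 + (norm x)\<^sup>2) ^ N" for x
  proof -
    have "(1 + (norm x)\<^sup>2) ^ N \<le> (2 * max 1 ((norm x)\<^sup>2)) ^ N" by (intro power_mono) auto
    also have "\<dots> \<le> 2 ^ N * (1 + norm x ^ (2 * N))"
      by (auto simp: power_mult_distrib max_def power_mult)
    finally have "(1 + (norm x)\<^sup>2) ^ N * norm (f x) \<le> 2 ^ N * (1 + norm x ^ (2 * N)) * norm (f x)"
      by (rule mult_right_mono) auto
    also have "\<dots> = 2 ^ N * (norm x ^ 0 * norm (f x) + norm x ^ (2 * N) * norm (f x))"
      by (simp add: algebra_simps)
    also have "\<dots> \<le> 2 ^ N * (A + B)" by (intro mult_left_mono add_mono A B) auto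
    finally show ?thesis by (simp add: field_simps add_pos_nonneg)
  qed
  moreover have "0 \<le> A" "0 \<le> B"
    by (rule order_trans[OF _ A[of 0]], simp) (rule order_trans[OF _ B[of 0]], simp)
  then have "0 \<le> 2 ^ N * (A + B)" by simp
  ultimately show ?thesis by blast
qed

text \<open>
  Since \<open>\<Prod>\<^sub>i (1 + x\<^sub>i\<^sup>2) \<le> (1 + |x|\<^sup>2)\<^sup>n\<close>, the integral is at most a product of one-dimensional ones.
\<close>

lemma integrable_inverse_power:
  "integrable lborel (\<lambda>x :: real ^ 'n::finite. 1 / (1 + (norm x)\<^sup>2) ^ CARD('n))"
proof (rule integrableI_bounded)
  have fin: "(\<integral>\<^sup>+t. ennreal (1 / (1 + t\<^sup>2)) \<partial>lborel) < \<infinity>"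
    using integrable_inverse_1_plus_square
    by (auto simp: integrable_iff_bounded set_integrable_def inverse_eq_divide)
  have "(\<integral>\<^sup>+x. norm (1 / (1 + (norm (x :: real ^ 'n))\<^sup>2) ^ CARD('n)) \<partial>lborel)
      \<le> (\<integral>\<^sup>+x. (\<Prod>b\<in>Basis. ennreal (1 / (1 + ((x :: real ^ 'n) \<bullet> b)\<^sup>2))) \<partial>lborel)"
  proof (rule nn_integral_mono)
    fix x :: "real ^ 'n"
    have "(\<Prod>b\<in>(Basis :: (real ^ 'n) set). 1 + (x \<bullet> b)\<^sup>2) \<le> (\<Prod>b\<in>(Basis :: (real ^ 'n) set). 1 + (norm x)\<^sup>2)"
      by (intro prod_mono) (auto simp: power2_le_iff_abs_le Basis_le_norm)
    also have "\<dots> = (1 + (norm x)\<^sup>2) ^ CARD('n)" by simp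
    finally have "1 / (1 + (norm x)\<^sup>2) ^ CARD('n) \<le> 1 / (\<Prod>b\<in>(Basis :: (real ^ 'n) set). 1 + (x \<bullet> b)\<^sup>2)"
      by (intro divide_left_mono mult_pos_pos prod_pos) (auto simp: add_pos_nonneg)
    then show "ennreal (norm (1 / (1 + (norm x)\<^sup>2) ^ CARD('n))) \<le> (\<Prod>b\<in>Basis. ennreal (1 / (1 + (x \<bullet> b)\<^sup>2)))"
      by (subst prod_ennreal) (auto simp: prod_dividef intro!: ennreal_leI)
  qed
  also have "\<dots> = (\<Prod>b\<in>(Basis :: (real ^ 'n) set). \<integral>\<^sup>+t. ennreal (1 / (1 + t\<^sup>2)) \<partial>lborel)"
    by (rule nn_integral_lborel_prod) auto
  also have "\<dots> < \<infinity>" using fin by (simp add: power_less_top_ennreal)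
  finally show "(\<integral>\<^sup>+x. norm (1 / (1 + (norm (x :: real ^ 'n))\<^sup>2) ^ CARD('n)) \<partial>lborel) < \<infinity>" .
qed measurable

lemma decay_integrable:
  assumes "decay f"
  shows "integrable lborel f"
proof -
  obtain C where C: "\<And>x. norm (f x) \<le> C / (1 + (norm x)\<^sup>2) ^ CARD('a)"
    using decay_bound[OF assms] by metis
  show ?thesis
  proof (rule Bochner_Integration.integrable_bound)
    show "integrable lborel (\<lambda>x::real^'a. C * (1 / (1 + (norm x)\<^sup>2) ^ CARD('a)))"
      by (intro integrable_mult_right integrable_inverse_power)
    show "f \<in> borel_measurable lborel"
      using assms by (auto simp: decay_def intro: borel_measurable_continuous_onI)
    show "AE x in lborel. norm (f x) \<le> norm (C * (1 / (1 + (norm x)\<^sup>2) ^ CARD('a)))"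
    proof (rule AE_I2)
      fix x
      have "norm (f x) \<le> C * (1 / (1 + (norm x)\<^sup>2) ^ CARD('a))" using C[of x] by simp
      then show "norm (f x) \<le> norm (C * (1 / (1 + (norm x)\<^sup>2) ^ CARD('a)))"
        using abs_ge_self by (metis order_trans real_norm_def)
    qed
  qed
qed

lemma decay_measurable: "decay f \<Longrightarrow> f \<in> borel_measurable borel"
  by (simp add: decay_def borel_measurable_continuous_onI)

section \<open>The Fourier transform\<close>

lemma measurable_cis [measurable]: "cis \<in> borel_measurable borel"
  by (intro borel_measurable_continuous_onI continuous_on_cis continuous_on_id)

lemma measurable_vec_nth [measurable]: "(\<lambda>x :: real ^ 'n::finite. x $ i) \<in> borel_measurable borel"
  by (intro borel_measurable_continuous_onI continuous_intros)

text \<open>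
  The Fourier transform for \<open>\<sigma> = -1\<close> and its inverse for \<open>\<sigma> = 1\<close>, so that each property is proved
  for both at once.
\<close>

definition FT :: "real \<Rightarrow> (real ^ 'n::finite \<Rightarrow> complex) \<Rightarrow> real ^ 'n \<Rightarrow> complex"
  where "FT \<sigma> f \<xi> = (\<integral>x. f x * cis (2 * pi * \<sigma> * (x \<bullet> \<xi>)) \<partial>lborel)"

lemma fourier_eq_FT: "fourier = FT (-1)" and inv_fourier_eq_FT: "inv_fourier = FT 1"
  by (auto simp: fun_eq_iff fourier_def inv_fourier_def FT_def cis_conv_exp mult_ac inner_commute)

lemma FT_integrable:
  fixes f :: "real ^ 'n::finite \<Rightarrow> complex"
  assumes "integrable lborel f"
  shows "integrable lborel (\<lambda>x. f x * cis (c * (x \<bullet> \<xi>)))"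
  using borel_measurable_integrable[OF assms]
  by (intro Bochner_Integration.integrable_bound[OF assms]) (auto simp: norm_mult)

lemma FT_bound:
  assumes "integrable lborel f"
  shows "norm (FT \<sigma> f \<xi>) \<le> (\<integral>x. norm (f x) \<partial>lborel)"
proof -
  have "norm (FT \<sigma> f \<xi>) \<le> (\<integral>x. norm (f x * cis (2 * pi * \<sigma> * (x \<bullet> \<xi>))) \<partial>lborel)"
    unfolding FT_def by (rule integral_norm_bound)
  then show ?thesis by (simp add: norm_mult)
qed

lemma FT_continuous:
  fixes f :: "real ^ 'n::finite \<Rightarrow> complex"
  assumes f: "integrable lborel f"
  shows "continuous_on UNIV (FT \<sigma> f)"
proof (rule continuous_on_sequentiallyI)
  fix u :: "nat \<Rightarrow> real ^ 'n" and \<xi>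
  assume u: "u \<longlonglongrightarrow> \<xi>"
  have [measurable]: "f \<in> borel_measurable borel" using borel_measurable_integrable[OF f] by simp
  show "(\<lambda>k. FT \<sigma> f (u k)) \<longlonglongrightarrow> FT \<sigma> f \<xi>"
    unfolding FT_def
  proof (rule integral_dominated_convergence[where w = "\<lambda>x. norm (f x)"])
    show "AE x in lborel. (\<lambda>k. f x * cis (2 * pi * \<sigma> * (x \<bullet> u k))) \<longlonglongrightarrow> f x * cis (2 * pi * \<sigma> * (x \<bullet> \<xi>))"
    proof (rule AE_I2)
      fix x
      have "isCont (\<lambda>\<eta>. f x * cis (2 * pi * \<sigma> * (x \<bullet> \<eta>))) \<xi>"
        by (rule continuous_on_interior[of UNIV]) (auto intro!: continuous_intros continuous_on_cis)
      from isCont_tendsto_compose[OF this u]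
      show "(\<lambda>k. f x * cis (2 * pi * \<sigma> * (x \<bullet> u k))) \<longlonglongrightarrow> f x * cis (2 * pi * \<sigma> * (x \<bullet> \<xi>))" .
    qed
  qed (use f in \<open>auto simp: norm_mult\<close>)
qed

lemma cis_affine_has_vector_derivative:
  "((\<lambda>t. cis (A + B * t)) has_vector_derivative of_real B * \<i> * cis (A + B * t)) (at t)"
proof -
  have "((\<lambda>z. exp (\<i> * (of_real A + of_real B * z))) has_field_derivative
      of_real B * \<i> * exp (\<i> * (of_real A + of_real B * of_real t))) (at (of_real t))"
    by (auto intro!: derivative_eq_intros)
  from has_vector_derivative_real_field[OF this] show ?thesis by (simp add: cis_conv_exp)
qed

lemma FT_has_derivative:
  fixes f :: "real ^ 'n::finite \<Rightarrow> complex"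
  assumes f: "integrable lborel f" and xf: "integrable lborel (\<lambda>x. of_real (x $ i) * f x)"
  shows "((\<lambda>t. FT \<sigma> f (\<xi> + t *\<^sub>R axis i 1)) has_vector_derivative
      FT \<sigma> (\<lambda>x. (of_real (2 * pi * \<sigma>) * \<i>) * (of_real (x $ i) * f x)) \<xi>) (at 0)"
proof -
  have [measurable]: "f \<in> borel_measurable borel" using borel_measurable_integrable[OF f] by simp
  have g: "integrable lborel (\<lambda>x. (of_real (2 * pi * \<sigma>) * \<i>) * (of_real (x $ i) * f x))"
    by (intro integrable_mult_right xf)
  let ?c = "2 * pi * \<sigma>"
  let ?k' = "\<lambda>t x. (of_real ?c * \<i>) * (of_real (x $ i) * f x) * cis (?c * (x \<bullet> (\<xi> + t *\<^sub>R axis i 1)))"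
  have "((\<lambda>t. \<integral>x. f x * cis (?c * (x \<bullet> (\<xi> + t *\<^sub>R axis i 1))) \<partial>lborel) has_vector_derivative
     (\<integral>x. ?k' 0 x \<partial>lborel)) (at 0)"
  proof (rule has_vector_derivative_lebesgue_integral[where k' = ?k' and
        B = "\<integral>x. norm ((of_real ?c * \<i>) * (of_real (x $ i) * f x)) \<partial>lborel"])
    have "(\<lambda>(t, x). ?k' t x) \<in> borel_measurable (borel \<Otimes>\<^sub>M borel)" by measurable
    then show "(\<lambda>(t, x). ?k' t x) \<in> borel_measurable (borel \<Otimes>\<^sub>M lborel)"
      by (simp cong: measurable_cong_sets sets_pair_measure_cong)
    show "integrable lborel (\<lambda>x. f x * cis (?c * (x \<bullet> (\<xi> + t *\<^sub>R axis i 1))))" for t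
      by (rule FT_integrable[OF f])
    show "((\<lambda>t. f x * cis (?c * (x \<bullet> (\<xi> + t *\<^sub>R axis i 1)))) has_vector_derivative ?k' t x) (at t)" for t x
      using has_vector_derivative_mult_right[OF cis_affine_has_vector_derivative[of "?c * (x \<bullet> \<xi>)" "?c * x $ i" t], of "f x"]
      by (simp add: inner_add_right inner_axis algebra_simps)
    show "continuous_on UNIV (\<lambda>t. ?k' t x)" for x
      by (intro continuous_intros continuous_on_cis)
    show "(\<integral>\<^sup>+x. norm (?k' t x) \<partial>lborel) \<le> ennreal (\<integral>x. norm ((of_real ?c * \<i>) * (of_real (x $ i) * f x)) \<partial>lborel)" for t
      using nn_integral_eq_integral[OF integrable_norm[OF g]] by (simp add: norm_mult)
    have "continuous_on UNIV (\<lambda>t. FT \<sigma> (\<lambda>x. (of_real ?c * \<i>) * (of_real (x $ i) * f x)) (\<xi> + t *\<^sub>R axis i 1))"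
      by (rule continuous_on_axis[OF FT_continuous[OF g]])
    then show "continuous_on UNIV (\<lambda>t. \<integral>x. ?k' t x \<partial>lborel)" by (simp only: FT_def)
  qed (rule sigma_finite_lborel)
  then show ?thesis by (simp add: FT_def)
qed

lemma rapid_integrable: "rapid f \<Longrightarrow> integrable lborel f"
  by (rule decay_integrable) (rule all_derivs_base)

text \<open>
  The product of \<open>f\<close> and the exponential is differentiated and integrated over the whole space.
\<close>

lemma FT_partial_deriv:
  fixes f :: "real ^ 'n::finite \<Rightarrow> complex"
  assumes f: "rapid f"
  shows "FT \<sigma> (partial_deriv i f) \<xi> = - (of_real (2 * pi * \<sigma>) * \<i>) * of_real (\<xi> $ i) * FT \<sigma> f \<xi>"
proof -
  let ?c = "2 * pi * \<sigma>"
  let ?E = "\<lambda>x. cis (?c * (x \<bullet> \<xi>))"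
  let ?F = "\<lambda>x. f x * ?E x"
  let ?D = "\<lambda>x. f x * (of_real (?c * \<xi> $ i) * \<i> * ?E x) + partial_deriv i f x * ?E x"
  have f': "rapid (partial_deriv i f)" by (rule all_derivs_partial[OF f])
  have D: "((\<lambda>t. ?F (x + t *\<^sub>R axis j 1)) has_vector_derivative
      f x * (of_real (?c * \<xi> $ j) * \<i> * ?E x) + partial_deriv j f x * ?E x) (at 0)" for x j
  proof -
    have "((\<lambda>t. ?E (x + t *\<^sub>R axis j 1)) has_vector_derivative of_real (?c * \<xi> $ j) * \<i> * ?E x) (at 0)"
      using cis_affine_has_vector_derivative[of "?c * (x \<bullet> \<xi>)" "?c * \<xi> $ j" 0]
      by (simp add: inner_add_left inner_axis' algebra_simps)
    from has_vector_derivative_mult[OF axis_diff_has_vector_derivative_0[OF all_derivs_axis_diff[OF f]] this]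
    show ?thesis by simp
  qed
  have int1: "integrable lborel (\<lambda>x. f x * ?E x)" by (intro FT_integrable rapid_integrable f)
  have int2: "integrable lborel (\<lambda>x. partial_deriv i f x * ?E x)" by (intro FT_integrable rapid_integrable f')
  have int1': "integrable lborel (\<lambda>x. of_real (?c * \<xi> $ i) * \<i> * (f x * ?E x))"
    by (rule integrable_mult_right[OF int1])
  have pd: "partial_deriv i ?F = (\<lambda>x. of_real (?c * \<xi> $ i) * \<i> * (f x * ?E x) + partial_deriv i f x * ?E x)"
    using axis_diffI(2)[OF D] by (simp add: fun_eq_iff mult_ac)
  have "(\<integral>x. partial_deriv i ?F x \<partial>lborel) = 0"
  proof (rule integral_partial_deriv)
    show "axis_diff ?F" by (rule axis_diffI(1)[OF D])
    show "integrable lborel (partial_deriv i ?F)"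
      unfolding pd by (intro Bochner_Integration.integrable_add int1' int2)
    have "continuous_on UNIV f" "continuous_on UNIV (partial_deriv i f)"
      using f f' all_derivs_base[OF rapid_smooth] by blast+
    then show "continuous_on UNIV (partial_deriv i ?F)"
      unfolding pd by (intro continuous_intros continuous_on_cis)
  qed (rule int1)
  then have "of_real (?c * \<xi> $ i) * \<i> * FT \<sigma> f \<xi> + FT \<sigma> (partial_deriv i f) \<xi> = 0"
    unfolding pd FT_def by (subst (asm) Bochner_Integration.integral_add[OF int1' int2]) simp
  then show ?thesis by (simp add: algebra_simps add_eq_0_iff)
qed

text \<open>
  Each factor \<open>\<xi>\<^sub>i\<close> in front of the transform is traded for a derivative of \<open>f\<close>, up to the constant
  \<open>2\<pi>\<sigma>\<close>.
\<close>

lemma FT_decay: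
  assumes "\<sigma> \<noteq> 0" "rapid f"
  shows "decay (FT \<sigma> f)"
proof (rule decay_if_bounded_components)
  show "continuous_on UNIV (FT \<sigma> f)" by (intro FT_continuous rapid_integrable assms)
  show "\<exists>C. \<forall>\<xi>. \<bar>\<xi> $ i\<bar> ^ k * norm (FT \<sigma> f \<xi>) \<le> C" for i k
    using assms(2)
  proof (induction k arbitrary: f)
    case 0
    then show ?case using FT_bound[OF rapid_integrable] by auto
  next
    case (Suc k)
    obtain C where C: "\<And>\<xi>. \<bar>\<xi> $ i\<bar> ^ k * norm (FT \<sigma> (partial_deriv i f) \<xi>) \<le> C"
      using Suc.IH[OF all_derivs_partial[OF Suc.prems]] by metis
    have "\<bar>\<xi> $ i\<bar> ^ Suc k * norm (FT \<sigma> f \<xi>) \<le> C / (2 * pi * \<bar>\<sigma>\<bar>)" for \<xi>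
    proof -
      have "2 * pi * \<bar>\<sigma>\<bar> * (\<bar>\<xi> $ i\<bar> ^ Suc k * norm (FT \<sigma> f \<xi>)) = \<bar>\<xi> $ i\<bar> ^ k * norm (FT \<sigma> (partial_deriv i f) \<xi>)"
        by (simp add: FT_partial_deriv[OF Suc.prems] norm_mult abs_mult)
      also have "\<dots> \<le> C" by (rule C)
      finally show ?thesis using assms(1) by (simp add: field_simps)
    qed
    then show ?case by blast
  qed
qed

text \<open>
  A partial derivative of a transform is the transform of \<open>f\<close> times a coordinate, which is again
  rapidly decreasing; this is the step of the coinduction.
\<close>

lemma FT_rapid:
  assumes "\<sigma> \<noteq> 0" "rapid f"
  shows "rapid (FT \<sigma> f)"
  using assms(2)
proof (coinduction arbitrary: f)
  case (all_derivs f)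
  note D = FT_has_derivative[OF rapid_integrable[OF all_derivs] rapid_integrable[OF rapid_coord[OF all_derivs]], where \<sigma> = \<sigma>]
  have "axis_diff (FT \<sigma> f)" by (rule axis_diffI(1)[OF D])
  moreover have "partial_deriv i (FT \<sigma> f) = FT \<sigma> (\<lambda>x. (of_real (2 * pi * \<sigma>) * \<i>) * (of_real (x $ i) * f x))" for i
    by (rule axis_diffI(2)[OF D])
  moreover have "rapid (\<lambda>x. (of_real (2 * pi * \<sigma>) * \<i>) * (of_real (x $ i) * f x))" for i
    by (intro rapid_scale rapid_coord all_derivs)
  ultimately show ?case using FT_decay[OF assms(1) all_derivs] by (intro exI[of _ "FT \<sigma> f"]) blast
qed

section \<open>Gaussians and Fourier inversion\<close>

text \<open>
  The heat kernel at time \<open>r\<close>, the Fourier transform of \<open>exp (-4\<pi>\<^sup>2r|\<xi>|\<^sup>2)\<close>.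
\<close>

definition heat :: "real \<Rightarrow> real ^ 'n::finite \<Rightarrow> complex"
  where "heat r x = of_real ((4 * pi * r) powr (- real CARD('n) / 2) * exp (- (norm x)\<^sup>2 / (4 * r)))"

lemma power_le_exp: "0 \<le> y \<Longrightarrow> y ^ k \<le> real k ^ k * exp (y::real)"
proof (cases "k = 0")
  case False
  assume y: "0 \<le> y"
  have "(y / k) ^ k \<le> (1 + y / k) ^ k" using y by (intro power_mono) auto
  also have "\<dots> \<le> exp y" using y False by (intro exp_ge_one_plus_x_over_n_power_n) auto
  finally show ?thesis using False by (simp add: power_divide field_simps)
qed auto

lemma decay_gauss:
  assumes "c > 0"
  shows "decay (\<lambda>x. of_real (exp (- c * (norm x)\<^sup>2)))"
  unfolding decay_def
proof (intro conjI allI)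
  fix k
  have "norm x ^ k * norm (of_real (exp (- c * (norm x)\<^sup>2)) :: complex) \<le> 1 + (1 / c) ^ k * real k ^ k" for x :: "real ^ 'a"
  proof -
    have "norm x ^ k \<le> 1 + (norm x ^ k)\<^sup>2"
      using zero_le_power2[of "norm x ^ k - 1"] by (simp add: power2_eq_square algebra_simps)
         (smt (verit) zero_le_power norm_ge_zero mult_nonneg_nonneg)
    also have "(norm x ^ k)\<^sup>2 = (1 / c) ^ k * (c * (norm x)\<^sup>2) ^ k"
      using assms by (simp add: power_mult_distrib power_divide flip: power_mult) (simp add: mult.commute)
    also have "(1 / c) ^ k * (c * (norm x)\<^sup>2) ^ k \<le> (1 / c) ^ k * (real k ^ k * exp (c * (norm x)\<^sup>2))"
      using assms by (intro mult_left_mono power_le_exp) auto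
    finally have "norm x ^ k * exp (- c * (norm x)\<^sup>2)
        \<le> (1 + (1 / c) ^ k * (real k ^ k * exp (c * (norm x)\<^sup>2))) * exp (- c * (norm x)\<^sup>2)"
      by (intro mult_right_mono) auto
    also have "\<dots> = exp (- c * (norm x)\<^sup>2) + (1 / c) ^ k * real k ^ k"
      by (simp add: algebra_simps flip: exp_add)
    also have "\<dots> \<le> 1 + (1 / c) ^ k * real k ^ k" using assms by simp
    finally show ?thesis by simp
  qed
  then show "\<exists>C. \<forall>x::real^'a. norm x ^ k * norm (of_real (exp (- c * (norm x)\<^sup>2)) :: complex) \<le> C" by blast
qed (intro continuous_intros)

text \<open>
  Since \<open>\<partial>\<^sub>i H\<^sub>1 = -x\<^sub>i H\<^sub>1 / 2\<close>, the hull of the single function \<open>H\<^sub>1\<close> contains its derivatives.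
\<close>

lemma heat_rapid: "rapid (heat 1 :: real ^ 'n::finite \<Rightarrow> complex)"
proof (rule rapid_poly_span)
  let ?A = "\<lambda>f. f = (heat 1 :: real ^ 'n \<Rightarrow> complex)"
  show "poly_span ?A (heat 1)" by (rule poly_span.base) simp
  have "decay (\<lambda>x. of_real ((4 * pi * 1) powr (- real CARD('n) / 2)) * (of_real (exp (- (1/4) * (norm (x :: real ^ 'n))\<^sup>2)) :: complex))"
    by (intro decay_scale decay_gauss) simp
  then have dec: "decay (heat 1 :: real ^ 'n \<Rightarrow> complex)"
    by (simp add: heat_def[abs_def])
  have D: "((\<lambda>t. heat 1 (x + t *\<^sub>R axis i 1)) has_vector_derivative (- 1/2) * (of_real (x $ i) * heat 1 x)) (at 0)"
    for i and x :: "real ^ 'n"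
  proof -
    have *: "(norm (x + t *\<^sub>R axis i 1))\<^sup>2 = (norm x)\<^sup>2 + 2 * t * x $ i + t\<^sup>2" for t
      unfolding power2_norm_eq_inner
      by (simp add: inner_add_left inner_add_right inner_axis inner_axis' power2_eq_square algebra_simps)
    have "((\<lambda>t. (4 * pi) powr (- real CARD('n) / 2) * exp (- ((norm x)\<^sup>2 + 2 * t * x $ i + t\<^sup>2) / 4)) has_real_derivative
        (4 * pi) powr (- real CARD('n) / 2) * (exp (- (norm x)\<^sup>2 / 4) * (- (2 * x $ i) / 4))) (at 0)"
      by (auto intro!: derivative_eq_intros)
    then have "((\<lambda>t. complex_of_real ((4 * pi) powr (- real CARD('n) / 2) * exp (- ((norm x)\<^sup>2 + 2 * t * x $ i + t\<^sup>2) / 4))) has_vector_derivative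
        complex_of_real ((4 * pi) powr (- real CARD('n) / 2) * (exp (- (norm x)\<^sup>2 / 4) * (- (2 * x $ i) / 4)))) (at 0)"
      by (intro has_vector_derivative_of_real) (simp add: has_real_derivative_iff_has_vector_derivative)
    then show ?thesis by (simp add: heat_def * algebra_simps)
  qed
  show "decay f" if "?A f" for f using dec that by simp
  show "axis_diff f" if "?A f" for f using axis_diffI(1)[OF D] that by simp
  show "poly_span ?A (partial_deriv i f)" if "?A f" for f i
    unfolding that axis_diffI(2)[OF D] by (intro poly_span.intros) simp
qed

lemma gauss_FT_1d:
  "(\<integral>x. of_real (exp (- x\<^sup>2 / 2)) * cis (x * t) \<partial>lborel) = complex_of_real (sqrt (2 * pi) * exp (- t\<^sup>2 / 2))"
  and gauss_integrable_1d: "integrable lborel (\<lambda>x. of_real (exp (- x\<^sup>2 / 2)) * cis (x * t))"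
proof -
  have "integrable lborel std_normal_density" by (rule integrable_normal_density) simp
  then have "integrable lborel (\<lambda>x. sqrt (2 * pi) * std_normal_density x)" by (rule integrable_mult_right)
  then have i: "integrable lborel (\<lambda>x::real. exp (- x\<^sup>2 / 2))" by (simp add: std_normal_density_def)
  show "integrable lborel (\<lambda>x. of_real (exp (- x\<^sup>2 / 2)) * cis (x * t))"
    by (rule Bochner_Integration.integrable_bound[OF i]) (auto simp: norm_mult)
  have "complex_of_real (exp (- t\<^sup>2 / 2)) = (\<integral>x. iexp (t * x) \<partial>density lborel std_normal_density)"
    using fun_cong[OF char_std_normal_distribution, of t] by (simp add: char_def)
  also have "\<dots> = (\<integral>x. std_normal_density x *\<^sub>R iexp (t * x) \<partial>lborel)"
    by (rule integral_density) auto
  also have "\<dots> = (\<integral>x. of_real (1 / sqrt (2 * pi)) * (of_real (exp (- x\<^sup>2 / 2)) * cis (x * t)) \<partial>lborel)"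
    by (intro Bochner_Integration.integral_cong) (auto simp: std_normal_density_def cis_conv_exp scaleR_conv_of_real mult_ac)
  also have "\<dots> = of_real (1 / sqrt (2 * pi)) * (\<integral>x. of_real (exp (- x\<^sup>2 / 2)) * cis (x * t) \<partial>lborel)"
    by simp
  finally show "(\<integral>x. of_real (exp (- x\<^sup>2 / 2)) * cis (x * t) \<partial>lborel) = complex_of_real (sqrt (2 * pi) * exp (- t\<^sup>2 / 2))"
    by (simp add: field_simps flip: of_real_mult)
qed

text \<open>
  The integral is a product over the coordinates, and each factor is a value of the characteristic
  function of the standard normal distribution.
\<close>

lemma gauss_FT:
  "(\<integral>x. of_real (exp (- (norm x)\<^sup>2 / 2)) * cis (x \<bullet> \<zeta>) \<partial>lborel)
    = complex_of_real (sqrt (2 * pi) ^ CARD('n) * exp (- (norm \<zeta>)\<^sup>2 / 2))"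
  for \<zeta> :: "real ^ 'n::finite"
proof -
  let ?B = "Basis :: (real ^ 'n) set"
  let ?g = "\<lambda>b t. of_real (exp (- t\<^sup>2 / 2)) * cis (t * (\<zeta> \<bullet> b))"
  have nrm: "(norm x)\<^sup>2 = (\<Sum>b\<in>?B. (x \<bullet> b)\<^sup>2)" for x :: "real ^ 'n"
    unfolding power2_norm_eq_inner by (subst euclidean_inner) (simp add: power2_eq_square)
  have prod: "of_real (exp (- (norm x)\<^sup>2 / 2)) * cis (x \<bullet> \<zeta>) = (\<Prod>b\<in>?B. ?g b (x \<bullet> b))" for x
  proof -
    have "exp (- (norm x)\<^sup>2 / 2) = (\<Prod>b\<in>?B. exp (- (x \<bullet> b)\<^sup>2 / 2))"
      by (simp add: nrm sum_negf sum_divide_distrib flip: exp_sum)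
    moreover have "cis (x \<bullet> \<zeta>) = (\<Prod>b\<in>?B. cis ((x \<bullet> b) * (\<zeta> \<bullet> b)))"
      by (simp add: cis_conv_exp euclidean_inner[of x \<zeta>] sum_distrib_left flip: exp_sum)
    ultimately show ?thesis by (simp add: prod.distrib)
  qed
  interpret product_sigma_finite "\<lambda>b :: real ^ 'n. lborel :: real measure"
    by (simp add: product_sigma_finite_def sigma_finite_lborel)
  have "(\<integral>x. of_real (exp (- (norm x)\<^sup>2 / 2)) * cis (x \<bullet> \<zeta>) \<partial>lborel)
     = (\<integral>x. of_real (exp (- (norm x)\<^sup>2 / 2)) * cis (x \<bullet> \<zeta>) \<partial>distr (\<Pi>\<^sub>M b\<in>?B. lborel) borel (\<lambda>f. \<Sum>b\<in>?B. f b *\<^sub>R b))"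
    by (subst lborel_eq) (rule refl)
  also have "\<dots> = (\<integral>f. (\<Prod>b\<in>?B. ?g b ((\<Sum>b\<in>?B. f b *\<^sub>R b) \<bullet> b)) \<partial>(\<Pi>\<^sub>M b\<in>?B. lborel))"
    unfolding prod by (rule integral_distr) measurable
  also have "\<dots> = (\<integral>f. (\<Prod>b\<in>?B. ?g b (f b)) \<partial>(\<Pi>\<^sub>M b\<in>?B. lborel))"
    by (intro Bochner_Integration.integral_cong prod.cong refl) (simp add: inner_sum_left_Basis)
  also have "\<dots> = (\<Prod>b\<in>?B. (\<integral>t. ?g b t \<partial>lborel))"
    by (rule product_integral_prod[OF finite_Basis gauss_integrable_1d])
  also have "\<dots> = (\<Prod>b\<in>?B. complex_of_real (sqrt (2 * pi) * exp (- (\<zeta> \<bullet> b)\<^sup>2 / 2)))"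
    by (simp only: gauss_FT_1d)
  also have "\<dots> = complex_of_real (sqrt (2 * pi) ^ CARD('n) * exp (- (norm \<zeta>)\<^sup>2 / 2))"
    by (simp add: prod.distrib nrm sum_negf sum_divide_distrib flip: exp_sum of_real_prod)
  finally show ?thesis .
qed

lemma powr_neg_half:
  assumes "a > 0"
  shows "a powr (- real k / 2) = (1 / sqrt a) ^ k"
proof -
  have "a powr (- real k / 2) = (a powr (- (1/2))) powr real k" by (simp add: powr_powr)
  also have "a powr (- (1/2)) = 1 / sqrt a" using assms by (simp add: powr_minus powr_half_sqrt field_simps)
  finally show ?thesis using assms by (simp add: powr_realpow)
qed

lemma heat_eq_FT:
  fixes z :: "real ^ 'n::finite"
  assumes r: "r > 0"
  shows "(\<integral>\<xi>. of_real (exp (- (4 * pi\<^sup>2 * r * (norm \<xi>)\<^sup>2))) * cis (2 * pi * (\<xi> \<bullet> z)) \<partial>lborel) = heat r z"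
proof -
  define c where "c = 1 / (2 * pi * sqrt (2 * r))"
  have c: "c > 0" using r by (simp add: c_def)
  have c2: "4 * pi\<^sup>2 * r * c\<^sup>2 = 1 / 2"
    using r by (simp add: c_def power_mult_distrib power_divide field_simps)
  have cz: "2 * pi * c = 1 / sqrt (2 * r)" by (simp add: c_def field_simps)
  have cc: "c * sqrt (2 * pi) = 1 / sqrt (4 * pi * r)"
  proof -
    define q where "q = sqrt (2 * pi)"
    have q: "q > 0" "2 * pi = q * q" by (simp_all add: q_def)
    have "sqrt (4 * pi * r) = q * sqrt (2 * r)" unfolding q_def by (simp flip: real_sqrt_mult)
    moreover have "c = 1 / (q * q * sqrt (2 * r))" by (simp only: c_def q(2))
    ultimately show ?thesis unfolding q_def[symmetric] using q(1) by simp
  qed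
  have "(\<integral>\<xi>. of_real (exp (- (4 * pi\<^sup>2 * r * (norm \<xi>)\<^sup>2))) * cis (2 * pi * (\<xi> \<bullet> z)) \<partial>lborel)
     = \<bar>c\<bar> ^ CARD('n) *\<^sub>R (\<integral>\<xi>. of_real (exp (- (4 * pi\<^sup>2 * r * (norm (0 + c *\<^sub>R \<xi>))\<^sup>2))) * cis (2 * pi * ((0 + c *\<^sub>R \<xi>) \<bullet> z)) \<partial>lborel)"
    using c by (intro lborel_integral_affine) auto
  also have "(\<integral>\<xi>. of_real (exp (- (4 * pi\<^sup>2 * r * (norm (0 + c *\<^sub>R \<xi>))\<^sup>2))) * cis (2 * pi * ((0 + c *\<^sub>R \<xi>) \<bullet> z)) \<partial>lborel)
     = (\<integral>\<xi>. of_real (exp (- (norm \<xi>)\<^sup>2 / 2)) * cis (\<xi> \<bullet> ((1 / sqrt (2 * r)) *\<^sub>R z)) \<partial>lborel)"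
  proof (rule Bochner_Integration.integral_cong[OF refl])
    fix \<xi> :: "real ^ 'n"
    have "4 * pi\<^sup>2 * r * (norm (0 + c *\<^sub>R \<xi>))\<^sup>2 = (4 * pi\<^sup>2 * r * c\<^sup>2) * (norm \<xi>)\<^sup>2"
      by (simp add: power_mult_distrib)
    then have 1: "4 * pi\<^sup>2 * r * (norm (0 + c *\<^sub>R \<xi>))\<^sup>2 = (norm \<xi>)\<^sup>2 / 2" by (simp add: c2)
    have "2 * pi * ((0 + c *\<^sub>R \<xi>) \<bullet> z) = (2 * pi * c) * (\<xi> \<bullet> z)" by simp
    then have 2: "2 * pi * ((0 + c *\<^sub>R \<xi>) \<bullet> z) = \<xi> \<bullet> ((1 / sqrt (2 * r)) *\<^sub>R z)" by (simp only: cz) simp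
    show "of_real (exp (- (4 * pi\<^sup>2 * r * (norm (0 + c *\<^sub>R \<xi>))\<^sup>2))) * cis (2 * pi * ((0 + c *\<^sub>R \<xi>) \<bullet> z))
       = of_real (exp (- (norm \<xi>)\<^sup>2 / 2)) * cis (\<xi> \<bullet> ((1 / sqrt (2 * r)) *\<^sub>R z))"
      by (simp only: 1 2) simp
  qed
  also have "\<dots> = complex_of_real (sqrt (2 * pi) ^ CARD('n) * exp (- (norm ((1 / sqrt (2 * r)) *\<^sub>R z))\<^sup>2 / 2))"
    by (rule gauss_FT)
  also have "- (norm ((1 / sqrt (2 * r)) *\<^sub>R z))\<^sup>2 / 2 = - (norm z)\<^sup>2 / (4 * r)"
    using r by (simp add: power_divide)
  also have "\<bar>c\<bar> ^ CARD('n) *\<^sub>R complex_of_real (sqrt (2 * pi) ^ CARD('n) * exp (- (norm z)\<^sup>2 / (4 * r)))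
      = complex_of_real ((c * sqrt (2 * pi)) ^ CARD('n) * exp (- (norm z)\<^sup>2 / (4 * r)))"
    using r c by (simp add: scaleR_conv_of_real power_mult_distrib power_divide)
  finally show ?thesis
    using r by (simp only: cc heat_def powr_neg_half[of "4 * pi * r" "CARD('n)"] mult_pos_pos pi_gt_zero zero_less_numeral)
qed

lemma heat_scale:
  fixes x :: "real ^ 'n::finite"
  assumes "r > 0"
  shows "heat r x = of_real (r powr (- real CARD('n) / 2)) * heat 1 ((1 / sqrt r) *\<^sub>R x)"
  using assms by (simp add: heat_def powr_mult power_divide)

lemma heat_minus: "heat r (- x) = heat r x" by (simp add: heat_def)

lemma heat_measurable [measurable]: "heat r \<in> borel_measurable borel"
  unfolding heat_def[abs_def] by measurable

lemma heat_integral: "(\<integral>x. heat 1 (x :: real ^ 'n::finite) \<partial>lborel) = 1"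
proof -
  have "(\<integral>x. heat 1 (x :: real ^ 'n) \<partial>lborel) = \<bar>sqrt 2\<bar> ^ CARD('n) *\<^sub>R (\<integral>x. heat 1 (0 + sqrt 2 *\<^sub>R x :: real ^ 'n) \<partial>lborel)"
    by (rule lborel_integral_affine) auto
  also have "(\<integral>x. heat 1 (0 + sqrt 2 *\<^sub>R x :: real ^ 'n) \<partial>lborel)
     = (\<integral>x. of_real ((4 * pi) powr (- real CARD('n) / 2)) * (of_real (exp (- (norm x)\<^sup>2 / 2)) * cis ((x :: real ^ 'n) \<bullet> 0)) \<partial>lborel)"
    by (intro Bochner_Integration.integral_cong) (auto simp: heat_def power_mult_distrib)
  also have "\<dots> = of_real ((4 * pi) powr (- real CARD('n) / 2)) * complex_of_real (sqrt (2 * pi) ^ CARD('n) * exp (- (norm (0 :: real ^ 'n))\<^sup>2 / 2))"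
    by (subst gauss_FT[symmetric]) simp
  also have "(4 * pi) powr (- real CARD('n) / 2) = (1 / sqrt (4 * pi)) ^ CARD('n)"
    by (rule powr_neg_half) simp
  finally have "(\<integral>x. heat 1 (x :: real ^ 'n) \<partial>lborel)
      = complex_of_real (sqrt 2 ^ CARD('n) * ((1 / sqrt (4 * pi)) ^ CARD('n) * sqrt (2 * pi) ^ CARD('n)))"
    by (simp add: scaleR_conv_of_real)
  also have "\<dots> = complex_of_real ((sqrt 2 * ((1 / sqrt (4 * pi)) * sqrt (2 * pi))) ^ CARD('n))"
    by (simp only: power_mult_distrib)
  also have "sqrt 2 * ((1 / sqrt (4 * pi)) * sqrt (2 * pi)) = 1"
  proof -
    have "sqrt (4 * pi) = sqrt 2 * sqrt (2 * pi)" by (simp flip: real_sqrt_mult)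
    then show ?thesis by simp
  qed
  finally show ?thesis by simp
qed

lemma gauss_integrable:
  assumes "c > 0"
  shows "integrable lborel (\<lambda>\<xi> :: real ^ 'n::finite. complex_of_real (exp (- (c * (norm \<xi>)\<^sup>2))))"
  using decay_integrable[OF decay_gauss[OF assms]] by simp

text \<open>
  Damping the inversion integral by a Gaussian turns it into a convolution with the heat kernel. The
  identity serves twice: the limit \<open>r \<rightarrow> 0\<close> is Fourier inversion, and integration over \<open>r\<close> against the
  measure \<open>\<nu>\<close> below identifies the multiplier \<open>1/a\<close> with a convolution.
\<close>

lemma FT_heat_conv:
  fixes \<psi> :: "real ^ 'n::finite \<Rightarrow> complex"
  assumes \<psi>: "integrable lborel \<psi>" and r: "r > 0" and \<sigma>: "\<sigma> = 1 \<or> \<sigma> = -1"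
  shows "(\<integral>\<xi>. of_real (exp (- (4 * pi\<^sup>2 * r * (norm \<xi>)\<^sup>2))) * FT \<sigma> \<psi> \<xi> * cis (2 * pi * (- \<sigma>) * (\<xi> \<bullet> x)) \<partial>lborel)
     = (\<integral>y. \<psi> y * heat r (x - y) \<partial>lborel)"
proof -
  have [measurable]: "\<psi> \<in> borel_measurable borel" using borel_measurable_integrable[OF \<psi>] by simp
  let ?e = "\<lambda>\<xi> :: real ^ 'n. complex_of_real (exp (- (4 * pi\<^sup>2 * r * (norm \<xi>)\<^sup>2)))"
  let ?k = "\<lambda>\<xi> y. ?e \<xi> * (\<psi> y * cis (2 * pi * \<sigma> * (y \<bullet> \<xi>))) * cis (2 * pi * (- \<sigma>) * (\<xi> \<bullet> x))"
  have e: "integrable lborel ?e" using r by (intro gauss_integrable) simp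
  have "(\<integral>\<xi>. ?e \<xi> * FT \<sigma> \<psi> \<xi> * cis (2 * pi * (- \<sigma>) * (\<xi> \<bullet> x)) \<partial>lborel)
     = (\<integral>\<xi>. \<integral>y. ?k \<xi> y \<partial>lborel \<partial>lborel)"
    by (simp add: FT_def)
  also have "\<dots> = (\<integral>y. \<integral>\<xi>. ?k \<xi> y \<partial>lborel \<partial>lborel)"
  proof (rule integral_swap)
    have "(\<integral>\<^sup>+\<xi>. \<integral>\<^sup>+y. norm (?k \<xi> y) \<partial>lborel \<partial>lborel)
      = (\<integral>\<^sup>+\<xi>. norm (?e \<xi>) \<partial>lborel) * (\<integral>\<^sup>+y. norm (\<psi> y) \<partial>lborel)"
      by (simp add: norm_mult ennreal_mult nn_integral_cmult nn_integral_multc)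
    also have "\<dots> < \<infinity>" using e \<psi> by (auto simp: integrable_iff_bounded ennreal_mult_less_top)
    finally show "(\<integral>\<^sup>+\<xi>. \<integral>\<^sup>+y. norm (?k \<xi> y) \<partial>lborel \<partial>lborel) < \<infinity>" .
  qed (auto intro: sigma_finite_lborel)
  also have "\<dots> = (\<integral>y. \<integral>\<xi>. \<psi> y * (?e \<xi> * cis (2 * pi * (\<xi> \<bullet> (\<sigma> *\<^sub>R (y - x))))) \<partial>lborel \<partial>lborel)"
  proof (intro Bochner_Integration.integral_cong refl)
    fix y \<xi> :: "real ^ 'n"
    have "cis (2 * pi * \<sigma> * (y \<bullet> \<xi>)) * cis (2 * pi * (- \<sigma>) * (\<xi> \<bullet> x)) = cis (2 * pi * (\<xi> \<bullet> (\<sigma> *\<^sub>R (y - x))))"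
      by (simp add: cis_mult inner_diff_right algebra_simps inner_commute)
    then show "?k \<xi> y
        = \<psi> y * (?e \<xi> * cis (2 * pi * (\<xi> \<bullet> (\<sigma> *\<^sub>R (y - x)))))"
      by (metis (no_types, lifting) mult.assoc mult.commute)
  qed
  also have "\<dots> = (\<integral>y. \<psi> y * heat r (\<sigma> *\<^sub>R (y - x)) \<partial>lborel)"
    by (simp only: heat_eq_FT[OF r, symmetric] integral_mult_right_zero)
  also have "\<dots> = (\<integral>y. \<psi> y * heat r (x - y) \<partial>lborel)"
    using \<sigma> heat_minus[of r "_ - x"] by (intro Bochner_Integration.integral_cong refl) auto
  finally show ?thesis .
qed

text \<open>
  Take \<open>r = \<epsilon>\<^sup>2\<close> in the preceding identity and substitute \<open>y = x - \<epsilon>z\<close>, which turns the heat kernel at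
  time \<open>r\<close> into the one at time \<open>1\<close>; then let \<open>\<epsilon> \<rightarrow> 0\<close> by dominated convergence on both sides.
\<close>

lemma FT_inversion:
  fixes \<psi> :: "real ^ 'n::finite \<Rightarrow> complex"
  assumes \<psi>: "rapid \<psi>" and \<sigma>: "\<sigma> = 1 \<or> \<sigma> = -1"
  shows "FT (- \<sigma>) (FT \<sigma> \<psi>) = \<psi>"
proof
  fix x
  define \<epsilon> where "\<epsilon> k = inverse (real (Suc k))" for k
  have \<epsilon>: "\<epsilon> k > 0" for k by (simp add: \<epsilon>_def)
  let ?E = "\<lambda>k \<xi>. of_real (exp (- (4 * pi\<^sup>2 * (\<epsilon> k)\<^sup>2 * (norm \<xi>)\<^sup>2))) * FT \<sigma> \<psi> \<xi> * cis (2 * pi * (- \<sigma>) * (\<xi> \<bullet> x))"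
  have lim: "\<epsilon> \<longlonglongrightarrow> 0" unfolding \<epsilon>_def by (rule LIMSEQ_inverse_real_of_nat)
  have \<psi>c: "continuous_on UNIV \<psi>" by (rule all_derivs_base[OF rapid_smooth[OF \<psi>]])
  then have [measurable]: "\<psi> \<in> borel_measurable borel" by (rule borel_measurable_continuous_onI)
  obtain C where C: "\<And>x. norm (\<psi> x) \<le> C" using decay_bounded[OF all_derivs_base[OF \<psi>]] by metis
  have F: "rapid (FT \<sigma> \<psi>)" using \<sigma> by (intro FT_rapid \<psi>) auto
  have Fi: "integrable lborel (FT \<sigma> \<psi>)" by (rule rapid_integrable[OF F])
  have [measurable]: "FT \<sigma> \<psi> \<in> borel_measurable borel" using borel_measurable_integrable[OF Fi] by simp
  have "(\<lambda>k. \<integral>\<xi>. ?E k \<xi> \<partial>lborel)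
     \<longlonglongrightarrow> (\<integral>\<xi>. FT \<sigma> \<psi> \<xi> * cis (2 * pi * (- \<sigma>) * (\<xi> \<bullet> x)) \<partial>lborel)"
  proof (rule integral_dominated_convergence[where w = "\<lambda>\<xi>. norm (FT \<sigma> \<psi> \<xi>)"])
    show "AE \<xi> in lborel. (\<lambda>k. ?E k \<xi>)
       \<longlonglongrightarrow> FT \<sigma> \<psi> \<xi> * cis (2 * pi * (- \<sigma>) * (\<xi> \<bullet> x))"
    proof (rule AE_I2)
      fix \<xi> :: "real ^ 'n"
      have "(\<lambda>k. ?E k \<xi>)
        \<longlonglongrightarrow> of_real (exp (- (4 * pi\<^sup>2 * 0\<^sup>2 * (norm \<xi>)\<^sup>2))) * FT \<sigma> \<psi> \<xi> * cis (2 * pi * (- \<sigma>) * (\<xi> \<bullet> x))"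
        by (intro tendsto_intros lim)
      then show "(\<lambda>k. ?E k \<xi>)
       \<longlonglongrightarrow> FT \<sigma> \<psi> \<xi> * cis (2 * pi * (- \<sigma>) * (\<xi> \<bullet> x))" by simp
    qed
    show "AE \<xi> in lborel. norm (?E k \<xi>)
       \<le> norm (FT \<sigma> \<psi> \<xi>)" for k
      by (auto simp: norm_mult intro!: mult_left_le_one_le)
  qed (use Fi in auto)
  moreover have "(\<integral>\<xi>. ?E k \<xi> \<partial>lborel)
     = (\<integral>z. \<psi> (x + (- \<epsilon> k) *\<^sub>R z) * heat 1 z \<partial>lborel)" for k
  proof -
    have e2: "(\<epsilon> k)\<^sup>2 > 0" using \<epsilon>[of k] by simp
    have "(\<integral>\<xi>. ?E k \<xi> \<partial>lborel)
      = (\<integral>y. \<psi> y * heat ((\<epsilon> k)\<^sup>2) (x - y) \<partial>lborel)"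
      by (rule FT_heat_conv[OF rapid_integrable[OF \<psi>] e2 \<sigma>])
    also have "\<dots> = \<bar>- \<epsilon> k\<bar> ^ CARD('n) *\<^sub>R (\<integral>z. \<psi> (x + (- \<epsilon> k) *\<^sub>R z) * heat ((\<epsilon> k)\<^sup>2) (x - (x + (- \<epsilon> k) *\<^sub>R z)) \<partial>lborel)"
      using \<epsilon>[of k] by (intro lborel_integral_affine) auto
    also have "\<dots> = (\<integral>z. \<epsilon> k ^ CARD('n) *\<^sub>R (\<psi> (x + (- \<epsilon> k) *\<^sub>R z) * heat ((\<epsilon> k)\<^sup>2) (x - (x + (- \<epsilon> k) *\<^sub>R z))) \<partial>lborel)"
      using \<epsilon>[of k] by simp
    also have "\<dots> = (\<integral>z. \<psi> (x + (- \<epsilon> k) *\<^sub>R z) * heat 1 z \<partial>lborel)"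
    proof (intro Bochner_Integration.integral_cong refl)
      fix z :: "real ^ 'n"
      have "heat ((\<epsilon> k)\<^sup>2) (\<epsilon> k *\<^sub>R z) = of_real ((1 / \<epsilon> k) ^ CARD('n)) * heat 1 z"
        unfolding heat_scale[OF e2] powr_neg_half[OF e2] using \<epsilon>[of k] by simp
      then show "\<epsilon> k ^ CARD('n) *\<^sub>R (\<psi> (x + (- \<epsilon> k) *\<^sub>R z) * heat ((\<epsilon> k)\<^sup>2) (x - (x + (- \<epsilon> k) *\<^sub>R z)))
        = \<psi> (x + (- \<epsilon> k) *\<^sub>R z) * heat 1 z"
        using \<epsilon>[of k] by (simp add: scaleR_conv_of_real power_divide)
    qed
    finally show ?thesis .
  qed
  moreover have "(\<lambda>k. \<integral>z. \<psi> (x + (- \<epsilon> k) *\<^sub>R z) * heat 1 z \<partial>lborel) \<longlonglongrightarrow> (\<integral>z. \<psi> x * heat 1 (z :: real ^ 'n) \<partial>lborel)"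
  proof (rule integral_dominated_convergence[where w = "\<lambda>z :: real ^ 'n. C * norm (heat 1 z :: complex)"])
    show "integrable lborel (\<lambda>z :: real ^ 'n. C * norm (heat 1 z :: complex))"
      by (intro integrable_mult_right integrable_norm rapid_integrable heat_rapid)
    show "AE z in lborel. (\<lambda>k. \<psi> (x + (- \<epsilon> k) *\<^sub>R z) * heat 1 z) \<longlonglongrightarrow> \<psi> x * heat 1 z"
    proof (rule AE_I2)
      fix z :: "real ^ 'n"
      have "(\<lambda>k. x + (- \<epsilon> k) *\<^sub>R z) \<longlonglongrightarrow> x + (- 0) *\<^sub>R z" by (intro tendsto_intros lim)
      moreover have "isCont \<psi> x" using \<psi>c by (simp add: continuous_on_eq_continuous_at)
      ultimately have "(\<lambda>k. \<psi> (x + (- \<epsilon> k) *\<^sub>R z)) \<longlonglongrightarrow> \<psi> x"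
        by (intro isCont_tendsto_compose[of x \<psi>]) simp_all
      then show "(\<lambda>k. \<psi> (x + (- \<epsilon> k) *\<^sub>R z) * heat 1 z) \<longlonglongrightarrow> \<psi> x * heat 1 z" by (intro tendsto_intros)
    qed
    show "AE z in lborel. norm (\<psi> (x + (- \<epsilon> k) *\<^sub>R z) * heat 1 z) \<le> C * norm (heat 1 z :: complex)" for k
      using C by (auto simp: norm_mult intro!: mult_right_mono)
  qed auto
  ultimately have "(\<integral>\<xi>. FT \<sigma> \<psi> \<xi> * cis (2 * pi * (- \<sigma>) * (\<xi> \<bullet> x)) \<partial>lborel) = (\<integral>z. \<psi> x * heat 1 (z :: real ^ 'n) \<partial>lborel)"
    by (simp only: LIMSEQ_unique)
  then show "FT (- \<sigma>) (FT \<sigma> \<psi>) x = \<psi> x"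
    by (simp add: FT_def heat_integral)
qed

section \<open>One-dimensional integrals\<close>

lemma nn_integral_exp_half_line:
  assumes "c > 0"
  shows "(\<integral>\<^sup>+t. indicator {0..} t * ennreal (exp (- (c * t))) \<partial>lborel) = ennreal (1 / c)"
proof -
  have lim: "((\<lambda>t. - exp (- (c * t)) / c) \<longlongrightarrow> 0) at_top" using assms by real_asymp
  have "(\<integral>\<^sup>+t. ennreal (exp (- (c * t))) * indicator {0..} t \<partial>lborel) = ennreal (0 - (- exp (- (c * 0)) / c))"
    by (rule nn_integral_FTC_atLeast[OF _ _ _ lim]) (use assms in \<open>auto intro!: derivative_eq_intros\<close>)
  then show ?thesis by (simp add: mult.commute)
qed

lemma nn_integral_powr_tail:
  assumes "b > 0" "\<delta> > 0"
  shows "(\<integral>\<^sup>+r. indicator {\<delta>..} r * ennreal (r powr (- b - 1)) \<partial>lborel) = ennreal (\<delta> powr (- b) / b)"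
proof -
  have lim: "((\<lambda>r. - (r powr (- b)) / b) \<longlongrightarrow> 0) at_top" using assms by real_asymp
  have "(\<integral>\<^sup>+r. ennreal (r powr (- b - 1)) * indicator {\<delta>..} r \<partial>lborel) = ennreal (0 - (- (\<delta> powr (- b)) / b))"
    by (rule nn_integral_FTC_atLeast[OF _ _ _ lim]) (use assms in \<open>auto intro!: derivative_eq_intros\<close>)
  then show ?thesis by (simp add: mult.commute)
qed

text \<open>
  Monotone convergence in the left end point, for integrands that are singular at \<open>0\<close>.
\<close>

lemma nn_integral_greater_le:
  fixes g :: "real \<Rightarrow> ennreal"
  assumes [measurable]: "g \<in> borel_measurable borel"
    and le: "\<And>\<epsilon>. 0 < \<epsilon> \<Longrightarrow> (\<integral>\<^sup>+r. indicator {\<epsilon>..\<delta>} r * g r \<partial>lborel) \<le> B"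
  shows "(\<integral>\<^sup>+r. indicator {0<..\<delta>} r * g r \<partial>lborel) \<le> B"
proof -
  let ?f = "\<lambda>k r. indicator {inverse (real (Suc k))..\<delta>} r * g r"
  have "indicator {0<..\<delta>} r * g r = (SUP k. ?f k r)" for r
  proof (cases "0 < r")
    case True
    then obtain k where k: "inverse (real (Suc k)) < r" using reals_Archimedean by blast
    have "(SUP k. ?f k r) = indicator {0<..\<delta>} r * g r"
    proof (rule antisym)
      show "(SUP k. ?f k r) \<le> indicator {0<..\<delta>} r * g r"
        using True by (intro SUP_least mult_right_mono) (auto simp: indicator_def)
      have "indicator {0<..\<delta>} r * g r \<le> ?f k r"
        using k by (intro mult_right_mono) (auto simp: indicator_def)
      then show "indicator {0<..\<delta>} r * g r \<le> (SUP k. ?f k r)" by (rule SUP_upper2[OF UNIV_I])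
    qed
    then show ?thesis by simp
  next
    case False
    have "\<not> inverse (real (Suc k)) \<le> r" for k
    proof
      assume "inverse (real (Suc k)) \<le> r"
      moreover have "0 < inverse (real (Suc k))" by simp
      ultimately show False using False by linarith
    qed
    then show ?thesis using False by (simp add: indicator_def)
  qed
  then have "(\<integral>\<^sup>+r. indicator {0<..\<delta>} r * g r \<partial>lborel) = (\<integral>\<^sup>+r. (SUP k. ?f k r) \<partial>lborel)" by simp
  also have "\<dots> = (SUP k. \<integral>\<^sup>+r. ?f k r \<partial>lborel)"
  proof (rule nn_integral_monotone_convergence_SUP)
    show "incseq ?f"
    proof (rule incseq_SucI, rule le_funI, rule mult_right_mono)
      fix k r
      have "inverse (real (Suc (Suc k))) \<le> inverse (real (Suc k))" by (rule le_imp_inverse_le) auto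
      then have "inverse (real (Suc (Suc k))) \<le> r" if "inverse (real (Suc k)) \<le> r"
        using that by linarith
      then show "indicator {inverse (real (Suc k))..\<delta>} r \<le> (indicator {inverse (real (Suc (Suc k)))..\<delta>} r :: ennreal)"
        by (auto simp: indicator_def simp del: of_nat_Suc)
    qed auto
  qed measurable
  also have "\<dots> \<le> B" by (intro SUP_least le) simp
  finally show ?thesis .
qed

text \<open>
  The integrand has the antiderivative \<open>(-ln r)\<^bsup>1-q\<^esup>/(q - 1)\<close>. That it vanishes at \<open>0\<close>, which requires
  \<open>q > 1\<close>, is what makes the critical kernel \<open>q\<close>-integrable.
\<close>

lemma nn_integral_inverse_log_le:
  assumes q: "q > 1" and \<delta>: "0 < \<delta>" "\<delta> < 1"
  shows "(\<integral>\<^sup>+r. indicator {0<..\<delta>} r * ennreal ((- ln r) powr (- q) / r) \<partial>lborel)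
    \<le> ennreal ((- ln \<delta>) powr (1 - q) / (q - 1))"
proof (rule nn_integral_greater_le)
  fix \<epsilon> :: real assume \<epsilon>: "0 < \<epsilon>"
  let ?F = "\<lambda>r. (- ln r) powr (1 - q) / (q - 1)"
  show "(\<integral>\<^sup>+r. indicator {\<epsilon>..\<delta>} r * ennreal ((- ln r) powr (- q) / r) \<partial>lborel) \<le> ennreal (?F \<delta>)"
  proof (cases "\<epsilon> \<le> \<delta>")
    case True
    have "(\<integral>\<^sup>+r. ennreal ((- ln r) powr (- q) / r) * indicator {\<epsilon>..\<delta>} r \<partial>lborel) = ennreal (?F \<delta> - ?F \<epsilon>)"
    proof (rule nn_integral_FTC_Icc)
      fix r assume "r \<in> {\<epsilon>..\<delta>}"
      then have r: "0 < r" "r < 1" using \<epsilon> \<delta> by auto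
      then have l: "0 < - ln r" by simp
      have "((\<lambda>r. (- ln r) powr (1 - q)) has_real_derivative (1 - q) * (- ln r) powr (1 - q - 1) * (- (1 / r))) (at r)"
        using r l by (auto intro!: derivative_eq_intros simp: field_simps)
      from DERIV_cdivide[OF this, of "q - 1"]
      have "(?F has_real_derivative (1 - q) * (- ln r) powr (1 - q - 1) * (- (1 / r)) / (q - 1)) (at r)" .
      also have "(1 - q) * (- ln r) powr (1 - q - 1) * (- (1 / r)) / (q - 1) = (- ln r) powr (- q) / r"
        using q r by (simp add: field_simps)
      finally show "(?F has_real_derivative (- ln r) powr (- q) / r) (at r)" .
      show "0 \<le> (- ln r) powr (- q) / r" using r by simp
    qed (use True in auto)
    also have "\<dots> \<le> ennreal (?F \<delta>)" using q by (intro ennreal_leI) simp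
    finally show ?thesis by (simp add: mult.commute)
  qed (simp add: indicator_def)
qed measurable

text \<open>
  The logarithm varies slowly: moving its argument from \<open>r\<close> down to \<open>y\<close> costs at most a power of \<open>r/y\<close>,
  and the exponent \<open>\<epsilon>\<close> may be as small as one likes. So logarithms may be taken out of scale
  invariant integrals.
\<close>

lemma inverse_log_ratio:
  fixes y r \<epsilon> :: real
  assumes \<epsilon>: "\<epsilon> > 0" and y: "0 < y" "y \<le> r" "r \<le> 1 / 2"
  shows "1 / (- ln r) \<le> (1 + 1 / (\<epsilon> * ln 2)) * ((r / y) powr \<epsilon> / (- ln y))"
proof -
  have lr: "- ln r \<ge> ln 2"
  proof -
    have "ln r \<le> ln (1 / 2)" using y by simp
    then show ?thesis by (simp add: ln_div)
  qed
  have l2: "0 < ln (2::real)" by simp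
  have ly: "- ln y \<ge> ln 2"
  proof -
    have "ln y \<le> ln r" using y by simp
    then show ?thesis using lr by linarith
  qed
  have ry: "1 \<le> r / y" using y by simp
  have pw: "1 \<le> (r / y) powr \<epsilon>" by (rule ge_one_powr_ge_zero) (use ry \<epsilon> in auto)
  have "- ln y / (- ln r) = 1 + ln (r / y) / (- ln r)"
    using lr l2 y by (simp add: field_simps ln_div)
  also have "\<dots> \<le> 1 + ((r / y) powr \<epsilon> / \<epsilon>) / ln 2"
    using ln_powr_bound[OF ry \<epsilon>] lr l2 \<epsilon> by (intro add_left_mono frac_le) auto
  also have "\<dots> \<le> (r / y) powr \<epsilon> + ((r / y) powr \<epsilon> / \<epsilon>) / ln 2" using pw by simp
  also have "\<dots> = (1 + 1 / (\<epsilon> * ln 2)) * (r / y) powr \<epsilon>" by (simp add: field_simps)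
  finally have "- ln y / (- ln r) / (- ln y) \<le> (1 + 1 / (\<epsilon> * ln 2)) * (r / y) powr \<epsilon> / (- ln y)"
    by (rule divide_right_mono) (use ly l2 in linarith)
  moreover have "- ln y / (- ln r) / (- ln y) = 1 / (- ln r)" using ly l2 by (auto simp: field_simps)
  ultimately show ?thesis by simp
qed

text \<open>
  Without the logarithm, scaling gives \<open>y\<^bsup>-a\<^esup>\<close>: the mass sits at \<open>r\<close> comparable to \<open>y\<close>, because the
  factor \<open>(1 + y/r)\<^bsup>-N\<^esup>\<close> makes small \<open>r\<close> negligible and the power \<open>r\<^bsup>-a-1\<^esup>\<close> large \<open>r\<close>. For
  \<open>r \<le> y\<close> the logarithm at \<open>y\<close> is a bound already, and for \<open>r \<ge> y\<close> it is moved to \<open>y\<close> at the cost of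
  \<open>(r/y)\<^bsup>a/2\<^esup>\<close>, half of the available power.
\<close>

lemma log_scale_integral:
  fixes N :: nat
  assumes a: "a > 0" and N: "real N \<ge> a + 1"
  shows "\<exists>C\<ge>0. \<forall>y. 0 < y \<and> y \<le> 1 / 4 \<longrightarrow>
    (\<integral>\<^sup>+r. indicator {0<..<1/2} r * ennreal (r powr (- a - 1) / (- ln r) / (1 + y / r) ^ N) \<partial>lborel)
      \<le> ennreal (C * (y powr (- a) / (- ln y)))"
proof -
  \<comment> \<open>The constant of \<open>inverse_log_ratio\<close> for the exponent \<open>a/2\<close>.\<close>
  define C0 where "C0 = 1 + 1 / (a / 2 * ln 2)"
  have C0: "C0 \<ge> 1" using a by (simp add: C0_def)
  show ?thesis
  proof (intro exI[of _ "C0 * (1 + 2 / a)"] conjI allI impI; (elim conjE)?)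
    show "0 \<le> C0 * (1 + 2 / a)" using C0 a by simp
    fix y :: real assume y: "0 < y" "y \<le> 1 / 4"
    have ly: "0 < - ln y" using y by simp
    define K where "K = C0 / (- ln y)"
    have K: "K \<ge> 0" unfolding K_def using C0 ly by (intro divide_nonneg_pos) auto
    have pt: "indicator {0<..<1/2} r * ennreal (r powr (- a - 1) / (- ln r) / (1 + y / r) ^ N)
       \<le> ennreal K * (ennreal (y powr (- a - 1)) * indicator {0..y} r
           + ennreal (y powr (- (a / 2))) * (indicator {y..} r * ennreal (r powr (- (a / 2) - 1))))" for r
    proof (cases "0 < r \<and> r < 1/2")
      case r: True
      have lr: "0 < - ln r" using r by simp
      show ?thesis
      proof (cases "r \<le> y")
        case True
        \<comment> \<open>Only \<open>a + 1\<close> of the \<open>N\<close> powers are used; they leave an integrand bounded on \<open>[0,y]\<close>.\<close>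
        have "(y / r) powr (a + 1) \<le> (y / r) powr real N" using True r N by (intro powr_mono) auto
        also have "\<dots> = (y / r) ^ N" using r y by (intro powr_realpow) auto
        also have "\<dots> \<le> (1 + y / r) ^ N" using r y by (intro power_mono) auto
        finally have *: "(y / r) powr (a + 1) \<le> (1 + y / r) ^ N" .
        have "r powr (- a - 1) / (- ln r) / (1 + y / r) ^ N \<le> r powr (- a - 1) / (- ln y) / (y / r) powr (a + 1)"
          using * r y ly lr True by (intro frac_le divide_left_mono divide_nonneg_pos) auto
        also have "r powr (- a - 1) / (- ln y) / (y / r) powr (a + 1)
            = (r powr (- a - 1) * (y / r) powr (- a - 1)) / (- ln y)"
          using powr_minus_divide[of "y / r" "a + 1"] by (simp add: minus_diff_commute)
        also have "r powr (- a - 1) * (y / r) powr (- a - 1) = y powr (- a - 1)"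
          using r y by (simp flip: powr_mult)
        also have "y powr (- a - 1) / (- ln y) \<le> K * y powr (- a - 1)"
        proof -
          have "0 \<le> y powr (- a - 1) / (- ln y)" using ly by (intro divide_nonneg_pos) auto
          from mult_right_mono[OF C0 this] show ?thesis by (simp only: K_def mult_1 times_divide_eq_left times_divide_eq_right)
        qed
        finally have "ennreal (r powr (- a - 1) / (- ln r) / (1 + y / r) ^ N) \<le> ennreal (K * y powr (- a - 1))"
          by (rule ennreal_leI)
        also have "\<dots> = ennreal K * ennreal (y powr (- a - 1))" using K by (simp add: ennreal_mult)
        also have "ennreal (y powr (- a - 1)) \<le> ennreal (y powr (- a - 1)) * indicator {0..y} r
            + ennreal (y powr (- (a / 2))) * (indicator {y..} r * ennreal (r powr (- (a / 2) - 1)))"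
          by (rule add_increasing2) (use r True in simp_all)
        finally show ?thesis using r by (simp add: mult_left_mono)
      next
        case False
        then have ry: "y \<le> r" by simp
        have "r powr (- a - 1) / (- ln r) / (1 + y / r) ^ N \<le> r powr (- a - 1) / (- ln r) / 1"
          using r y lr by (intro divide_left_mono divide_nonneg_pos mult_pos_pos one_le_power) (auto simp: add_pos_nonneg)
        also have "\<dots> = r powr (- a - 1) * (1 / (- ln r))" by simp
        also have "\<dots> \<le> r powr (- a - 1) * (C0 * ((r / y) powr (a / 2) / (- ln y)))"
          unfolding C0_def using r y a ry by (intro mult_left_mono inverse_log_ratio) auto
        also have "\<dots> = K * (r powr (- a - 1) * (r powr (a / 2) * y powr (- (a / 2))))"
          using r y by (simp add: K_def powr_divide powr_minus_divide mult_ac)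
        also have "r powr (- a - 1) * (r powr (a / 2) * y powr (- (a / 2))) = y powr (- (a / 2)) * r powr (- (a / 2) - 1)"
          by (simp add: mult_ac flip: powr_add)
        finally have "ennreal (r powr (- a - 1) / (- ln r) / (1 + y / r) ^ N)
            \<le> ennreal (K * (y powr (- (a / 2)) * r powr (- (a / 2) - 1)))" by (rule ennreal_leI)
        also have "\<dots> = ennreal K * (ennreal (y powr (- (a / 2))) * ennreal (r powr (- (a / 2) - 1)))"
          using K by (simp add: ennreal_mult)
        also have "ennreal (y powr (- (a / 2))) * ennreal (r powr (- (a / 2) - 1)) \<le> ennreal (y powr (- a - 1)) * indicator {0..y} r
            + ennreal (y powr (- (a / 2))) * (indicator {y..} r * ennreal (r powr (- (a / 2) - 1)))"
          by (rule add_increasing) (use r ry in simp_all)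
        finally show ?thesis using r by (simp add: mult_left_mono)
      qed
    qed (auto simp: indicator_def)
    have "(\<integral>\<^sup>+r. indicator {0<..<1/2} r * ennreal (r powr (- a - 1) / (- ln r) / (1 + y / r) ^ N) \<partial>lborel)
      \<le> (\<integral>\<^sup>+r. ennreal K * (ennreal (y powr (- a - 1)) * indicator {0..y} r
           + ennreal (y powr (- (a / 2))) * (indicator {y..} r * ennreal (r powr (- (a / 2) - 1)))) \<partial>lborel)"
      by (intro nn_integral_mono pt)
    also have "\<dots> = ennreal K * (ennreal (y powr (- a - 1)) * ennreal y
        + ennreal (y powr (- (a / 2))) * ennreal (y powr (- (a / 2)) / (a / 2)))"
      using y a nn_integral_powr_tail[of "a / 2" y] by (simp add: nn_integral_cmult nn_integral_add)
    also have "\<dots> = ennreal (K * (y powr (- a - 1) * y + y powr (- (a / 2)) * (y powr (- (a / 2)) / (a / 2))))"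
      using y a K by (simp flip: ennreal_mult ennreal_plus)
    also have "y powr (- a - 1) * y = y powr (- a)"
      using y by (simp add: powr_diff field_simps)
    also have "y powr (- (a / 2)) * (y powr (- (a / 2)) / (a / 2)) = y powr (- a) * (2 / a)"
      by (simp add: field_simps flip: powr_add)
    also have "K * (y powr (- a) + y powr (- a) * (2 / a)) = C0 * (1 + 2 / a) * (y powr (- a) / (- ln y))"
      by (simp add: K_def algebra_simps)
    finally show "(\<integral>\<^sup>+r. indicator {0<..<1/2} r * ennreal (r powr (- a - 1) / (- ln r) / (1 + y / r) ^ N) \<partial>lborel)
      \<le> ennreal (C0 * (1 + 2 / a) * (y powr (- a) / (- ln y)))" .
  qed
qed

section \<open>Radial integrals\<close>

text \<open>
  Polar coordinates for radial functions. The image of Lebesgue measure under the norm and the measure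
  with density \<open>n \<omega>\<^sub>n r\<^bsup>n-1\<^esup>\<close> on the half line agree on all rays, by the volume of balls.
\<close>

lemma nn_integral_radial:
  assumes [measurable]: "\<phi> \<in> borel_measurable borel"
  shows "(\<integral>\<^sup>+x. \<phi> (norm (x :: real ^ 'n::finite)) \<partial>lborel)
    = (\<integral>\<^sup>+r. indicator {0..} r * ennreal (real CARD('n) * unit_ball_vol (real CARD('n)) * r ^ (CARD('n) - 1)) * \<phi> r \<partial>lborel)"
proof -
  let ?n = "CARD('n)"
  let ?w = "unit_ball_vol (real ?n)"
  let ?g = "\<lambda>r::real. indicator {0..} r * ennreal (real ?n * ?w * r ^ (?n - 1))"
  let ?M = "distr (lborel :: (real ^ 'n) measure) borel norm" and ?N = "density lborel ?g"
  have n: "?n > 0" by simp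
  have M: "emeasure ?M {..a} = ennreal (if 0 \<le> a then ?w * a ^ ?n else 0)" for a :: real
  proof -
    have "emeasure ?M {..a} = emeasure lborel (norm -` {..a} \<inter> space (lborel :: (real ^ 'n) measure))"
      by (rule emeasure_distr) auto
    also have "norm -` {..a} \<inter> space (lborel :: (real ^ 'n) measure) = cball 0 a" by auto
    finally show ?thesis using emeasure_cball[of a "0 :: real ^ 'n"] by auto
  qed
  have N: "emeasure ?N {..a} = ennreal (if 0 \<le> a then ?w * a ^ ?n else 0)" for a :: real
  proof (cases "0 \<le> a")
    case True
    have "emeasure ?N {..a} = (\<integral>\<^sup>+r. ?g r * indicator {..a} r \<partial>lborel)" by (rule emeasure_density) auto
    also have "\<dots> = (\<integral>\<^sup>+r. ennreal (real ?n * ?w * r ^ (?n - 1)) * indicator {0..a} r \<partial>lborel)"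
      by (intro nn_integral_cong) (auto simp: indicator_def)
    also have "\<dots> = ennreal (?w * a ^ ?n - ?w * 0 ^ ?n)"
      by (rule nn_integral_FTC_Icc) (use True in \<open>auto intro!: derivative_eq_intros\<close>)
    finally show ?thesis using True n by simp
  next
    case False
    have "emeasure ?N {..a} = (\<integral>\<^sup>+r. ?g r * indicator {..a} r \<partial>lborel)" by (rule emeasure_density) auto
    also have "\<dots> = (\<integral>\<^sup>+r. 0 \<partial>(lborel :: real measure))"
      using False by (intro nn_integral_cong) (auto simp: indicator_def)
    finally show ?thesis using False by simp
  qed
  have "?M = ?N"
  proof (rule measure_eqI_generator_eq[where E = "range atMost" and \<Omega> = UNIV and A = "\<lambda>k::nat. {..real k}"])
    show "Int_stable (range (atMost :: real \<Rightarrow> real set))" by (auto simp: Int_stable_def)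
    show "sets ?M = sigma_sets UNIV (range atMost)" "sets ?N = sigma_sets UNIV (range atMost)"
      by (simp_all add: borel_eq_atMost)
    show "(\<Union>k. {..real k}) = (UNIV :: real set)" using real_arch_simple by auto
    show "emeasure ?M {..real k} \<noteq> \<infinity>" for k by (simp add: M)
    show "emeasure ?M X = emeasure ?N X" if "X \<in> range atMost" for X using that M N by auto
  qed auto
  then have "(\<integral>\<^sup>+r. \<phi> r \<partial>?M) = (\<integral>\<^sup>+r. \<phi> r \<partial>?N)" by simp
  then show ?thesis by (simp add: nn_integral_distr nn_integral_density)
qed

abbreviation shell_integral :: "real set \<Rightarrow> (real ^ 'n::finite \<Rightarrow> real) \<Rightarrow> ennreal"
  where "shell_integral S f \<equiv> \<integral>\<^sup>+x. indicator S (norm x) * ennreal (f x) \<partial>lborel"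

lemma radial_power_far:
  assumes "b > 0"
  shows "\<exists>C\<ge>0. \<forall>\<delta>>0. shell_integral {\<delta>..} (\<lambda>x :: real ^ 'n::finite. norm x powr (- real CARD('n) - b))
     \<le> ennreal (C * \<delta> powr (- b))"
proof (intro exI[of _ "real CARD('n) * unit_ball_vol (real CARD('n)) / b"] conjI allI impI)
  let ?c = "real CARD('n) * unit_ball_vol (real CARD('n))"
  have c: "0 \<le> ?c" by simp
  then show "0 \<le> ?c / b" using assms by simp
  fix \<delta> :: real assume \<delta>: "\<delta> > 0"
  have "shell_integral {\<delta>..} (\<lambda>x :: real ^ 'n. norm x powr (- real CARD('n) - b))
    = (\<integral>\<^sup>+r. indicator {0..} r * ennreal (?c * r ^ (CARD('n) - 1)) * (indicator {\<delta>..} r * ennreal (r powr (- real CARD('n) - b))) \<partial>lborel)"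
    by (rule nn_integral_radial) measurable
  also have "\<dots> = (\<integral>\<^sup>+r. ennreal ?c * (indicator {\<delta>..} r * ennreal (r powr (- b - 1))) \<partial>lborel)"
  proof (rule nn_integral_cong)
    fix r :: real
    have "r ^ (CARD('n) - 1) * r powr (- real CARD('n) - b) = r powr (- b - 1)" if "r > 0"
    proof -
      have "r ^ (CARD('n) - 1) * r powr (- real CARD('n) - b) = r powr (real (CARD('n) - 1) + (- real CARD('n) - b))"
        using that by (simp only: powr_add powr_realpow)
      also have "real (CARD('n) - 1) + (- real CARD('n) - b) = - b - 1" by (simp add: of_nat_diff)
      finally show ?thesis .
    qed
    then show "indicator {0..} r * ennreal (?c * r ^ (CARD('n) - 1)) * (indicator {\<delta>..} r * ennreal (r powr (- real CARD('n) - b)))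
      = ennreal ?c * (indicator {\<delta>..} r * ennreal (r powr (- b - 1)))"
      using \<delta> c by (auto simp: indicator_def mult.assoc simp flip: ennreal_mult)
  qed
  also have "\<dots> = ennreal ?c * ennreal (\<delta> powr (- b) / b)"
    using assms \<delta> by (simp add: nn_integral_cmult nn_integral_powr_tail)
  also have "\<dots> = ennreal (?c / b * \<delta> powr (- b))" using c assms by (simp flip: ennreal_mult)
  finally show "shell_integral {\<delta>..} (\<lambda>x :: real ^ 'n. norm x powr (- real CARD('n) - b))
     \<le> ennreal (?c / b * \<delta> powr (- b))" by simp
qed

text \<open>
  In polar coordinates this is the integral of \<open>(-ln r)\<^bsup>-q\<^esup>/r\<close>.
\<close>

lemma radial_log_near:
  assumes q: "q > 1"
  shows "\<exists>C\<ge>0. \<forall>\<delta>. 0 < \<delta> \<and> \<delta> < 1 \<longrightarrow>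
    shell_integral {0<..\<delta>} (\<lambda>x :: real ^ 'n::finite. norm x powr (- real CARD('n)) * (- ln (norm x)) powr (- q))
     \<le> ennreal (C * (- ln \<delta>) powr (1 - q))"
proof (intro exI[of _ "real CARD('n) * unit_ball_vol (real CARD('n)) / (q - 1)"] conjI allI impI; (elim conjE)?)
  let ?c = "real CARD('n) * unit_ball_vol (real CARD('n))"
  have c: "0 \<le> ?c" by simp
  then show "0 \<le> ?c / (q - 1)" using assms by simp
  fix \<delta> :: real assume \<delta>: "0 < \<delta>" "\<delta> < 1"
  have "shell_integral {0<..\<delta>} (\<lambda>x :: real ^ 'n. norm x powr (- real CARD('n)) * (- ln (norm x)) powr (- q))
    = (\<integral>\<^sup>+r. indicator {0..} r * ennreal (?c * r ^ (CARD('n) - 1)) * (indicator {0<..\<delta>} r * ennreal (r powr (- real CARD('n)) * (- ln r) powr (- q))) \<partial>lborel)"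
    by (rule nn_integral_radial) measurable
  also have "\<dots> = (\<integral>\<^sup>+r. ennreal ?c * (indicator {0<..\<delta>} r * ennreal ((- ln r) powr (- q) / r)) \<partial>lborel)"
  proof (rule nn_integral_cong)
    fix r :: real
    have "r ^ (CARD('n) - 1) * (r powr (- real CARD('n)) * (- ln r) powr (- q)) = (- ln r) powr (- q) / r" if "r > 0"
    proof -
      have "r ^ (CARD('n) - 1) * r powr (- real CARD('n)) = r powr (- 1)"
        using that by (simp add: of_nat_diff flip: powr_realpow powr_add)
      then have "r ^ (CARD('n) - 1) * (r powr (- real CARD('n)) * (- ln r) powr (- q)) = r powr (- 1) * (- ln r) powr (- q)"
        by (simp only: mult.assoc[symmetric])
      also have "r powr (- 1) = 1 / r" using that by (simp add: powr_minus_divide)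
      finally show ?thesis by simp
    qed
    then show "indicator {0..} r * ennreal (?c * r ^ (CARD('n) - 1)) * (indicator {0<..\<delta>} r * ennreal (r powr (- real CARD('n)) * (- ln r) powr (- q)))
      = ennreal ?c * (indicator {0<..\<delta>} r * ennreal ((- ln r) powr (- q) / r))"
      using c by (auto simp: indicator_def mult.assoc simp flip: ennreal_mult)
  qed
  also have "\<dots> = ennreal ?c * (\<integral>\<^sup>+r. indicator {0<..\<delta>} r * ennreal ((- ln r) powr (- q) / r) \<partial>lborel)"
    by (rule nn_integral_cmult) measurable
  also have "\<dots> \<le> ennreal ?c * ennreal ((- ln \<delta>) powr (1 - q) / (q - 1))"
    by (intro mult_left_mono nn_integral_inverse_log_le q \<delta>) auto
  also have "\<dots> = ennreal (?c / (q - 1) * (- ln \<delta>) powr (1 - q))" using c assms by (simp flip: ennreal_mult)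
  finally show "shell_integral {0<..\<delta>} (\<lambda>x :: real ^ 'n. norm x powr (- real CARD('n)) * (- ln (norm x)) powr (- q))
     \<le> ennreal (?c / (q - 1) * (- ln \<delta>) powr (1 - q))" .
qed

text \<open>
  The logarithm is moved to \<open>\<delta>\<close> at the cost of \<open>(\<rho>/\<delta>)\<^bsup>1/2\<^esup>\<close>, after which \<open>q/2\<close> powers are left for
  the convergence at infinity.
\<close>

lemma radial_log_far:
  assumes q: "q > 1"
  shows "\<exists>C\<ge>0. \<forall>\<delta>. 0 < \<delta> \<and> \<delta> \<le> 1 / 2 \<longrightarrow>
    shell_integral {\<delta>..1/2} (\<lambda>x :: real ^ 'n::finite. norm x powr (- real CARD('n) - q) * (- ln (norm x)) powr (- q))
     \<le> ennreal (C * \<delta> powr (- q) * (- ln \<delta>) powr (- q))"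
proof -
  obtain C where C: "C \<ge> 0" "\<And>\<delta>. \<delta> > 0 \<Longrightarrow> shell_integral {\<delta>..} (\<lambda>x :: real ^ 'n. norm x powr (- real CARD('n) - q / 2))
     \<le> ennreal (C * \<delta> powr (- (q / 2)))"
    using radial_power_far[of "q / 2", where 'n = 'n] q by auto
  define K where "K = 1 + 1 / (1 / 2 * ln (2::real))"
  have K: "K \<ge> 0" by (simp add: K_def)
  show ?thesis
  proof (intro exI[of _ "K powr q * C"] conjI allI impI; (elim conjE)?)
    show "0 \<le> K powr q * C" using C by simp
    fix \<delta> :: real assume \<delta>: "0 < \<delta>" "\<delta> \<le> 1 / 2"
    have ld: "0 < - ln \<delta>" using \<delta> by simp
    define L where "L = K powr q * (\<delta> powr (- (q / 2)) * (- ln \<delta>) powr (- q))"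
    have L: "L \<ge> 0" by (simp add: L_def)
    have "shell_integral {\<delta>..1/2} (\<lambda>x :: real ^ 'n. norm x powr (- real CARD('n) - q) * (- ln (norm x)) powr (- q))
      \<le> (\<integral>\<^sup>+x. ennreal L * (indicator {\<delta>..} (norm (x :: real ^ 'n)) * ennreal (norm x powr (- real CARD('n) - q / 2))) \<partial>lborel)"
    proof (rule nn_integral_mono)
      fix x :: "real ^ 'n"
      define \<rho> where "\<rho> = norm x"
      show "indicator {\<delta>..1/2} (norm x) * ennreal (norm x powr (- real CARD('n) - q) * (- ln (norm x)) powr (- q))
        \<le> ennreal L * (indicator {\<delta>..} (norm x) * ennreal (norm x powr (- real CARD('n) - q / 2)))"
        unfolding \<rho>_def[symmetric]
      proof (cases "\<delta> \<le> \<rho> \<and> \<rho> \<le> 1 / 2")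
        case \<rho>: True
        then have \<rho>0: "0 < \<rho>" and lr: "0 < - ln \<rho>" using \<delta> by auto
        have "1 / (- ln \<rho>) \<le> K * ((\<rho> / \<delta>) powr (1 / 2) / (- ln \<delta>))"
          unfolding K_def using \<rho> \<delta> by (intro inverse_log_ratio) auto
        then have "(1 / (- ln \<rho>)) powr q \<le> (K * ((\<rho> / \<delta>) powr (1 / 2) / (- ln \<delta>))) powr q"
          using q lr by (intro powr_mono2) auto
        also have "(1 / (- ln \<rho>)) powr q = (- ln \<rho>) powr (- q)"
        proof -
          have "(1 / L) powr q = L powr (- q)" if "L > 0" for L :: real
            using that by (simp add: powr_divide powr_minus_divide)
          then show ?thesis using lr .
        qed
        also have "(K * ((\<rho> / \<delta>) powr (1 / 2) / (- ln \<delta>))) powr q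
            = K powr q * (\<rho> powr (q / 2) * \<delta> powr (- (q / 2)) * (- ln \<delta>) powr (- q))"
        proof -
          have "(K * ((\<rho> / \<delta>) powr (1 / 2) / L)) powr q = K powr q * (\<rho> powr (q / 2) * \<delta> powr (- (q / 2)) * L powr (- q))"
            if "L > 0" for L
            using K that \<rho>0 \<delta> by (simp add: powr_mult powr_divide powr_powr powr_minus_divide)
          then show ?thesis using ld .
        qed
        finally have "\<rho> powr (- real CARD('n) - q) * (- ln \<rho>) powr (- q)
           \<le> \<rho> powr (- real CARD('n) - q) * (K powr q * (\<rho> powr (q / 2) * \<delta> powr (- (q / 2)) * (- ln \<delta>) powr (- q)))"
          by (intro mult_left_mono) auto
        also have "\<dots> = L * (\<rho> powr (- real CARD('n) - q) * \<rho> powr (q / 2))" by (simp add: L_def mult_ac)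
        also have "\<rho> powr (- real CARD('n) - q) * \<rho> powr (q / 2) = \<rho> powr (- real CARD('n) - q / 2)"
          unfolding powr_add[symmetric] by (rule arg_cong[of _ _ "\<lambda>c. \<rho> powr c"]) simp
        finally have "ennreal (\<rho> powr (- real CARD('n) - q) * (- ln \<rho>) powr (- q)) \<le> ennreal (L * \<rho> powr (- real CARD('n) - q / 2))"
          by (rule ennreal_leI)
        then show "indicator {\<delta>..1/2} \<rho> * ennreal (\<rho> powr (- real CARD('n) - q) * (- ln \<rho>) powr (- q))
        \<le> ennreal L * (indicator {\<delta>..} \<rho> * ennreal (\<rho> powr (- real CARD('n) - q / 2)))"
          using \<rho> L by (simp add: indicator_def ennreal_mult)
      qed (auto simp: indicator_def)
    qed
    also have "\<dots> = ennreal L * shell_integral {\<delta>..} (\<lambda>x :: real ^ 'n. norm x powr (- real CARD('n) - q / 2))"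
      by (rule nn_integral_cmult) measurable
    also have "\<dots> \<le> ennreal L * ennreal (C * \<delta> powr (- (q / 2)))"
      by (intro mult_left_mono C \<delta>) auto
    also have "\<dots> = ennreal (K powr q * C * (\<delta> powr (- (q / 2)) * \<delta> powr (- (q / 2))) * (- ln \<delta>) powr (- q))"
      using L C by (simp add: L_def mult_ac flip: ennreal_mult)
    also have "\<delta> powr (- (q / 2)) * \<delta> powr (- (q / 2)) = \<delta> powr (- q)" by (simp flip: powr_add)
    finally show "shell_integral {\<delta>..1/2} (\<lambda>x :: real ^ 'n. norm x powr (- real CARD('n) - q) * (- ln (norm x)) powr (- q))
     \<le> ennreal (K powr q * C * \<delta> powr (- q) * (- ln \<delta>) powr (- q))" .
  qed
qed

section \<open>Hoelder's inequality\<close>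

text \<open>
  Young's inequality for \<open>a / A\<^bsup>1/q\<^esup>\<close> and \<open>b / B\<^bsup>1/p\<^esup>\<close>. Stating
  it with bounds \<open>A\<close> and \<open>B\<close> in place of the integrals fits the estimates below.
\<close>

lemma nn_integral_Holder:
  fixes a b :: "'a \<Rightarrow> real"
  assumes pq: "p > 1" "q > 1" "1 / q + 1 / p = 1"
    and [measurable]: "a \<in> borel_measurable M" "b \<in> borel_measurable M"
    and nn: "\<And>x. 0 \<le> a x" "\<And>x. 0 \<le> b x"
    and A: "(\<integral>\<^sup>+x. ennreal (a x powr q) \<partial>M) \<le> ennreal A" "0 \<le> A"
    and B: "(\<integral>\<^sup>+x. ennreal (b x powr p) \<partial>M) \<le> ennreal B" "0 \<le> B"
  shows "(\<integral>\<^sup>+x. ennreal (a x * b x) \<partial>M) \<le> ennreal (A powr (1 / q) * B powr (1 / p))"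
proof (cases "A = 0 \<or> B = 0")
  case True
  have "AE x in M. a x * b x = 0"
    using True
  proof
    assume "A = 0"
    then have "AE x in M. ennreal (a x powr q) = 0" using A by (subst nn_integral_0_iff_AE[symmetric]) auto
    then show ?thesis by eventually_elim (use nn in \<open>auto simp: ennreal_eq_0_iff\<close>)
  next
    assume "B = 0"
    then have "AE x in M. ennreal (b x powr p) = 0" using B by (subst nn_integral_0_iff_AE[symmetric]) auto
    then show ?thesis by eventually_elim (use nn in \<open>auto simp: ennreal_eq_0_iff\<close>)
  qed
  then have "(\<integral>\<^sup>+x. ennreal (a x * b x) \<partial>M) = 0"
    by (subst nn_integral_0_iff_AE) (auto elim!: eventually_mono)
  then show ?thesis by simp
next
  case False
  then have pos: "A > 0" "B > 0" using A B by auto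
  define \<alpha> \<beta> where "\<alpha> = A powr (1 / q)" and "\<beta> = B powr (1 / p)"
  have ab: "\<alpha> > 0" "\<beta> > 0" using pos by (auto simp: \<alpha>_def \<beta>_def)
  have pt: "ennreal (a x * b x) \<le> ennreal (\<alpha> * \<beta>) * (ennreal (1 / (q * A)) * ennreal (a x powr q) + ennreal (1 / (p * B)) * ennreal (b x powr p))" for x
  proof -
    have "(a x / \<alpha>) * (b x / \<beta>) \<le> (a x / \<alpha>) powr q / q + (b x / \<beta>) powr p / p"
      using pq nn ab by (intro Youngs_inequality) auto
    also have "(a x / \<alpha>) powr q = a x powr q / A"
      using nn ab pq pos by (simp add: powr_divide \<alpha>_def powr_powr)
    also have "(b x / \<beta>) powr p = b x powr p / B"
      using nn ab pq pos by (simp add: powr_divide \<beta>_def powr_powr)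
    finally have "a x * b x \<le> \<alpha> * \<beta> * (1 / (q * A) * a x powr q + 1 / (p * B) * b x powr p)"
      using ab by (simp add: field_simps)
    then have "ennreal (a x * b x) \<le> ennreal (\<alpha> * \<beta> * (1 / (q * A) * a x powr q + 1 / (p * B) * b x powr p))"
      by (rule ennreal_leI)
    also have "\<dots> = ennreal (\<alpha> * \<beta>) * (ennreal (1 / (q * A) * a x powr q) + ennreal (1 / (p * B) * b x powr p))"
      using ab pq pos by (subst ennreal_mult) auto
    also have "\<dots> = ennreal (\<alpha> * \<beta>) * (ennreal (1 / (q * A)) * ennreal (a x powr q) + ennreal (1 / (p * B)) * ennreal (b x powr p))"
    proof -
      have "ennreal (1 / (q * A) * a x powr q) = ennreal (1 / (q * A)) * ennreal (a x powr q)"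
        "ennreal (1 / (p * B) * b x powr p) = ennreal (1 / (p * B)) * ennreal (b x powr p)"
        using pq pos by (intro ennreal_mult; simp)+
      then show ?thesis by (simp only:)
    qed
    finally show ?thesis .
  qed
  have "(\<integral>\<^sup>+x. ennreal (a x * b x) \<partial>M)
    \<le> (\<integral>\<^sup>+x. ennreal (\<alpha> * \<beta>) * (ennreal (1 / (q * A)) * ennreal (a x powr q) + ennreal (1 / (p * B)) * ennreal (b x powr p)) \<partial>M)"
    by (intro nn_integral_mono pt)
  also have "\<dots> = ennreal (\<alpha> * \<beta>) * (ennreal (1 / (q * A)) * (\<integral>\<^sup>+x. ennreal (a x powr q) \<partial>M) + ennreal (1 / (p * B)) * (\<integral>\<^sup>+x. ennreal (b x powr p) \<partial>M))"
    by (simp add: nn_integral_cmult nn_integral_add)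
  also have "\<dots> \<le> ennreal (\<alpha> * \<beta>) * (ennreal (1 / (q * A)) * ennreal A + ennreal (1 / (p * B)) * ennreal B)"
    by (intro mult_left_mono add_mono A B) auto
  also have "ennreal (1 / (q * A)) * ennreal A = ennreal (1 / q)"
    using pos pq by (simp flip: ennreal_mult)
  also have "ennreal (1 / (p * B)) * ennreal B = ennreal (1 / p)"
    using pos pq by (simp flip: ennreal_mult)
  also have "ennreal (1 / q) + ennreal (1 / p) = 1" using pq by (simp flip: ennreal_plus)
  finally show ?thesis by (simp add: \<alpha>_def \<beta>_def)
qed

section \<open>The subordination measure\<close>

lemma measurable_Gamma [measurable]: "(Gamma :: real \<Rightarrow> real) \<in> borel_measurable borel"
proof -
  have "(\<lambda>x::real. inverse (rGamma x)) \<in> borel_measurable borel"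
    by (intro borel_measurable_inverse borel_measurable_continuous_onI continuous_on_rGamma)
  then show ?thesis by (simp add: rGamma_inverse_Gamma)
qed

text \<open>
  The part of the Gamma integral over \<open>[1,2]\<close> suffices.
\<close>

lemma Gamma_ge:
  assumes "\<sigma> > 0"
  shows "Gamma \<sigma> \<ge> exp (-2) / (2::real)"
proof -
  have "ennreal (exp (-2) / 2) = (\<integral>\<^sup>+t. ennreal (exp (-2) / 2) * indicator {1..2::real} t \<partial>lborel)"
    by (subst nn_integral_cmult_indicator) auto
  also have "\<dots> \<le> (\<integral>\<^sup>+t. ennreal (indicator {0..} t * t powr (\<sigma> - 1) / exp t) \<partial>lborel)"
  proof (rule nn_integral_mono)
    fix t :: real
    have "exp (-2) / 2 \<le> t powr (\<sigma> - 1) / exp t" if t: "1 \<le> t" "t \<le> 2"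
    proof -
      have "1 / 2 \<le> 1 / t" using t by (simp add: field_simps)
      also have "1 / t = t powr (- 1)" using t by (simp add: powr_minus_divide)
      also have "\<dots> \<le> t powr (\<sigma> - 1)" using t assms by (intro powr_mono) auto
      finally have "1 / 2 * (1 / exp 2) \<le> t powr (\<sigma> - 1) * (1 / exp t)"
        using t by (intro mult_mono divide_left_mono) auto
      then show ?thesis by (simp add: exp_minus field_simps)
    qed
    then show "ennreal (exp (-2) / 2) * indicator {1..2} t \<le> ennreal (indicator {0..} t * t powr (\<sigma> - 1) / exp t)"
      by (auto simp: indicator_def intro!: ennreal_leI)
  qed
  also have "\<dots> = ennreal (Gamma \<sigma>)" using Gamma_conv_nn_integral_real[OF assms] by simp
  finally show ?thesis using assms by (simp add: ennreal_le_iff Gamma_real_pos less_imp_le)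
qed

lemma Gamma_laplace:
  assumes "\<sigma> > 0" "\<mu> > 0"
  shows "(\<integral>\<^sup>+r. indicator {0<..} r * ennreal (exp (- (\<mu> * r)) * (r powr (\<sigma> - 1) / Gamma \<sigma>)) \<partial>lborel)
    = ennreal (\<mu> powr (- \<sigma>))"
proof -
  have G: "Gamma \<sigma> > 0" using assms by (rule_tac Gamma_real_pos)
  let ?I = "\<integral>\<^sup>+r. indicator {0<..} r * ennreal (exp (- (\<mu> * r)) * (r powr (\<sigma> - 1) / Gamma \<sigma>)) \<partial>lborel"
  have "ennreal (Gamma \<sigma>) = (\<integral>\<^sup>+t. ennreal (indicator {0..} t * t powr (\<sigma> - 1) / exp t) \<partial>lborel)"
    by (rule Gamma_conv_nn_integral_real[OF assms(1)])
  also have "\<dots> = ennreal \<bar>\<mu>\<bar> * (\<integral>\<^sup>+r. ennreal (indicator {0..} (0 + \<mu> * r) * (0 + \<mu> * r) powr (\<sigma> - 1) / exp (0 + \<mu> * r)) \<partial>lborel)"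
    using assms by (intro nn_integral_real_affine) auto
  also have "(\<integral>\<^sup>+r. ennreal (indicator {0..} (0 + \<mu> * r) * (0 + \<mu> * r) powr (\<sigma> - 1) / exp (0 + \<mu> * r)) \<partial>lborel)
     = (\<integral>\<^sup>+r. ennreal (\<mu> powr (\<sigma> - 1) * Gamma \<sigma>) * (indicator {0<..} r * ennreal (exp (- (\<mu> * r)) * (r powr (\<sigma> - 1) / Gamma \<sigma>))) \<partial>lborel)"
  proof (rule nn_integral_cong)
    fix r :: real
    show "ennreal (indicator {0..} (0 + \<mu> * r) * (0 + \<mu> * r) powr (\<sigma> - 1) / exp (0 + \<mu> * r))
      = ennreal (\<mu> powr (\<sigma> - 1) * Gamma \<sigma>) * (indicator {0<..} r * ennreal (exp (- (\<mu> * r)) * (r powr (\<sigma> - 1) / Gamma \<sigma>)))"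
    proof (cases "0 < r")
      case True
      define g where "g = Gamma \<sigma>"
      have "g > 0" using G by (simp add: g_def)
      then show ?thesis unfolding g_def[symmetric] using assms True
        by (simp add: indicator_def powr_mult exp_minus field_simps flip: ennreal_mult)
    next
      case False
      then have "r = 0 \<or> \<mu> * r < 0" using assms by (metis linorder_neqE_linordered_idom mult_pos_neg)
      then show ?thesis using False by (auto simp: indicator_def)
    qed
  qed
  also have "\<dots> = ennreal (\<mu> powr (\<sigma> - 1) * Gamma \<sigma>) * ?I" by (rule nn_integral_cmult) measurable
  finally have "ennreal (Gamma \<sigma>) = ennreal (\<mu> * \<mu> powr (\<sigma> - 1) * Gamma \<sigma>) * ?I"
    using assms G by (simp add: ennreal_mult mult.assoc)
  also have "\<mu> * \<mu> powr (\<sigma> - 1) = \<mu> powr \<sigma>" using assms by (simp add: powr_diff)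
  finally have eq: "ennreal (Gamma \<sigma>) = ennreal (\<mu> powr \<sigma> * Gamma \<sigma>) * ?I" .
  define g X where "g = Gamma \<sigma>" and "X = \<mu> powr \<sigma> * Gamma \<sigma>"
  have g: "g > 0" "X > 0" using G assms by (simp_all add: g_def X_def)
  have gX: "1 / X * g = \<mu> powr (- \<sigma>)"
    unfolding X_def g_def[symmetric] using g(1) by (simp add: powr_minus_divide)
  have "?I = ennreal (1 / X * X) * ?I" using g by simp
  also have "\<dots> = ennreal (1 / X) * (ennreal X * ?I)"
    using g by (subst ennreal_mult) (auto simp: mult.assoc)
  also have "ennreal X * ?I = ennreal g" using eq by (simp only: X_def g_def)
  also have "ennreal (1 / X) * ennreal g = ennreal (1 / X * g)"
    using g by (intro ennreal_mult[symmetric]) auto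
  finally show ?thesis by (simp only: gX)
qed

text \<open>
  For \<open>\<mu> > 1\<close> one has \<open>1/(\<mu>\<^sup>s ln \<mu>) = \<integral>\<^sub>0\<^sup>\<infinity> \<mu>\<^bsup>-(s+t)\<^esup> dt\<close>, and \<open>\<mu>\<^bsup>-\<sigma>\<^esup>\<close> is the Laplace
  transform of \<open>r\<^bsup>\<sigma>-1\<^esup>/\<Gamma>(\<sigma>)\<close>. Exchanging the integrals, \<open>1/(\<mu>\<^sup>s ln \<mu>)\<close> is the Laplace transform of
  the following weight.
\<close>

definition log_weight :: "real \<Rightarrow> real \<Rightarrow> ennreal"
  where "log_weight s r = (\<integral>\<^sup>+t. indicator {0..} t * ennreal (r powr (s + t - 1) / Gamma (s + t)) \<partial>lborel)"

lemma measurable_log_weight [measurable]: "log_weight s \<in> borel_measurable borel"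
  unfolding log_weight_def[abs_def] by measurable

text \<open>
  As \<open>1/\<Gamma>\<close> is bounded on \<open>(0,\<infinity>)\<close>, the weight is at most a constant times
  \<open>r\<^bsup>s-1\<^esup> \<integral>\<^sub>0\<^sup>\<infinity> r\<^sup>t dt\<close>, and this integral is \<open>1/|ln r|\<close>.
\<close>

lemma log_weight_le:
  assumes s: "s > 0" and r: "0 < r" "r < 1"
  shows "log_weight s r \<le> ennreal (2 * exp 2 * (r powr (s - 1) / (- ln r)))"
proof -
  have lr: "0 < - ln r" using r by simp
  have "log_weight s r \<le> (\<integral>\<^sup>+t. ennreal (2 * exp 2 * r powr (s - 1)) * (indicator {0..} t * ennreal (exp (- (- ln r * t)))) \<partial>lborel)"
    unfolding log_weight_def
  proof (rule nn_integral_mono)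
    fix t :: real
    have "r powr (s + t - 1) / Gamma (s + t) \<le> 2 * exp 2 * r powr (s - 1) * exp (- (- ln r * t))" if "0 \<le> t"
    proof -
      have G: "exp (-2) / 2 \<le> Gamma (s + t)" using s that by (intro Gamma_ge) auto
      have "r powr (s + t - 1) / Gamma (s + t) \<le> r powr (s + t - 1) / (exp (-2) / 2)"
        using G by (intro divide_left_mono mult_pos_pos) (auto intro: less_le_trans[OF _ G])
      also have "\<dots> = 2 * exp 2 * r powr (s + t - 1)" by (simp add: exp_minus field_simps)
      also have "\<dots> = 2 * exp 2 * (r powr (s - 1) * r powr t)" by (simp add: algebra_simps flip: powr_add)
      also have "r powr t = exp (- (- ln r * t))" using r by (simp add: powr_def mult.commute)
      finally show ?thesis by simp
    qed
    then have "ennreal (r powr (s + t - 1) / Gamma (s + t)) \<le> ennreal (2 * exp 2 * r powr (s - 1)) * ennreal (exp (- (- ln r * t)))" if "0 \<le> t"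
      using that by (subst ennreal_mult[symmetric]) (auto intro!: ennreal_leI)
    then show "indicator {0..} t * ennreal (r powr (s + t - 1) / Gamma (s + t))
      \<le> ennreal (2 * exp 2 * r powr (s - 1)) * (indicator {0..} t * ennreal (exp (- (- ln r * t))))"
      by (auto simp: indicator_def)
  qed
  also have "\<dots> = ennreal (2 * exp 2 * r powr (s - 1)) * ennreal (1 / (- ln r))"
    by (subst nn_integral_cmult) (use lr nn_integral_exp_half_line[OF lr] in auto)
  also have "\<dots> = ennreal (2 * exp 2 * (r powr (s - 1) / (- ln r)))"
    using lr by (subst ennreal_mult[symmetric]) (auto simp: less_imp_le divide_nonneg_neg)
  finally show ?thesis .
qed

text \<open>
  The factor \<open>exp (-\<lambda>r)\<close> shifts the argument of the Laplace transform from \<open>c\<close> to \<open>\<lambda> + c\<close>.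
\<close>

definition nu :: "real \<Rightarrow> real \<Rightarrow> real measure"
  where "nu s lam = density lborel (\<lambda>r. indicator {0<..} r * ennreal (exp (- (lam * r))) * log_weight s r)"

lemma sets_nu [simp, measurable_cong]: "sets (nu s lam) = sets borel" by (simp add: nu_def)
lemma space_nu [simp]: "space (nu s lam) = UNIV" by (simp add: nu_def)

lemma nn_integral_nu:
  assumes "f \<in> borel_measurable borel"
  shows "(\<integral>\<^sup>+r. f r \<partial>nu s lam) = (\<integral>\<^sup>+r. indicator {0<..} r * ennreal (exp (- (lam * r))) * log_weight s r * f r \<partial>lborel)"
  unfolding nu_def using assms by (intro nn_integral_density) auto

lemma nn_integral_nu_exp:
  assumes s: "s > 0" and mu: "lam + c > 1"
  shows "(\<integral>\<^sup>+r. ennreal (exp (- (c * r))) \<partial>nu s lam) = ennreal (1 / ((lam + c) powr s * ln (lam + c)))"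
proof -
  let ?\<mu> = "lam + c"
  let ?f = "\<lambda>r t. indicator {0<..} r * indicator {0..} t * ennreal (exp (- (?\<mu> * r)) * (r powr (s + t - 1) / Gamma (s + t)))"
  have "(\<integral>\<^sup>+r. ennreal (exp (- (c * r))) \<partial>nu s lam)
    = (\<integral>\<^sup>+r. indicator {0<..} r * ennreal (exp (- (lam * r))) * log_weight s r * ennreal (exp (- (c * r))) \<partial>lborel)"
    by (rule nn_integral_nu) measurable
  also have "\<dots> = (\<integral>\<^sup>+r. \<integral>\<^sup>+t. ?f r t \<partial>lborel \<partial>lborel)"
  proof (rule nn_integral_cong)
    fix r :: real
    have "indicator {0<..} r * ennreal (exp (- (lam * r))) * log_weight s r * ennreal (exp (- (c * r)))
      = (indicator {0<..} r * ennreal (exp (- (lam * r))) * ennreal (exp (- (c * r)))) * log_weight s r"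
      by (simp add: mult_ac)
    also have "ennreal (exp (- (lam * r))) * ennreal (exp (- (c * r))) = ennreal (exp (- (?\<mu> * r)))"
      by (simp add: algebra_simps flip: ennreal_mult exp_add)
    then have "indicator {0<..} r * ennreal (exp (- (lam * r))) * ennreal (exp (- (c * r))) = indicator {0<..} r * ennreal (exp (- (?\<mu> * r)))"
      by (simp only: mult.assoc)
    also have "indicator {0<..} r * ennreal (exp (- (?\<mu> * r))) * log_weight s r
       = (\<integral>\<^sup>+t. indicator {0<..} r * ennreal (exp (- (?\<mu> * r))) * (indicator {0..} t * ennreal (r powr (s + t - 1) / Gamma (s + t))) \<partial>lborel)"
      unfolding log_weight_def by (rule nn_integral_cmult[symmetric]) measurable
    also have "\<dots> = (\<integral>\<^sup>+t. ?f r t \<partial>lborel)"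
      using s by (intro nn_integral_cong) (auto simp: indicator_def Gamma_real_pos less_imp_le simp flip: ennreal_mult)
    finally show "indicator {0<..} r * ennreal (exp (- (lam * r))) * log_weight s r * ennreal (exp (- (c * r))) = (\<integral>\<^sup>+t. ?f r t \<partial>lborel)" .
  qed
  also have "\<dots> = (\<integral>\<^sup>+t. \<integral>\<^sup>+r. ?f r t \<partial>lborel \<partial>lborel)"
    by (rule lborel_pair.Fubini'[symmetric]) measurable
  also have "\<dots> = (\<integral>\<^sup>+t. ennreal (?\<mu> powr (- s)) * (indicator {0..} t * ennreal (exp (- (ln ?\<mu> * t)))) \<partial>lborel)"
  proof (rule nn_integral_cong)
    fix t :: real
    show "(\<integral>\<^sup>+r. ?f r t \<partial>lborel) = ennreal (?\<mu> powr (- s)) * (indicator {0..} t * ennreal (exp (- (ln ?\<mu> * t))))"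
    proof (cases "0 \<le> t")
      case True
      have "(\<integral>\<^sup>+r. ?f r t \<partial>lborel) = ennreal (?\<mu> powr (- (s + t)))"
        using Gamma_laplace[of "s + t" ?\<mu>] True s mu by simp
      also have "?\<mu> powr (- (s + t)) = ?\<mu> powr (- s) * exp (- (ln ?\<mu> * t))"
        using mu by (simp add: powr_def algebra_simps flip: exp_add)
      finally show ?thesis using True by (simp add: ennreal_mult)
    qed simp
  qed
  also have "\<dots> = ennreal (?\<mu> powr (- s)) * ennreal (1 / ln ?\<mu>)"
    using mu by (subst nn_integral_cmult) (auto simp: nn_integral_exp_half_line)
  also have "\<dots> = ennreal (1 / (?\<mu> powr s * ln ?\<mu>))"
    using mu by (subst ennreal_mult[symmetric]) (auto simp: powr_minus_divide)
  finally show ?thesis .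
qed

lemma AE_nu_pos: "AE r in nu s lam. r > 0"
  unfolding nu_def by (subst AE_density) (auto simp: indicator_def)

lemma finite_measure_nu:
  assumes "s > 0" "lam > 1"
  shows "finite_measure (nu s lam)"
proof
  have "emeasure (nu s lam) (space (nu s lam)) = (\<integral>\<^sup>+r. ennreal (exp (- (0 * r))) \<partial>nu s lam)" by simp
  also have "\<dots> < \<infinity>" using assms by (subst nn_integral_nu_exp) auto
  finally show "emeasure (nu s lam) (space (nu s lam)) \<noteq> \<infinity>" by simp
qed

lemma powr_le_exp:
  fixes r :: real
  assumes "d > 0" "j > 0" "r > 0"
  shows "r powr j \<le> (j / d) powr j * exp (d * r)"
proof -
  have "ln (d * r / j) \<le> d * r / j - 1" using assms by (intro ln_le_minus_one) auto
  then have "ln r \<le> d * r / j + ln (j / d)" using assms by (simp add: ln_mult ln_div)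
  then have "j * ln r \<le> j * (d * r / j + ln (j / d))" using assms by (intro mult_left_mono) auto
  also have "\<dots> = d * r + j * ln (j / d)" using assms by (simp add: algebra_simps)
  finally have "exp (j * ln r) \<le> exp (d * r) * exp (j * ln (j / d))" by (simp flip: exp_add)
  then show ?thesis using assms by (simp add: powr_def mult_ac)
qed

text \<open>
  Since \<open>\<lambda> > 1\<close>, a growing exponential \<open>exp (dr)\<close> with \<open>\<lambda> - d > 1\<close> is still integrable, and it dominates
  every power of \<open>r\<close> on \<open>[1/2,\<infinity>)\<close>.
\<close>

lemma nu_moments:
  assumes s: "s > 0" and lam: "lam > 1"
  shows "(\<integral>\<^sup>+r. indicator {1/2..} r * ennreal (r powr j) \<partial>nu s lam) < \<infinity>"
proof -
  \<comment> \<open>Half of the room between \<open>lam\<close> and \<open>1\<close>.\<close>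
  define d where "d = (lam - 1) / 2"
  have d: "d > 0" "lam + - d > 1" using lam by (simp_all add: d_def field_simps)
  obtain C where C: "C \<ge> 0" "\<And>r. r \<ge> 1/2 \<Longrightarrow> r powr j \<le> C * exp (d * r)"
  proof (cases "j > 0")
    case True
    then show ?thesis using powr_le_exp[OF d(1) True] by (intro that[of "(j / d) powr j"]) auto
  next
    case False
    have "r powr j \<le> (1/2) powr j * exp (d * r)" if "r \<ge> 1/2" for r :: real
    proof -
      have "r powr j \<le> (1/2) powr j" using False that by (intro powr_mono2') auto
      also have "\<dots> \<le> (1/2) powr j * exp (d * r)" using that d by (simp add: mult_le_cancel_left1)
      finally show ?thesis .
    qed
    then show ?thesis by (intro that[of "(1/2) powr j"]) auto
  qed
  have "(\<integral>\<^sup>+r. indicator {1/2..} r * ennreal (r powr j) \<partial>nu s lam) \<le> (\<integral>\<^sup>+r. ennreal C * ennreal (exp (- (- d * r))) \<partial>nu s lam)"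
  proof (rule nn_integral_mono)
    fix r
    show "indicator {1/2..} r * ennreal (r powr j) \<le> ennreal C * ennreal (exp (- (- d * r)))"
      using C by (auto simp: indicator_def simp flip: ennreal_mult intro!: ennreal_leI)
  qed
  also have "\<dots> = ennreal C * ennreal (1 / ((lam + - d) powr s * ln (lam + - d)))"
    by (subst nn_integral_cmult) (use nn_integral_nu_exp[OF s d(2)] in auto)
  also have "\<dots> < \<infinity>" by (simp add: ennreal_mult_less_top)
  finally show ?thesis .
qed

section \<open>Majorants of the kernel\<close>

text \<open>
  The majorant of the kernel and its derivatives; \<open>2a\<close> is the order of the singularity at the origin,
  and \<open>N\<close> governs the decay.
\<close>

definition kmaj :: "real \<Rightarrow> nat \<Rightarrow> real ^ 'n::finite \<Rightarrow> real"
  where "kmaj a N x = (if norm x \<le> 1 / 2 then norm x powr (- (2 * a)) / (- ln (norm x)) else norm x powr (- (2 * real N)))"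

lemma measurable_kmaj [measurable]: "kmaj a N \<in> borel_measurable borel"
  unfolding kmaj_def[abs_def] by measurable

lemma kmaj_nonneg: "0 \<le> kmaj a N x"
proof -
  have "0 \<le> - ln (norm x)" if "norm x \<le> 1 / 2"
    using that by (cases "x = 0") auto
  then have "norm x \<le> 1 / 2 \<Longrightarrow> 0 \<le> norm x powr (- (2 * a)) / (- ln (norm x))"
    by (intro divide_nonneg_nonneg) auto
  then show ?thesis unfolding kmaj_def
    by (cases "norm x \<le> 1 / 2") (simp_all only: if_True if_False powr_ge_zero)
qed

text \<open>
  With \<open>y = |x|\<^sup>2\<close> the integrand is the profile of a rapidly decreasing function at scale \<open>\<surd>r\<close>. For
  small \<open>y\<close> the part \<open>r < 1/2\<close> is a logarithmic scale integral by the bound on the weight, and the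
  part \<open>r \<ge> 1/2\<close> is bounded by a moment of \<open>\<nu>\<close>. For large \<open>y\<close> one uses \<open>(1 + y/r)\<^bsup>-N\<^esup> \<le> (r/y)\<^sup>N\<close>
  and moments again.
\<close>

lemma nu_gauss_majorant:
  fixes N :: nat
  assumes s: "s > 0" and lam: "lam > 1" and a: "a > 0" and b: "b \<le> a + s" and N: "real N \<ge> a + 1" "real N \<ge> b"
  shows "\<exists>C\<ge>0. \<forall>x :: real ^ 'n::finite. x \<noteq> 0 \<longrightarrow>
    (\<integral>\<^sup>+r. ennreal (r powr (- b) / (1 + (norm x)\<^sup>2 / r) ^ N) \<partial>nu s lam) \<le> ennreal (C * kmaj a N x)"
proof -
  obtain C1 where C1: "C1 \<ge> 0" "\<And>y. 0 < y \<Longrightarrow> y \<le> 1 / 4 \<Longrightarrow>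
    (\<integral>\<^sup>+r. indicator {0<..<1/2} r * ennreal (r powr (- a - 1) / (- ln r) / (1 + y / r) ^ N) \<partial>lborel)
      \<le> ennreal (C1 * (y powr (- a) / (- ln y)))"
    using log_scale_integral[OF a N(1)] by blast
  \<comment> \<open>Moments for \<open>r \<ge> 1/2\<close> at small and at large \<open>x\<close>, and the total mass for \<open>r < 1/2\<close> at large \<open>x\<close>.\<close>
  define B2 where "B2 = enn2real (\<integral>\<^sup>+r. indicator {1/2..} r * ennreal (r powr (- b)) \<partial>nu s lam)"
  have B2: "(\<integral>\<^sup>+r. indicator {1/2..} r * ennreal (r powr (- b)) \<partial>nu s lam) = ennreal B2" "B2 \<ge> 0"
    using nu_moments[OF s lam, of "- b"] by (auto simp: B2_def)
  define B3 where "B3 = enn2real (\<integral>\<^sup>+r. indicator {1/2..} r * ennreal (r powr (real N - b)) \<partial>nu s lam)"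
  have B3: "(\<integral>\<^sup>+r. indicator {1/2..} r * ennreal (r powr (real N - b)) \<partial>nu s lam) = ennreal B3" "B3 \<ge> 0"
    using nu_moments[OF s lam, of "real N - b"] by (auto simp: B3_def)
  interpret finite_measure "nu s lam" by (rule finite_measure_nu[OF s lam])
  define B4 where "B4 = measure (nu s lam) UNIV"
  have B4: "emeasure (nu s lam) UNIV = ennreal B4" "B4 \<ge> 0" unfolding B4_def by (simp_all add: emeasure_eq_measure)
  define C where "C = 2 * exp 2 * C1 + B2 / a + B3 + B4"
  have C: "C \<ge> 0" using C1 B2 B3 B4 a by (simp add: C_def)
  let ?g = "\<lambda>y r. r powr (- b) / (1 + y / r) ^ N"
  have near: "(\<integral>\<^sup>+r. ennreal (?g y r) \<partial>nu s lam) \<le> ennreal (C * (y powr (- a) / (- ln y)))"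
    if y: "0 < y" "y \<le> 1 / 4" for y
  proof -
    have ly: "0 < - ln y" using y by simp
    have "(\<integral>\<^sup>+r. ennreal (?g y r) \<partial>nu s lam)
      \<le> (\<integral>\<^sup>+r. indicator {0<..<1/2} r * ennreal (?g y r) + indicator {1/2..} r * ennreal (r powr (- b)) \<partial>nu s lam)"
    proof (rule nn_integral_mono_AE, use AE_nu_pos in eventually_elim)
      case (elim r)
      have "?g y r \<le> r powr (- b) / 1"
        using elim y by (intro divide_left_mono one_le_power mult_pos_pos) (auto simp: add_pos_pos)
      then show ?case using elim by (auto simp: indicator_def intro!: ennreal_leI)
    qed
    also have "\<dots> = (\<integral>\<^sup>+r. indicator {0<..<1/2} r * ennreal (?g y r) \<partial>nu s lam) + ennreal B2"
      by (subst nn_integral_add) (auto simp: B2)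
    also have "(\<integral>\<^sup>+r. indicator {0<..<1/2} r * ennreal (?g y r) \<partial>nu s lam)
      = (\<integral>\<^sup>+r. indicator {0<..} r * ennreal (exp (- (lam * r))) * log_weight s r * (indicator {0<..<1/2} r * ennreal (?g y r)) \<partial>lborel)"
      by (rule nn_integral_nu) measurable
    also have "\<dots> \<le> (\<integral>\<^sup>+r. ennreal (2 * exp 2) * (indicator {0<..<1/2} r * ennreal (r powr (- a - 1) / (- ln r) / (1 + y / r) ^ N)) \<partial>lborel)"
    proof (rule nn_integral_mono)
      fix r :: real
      show "indicator {0<..} r * ennreal (exp (- (lam * r))) * log_weight s r * (indicator {0<..<1/2} r * ennreal (?g y r))
        \<le> ennreal (2 * exp 2) * (indicator {0<..<1/2} r * ennreal (r powr (- a - 1) / (- ln r) / (1 + y / r) ^ N))"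
      proof (cases "0 < r \<and> r < 1 / 2")
        case r: True
        have lr: "0 < - ln r" using r by simp
        have yr: "0 < (1 + y / r) ^ N" using r y by (auto intro!: zero_less_power simp: add_pos_pos)
        have 1: "ennreal (exp (- (lam * r))) \<le> 1" using r lam by (simp add: ennreal_le_1)
        have 2: "log_weight s r \<le> ennreal (2 * exp 2 * (r powr (s - 1) / (- ln r)))" using r by (intro log_weight_le s) auto
        have nn: "0 \<le> r powr (s - 1) / (- ln r)" using lr by (intro divide_nonneg_pos) auto
        have "ennreal (exp (- (lam * r))) * log_weight s r * ennreal (?g y r)
          \<le> 1 * ennreal (2 * exp 2 * (r powr (s - 1) / (- ln r))) * ennreal (?g y r)"
          by (intro mult_mono 1 2) auto
        also have "\<dots> = ennreal (2 * exp 2 * (r powr (s - 1) / (- ln r)) * ?g y r)"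
        proof -
          have "0 \<le> 2 * exp 2 * (r powr (s - 1) / (- ln r))" by (intro mult_nonneg_nonneg nn) auto
          moreover have "0 \<le> ?g y r" using yr by (intro divide_nonneg_pos) auto
          ultimately show ?thesis by (simp only: mult_1 ennreal_mult)
        qed
        also have "2 * exp 2 * (r powr (s - 1) / (- ln r)) * ?g y r = 2 * exp 2 * ((r powr (s - 1) * r powr (- b)) / (- ln r) / (1 + y / r) ^ N)"
          by simp
        also have "ennreal \<dots> \<le> ennreal (2 * exp 2 * (r powr (- a - 1) / (- ln r) / (1 + y / r) ^ N))"
        proof -
          \<comment> \<open>Here \<open>r < 1\<close> and the assumption \<open>b \<le> a + s\<close> enter.\<close>
          have "r powr (s - 1) * r powr (- b) \<le> r powr (- a - 1)"
            unfolding powr_add[symmetric] using r b by (intro powr_mono') auto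
          then show ?thesis using lr yr by (intro ennreal_leI mult_left_mono divide_right_mono) auto
        qed
        also have "\<dots> = ennreal (2 * exp 2) * ennreal (r powr (- a - 1) / (- ln r) / (1 + y / r) ^ N)"
        proof (rule ennreal_mult)
          show "0 \<le> r powr (- a - 1) / (- ln r) / (1 + y / r) ^ N"
            using lr yr by (intro divide_nonneg_pos) auto
        qed simp
        finally show ?thesis using r by simp
      qed (auto simp: indicator_def)
    qed
    also have "\<dots> = ennreal (2 * exp 2) * (\<integral>\<^sup>+r. indicator {0<..<1/2} r * ennreal (r powr (- a - 1) / (- ln r) / (1 + y / r) ^ N) \<partial>lborel)"
      by (rule nn_integral_cmult) measurable
    also have "\<dots> \<le> ennreal (2 * exp 2) * ennreal (C1 * (y powr (- a) / (- ln y)))"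
      by (intro mult_left_mono C1(2) y) auto
    also have "\<dots> = ennreal (2 * exp 2 * C1 * (y powr (- a) / (- ln y)))"
    proof -
      have "0 \<le> y powr (- a) / (- ln y)" using ly by (intro divide_nonneg_pos) auto
      from ennreal_mult[OF _ mult_nonneg_nonneg[OF C1(1) this], of "2 * exp 2"] show ?thesis
        by (simp only: mult.assoc) simp
    qed
    finally have 1: "(\<integral>\<^sup>+r. ennreal (?g y r) \<partial>nu s lam) \<le> ennreal (2 * exp 2 * C1 * (y powr (- a) / (- ln y))) + ennreal B2"
      by (simp add: add_right_mono)
    \<comment> \<open>A constant is dominated by the singular majorant, since \<open>y\<^sup>a |ln y| \<le> 1/a\<close>.\<close>
    have B2': "B2 \<le> B2 / a * (y powr (- a) / (- ln y))"
    proof -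
      have "ln (1 / y) \<le> (1 / y) powr a / a" using y a by (intro ln_powr_bound) auto
      then have "a * (- ln y) \<le> y powr (- a)"
        using y a by (simp add: ln_div powr_divide powr_minus_divide field_simps)
      then have "a * (- ln y) / (a * (- ln y)) \<le> y powr (- a) / (a * (- ln y))"
        using a ly by (intro divide_right_mono mult_nonneg_nonneg) auto
      moreover have "a * (- ln y) \<noteq> 0" using a ly by auto
      ultimately have "1 \<le> 1 / a * (y powr (- a) / (- ln y))" by simp
      from mult_left_mono[OF this B2(2)] show ?thesis by simp
    qed
    have nn: "0 \<le> y powr (- a) / (- ln y)" using ly by (intro divide_nonneg_pos) auto
    have "ennreal (2 * exp 2 * C1 * (y powr (- a) / (- ln y))) + ennreal B2 = ennreal (2 * exp 2 * C1 * (y powr (- a) / (- ln y)) + B2)"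
      using C1(1) nn B2(2) by (intro ennreal_plus[symmetric] mult_nonneg_nonneg) auto
    also have "\<dots> \<le> ennreal (C * (y powr (- a) / (- ln y)))"
    proof (rule ennreal_leI)
      have "2 * exp 2 * C1 * (y powr (- a) / (- ln y)) + B2
        \<le> 2 * exp 2 * C1 * (y powr (- a) / (- ln y)) + B2 / a * (y powr (- a) / (- ln y)) + (B3 + B4) * (y powr (- a) / (- ln y))"
        using B2' nn B3(2) B4(2) mult_nonneg_nonneg[of "B3 + B4", OF _ nn] by linarith
      then show "2 * exp 2 * C1 * (y powr (- a) / (- ln y)) + B2 \<le> C * (y powr (- a) / (- ln y))"
        unfolding C_def distrib_right by linarith
    qed
    finally show ?thesis using 1 by (rule order_trans[rotated])
  qed
  have far: "(\<integral>\<^sup>+r. ennreal (?g y r) \<partial>nu s lam) \<le> ennreal (C * y powr (- real N))" if y: "0 < y" for y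
  proof -
    have "(\<integral>\<^sup>+r. ennreal (?g y r) \<partial>nu s lam)
      \<le> (\<integral>\<^sup>+r. ennreal (y powr (- real N)) * (1 + indicator {1/2..} r * ennreal (r powr (real N - b))) \<partial>nu s lam)"
    proof (rule nn_integral_mono_AE, use AE_nu_pos in eventually_elim)
      case (elim r)
      have "(y / r) powr real N = (y / r) ^ N" using elim y by (intro powr_realpow) auto
      also have "\<dots> \<le> (1 + y / r) ^ N" using elim y by (intro power_mono) auto
      finally have "?g y r \<le> r powr (- b) / (y / r) powr real N"
        using elim y by (intro divide_left_mono mult_pos_pos) (auto simp: add_pos_pos)
      also have "\<dots> = y powr (- real N) * (r powr real N * r powr (- b))"
        using elim y by (simp add: powr_divide powr_minus_divide)
      also have "r powr real N * r powr (- b) = r powr (real N - b)" by (simp flip: powr_add)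
      finally have *: "?g y r \<le> y powr (- real N) * r powr (real N - b)" .
      have "ennreal (?g y r) \<le> ennreal (y powr (- real N)) * ennreal (r powr (real N - b))"
        using * by (subst ennreal_mult[symmetric]) (auto intro!: ennreal_leI)
      also have "ennreal (r powr (real N - b)) \<le> 1 + indicator {1/2..} r * ennreal (r powr (real N - b))"
      proof (cases "r < 1 / 2")
        case True
        then have "r powr (real N - b) \<le> 1" using elim N by (intro powr_le1) auto
        then show ?thesis using True by (simp add: ennreal_le_1)
      qed (simp add: add_increasing)
      finally show ?case by (simp add: mult_left_mono)
    qed
    also have "\<dots> = ennreal (y powr (- real N)) * (ennreal B4 + ennreal B3)"
      by (subst nn_integral_cmult; (subst nn_integral_add)?) (auto simp: B3 B4)
    also have "\<dots> = ennreal ((B4 + B3) * y powr (- real N))"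
      using B3(2) B4(2) by (simp add: ennreal_mult mult.commute flip: ennreal_plus)
    also have "\<dots> \<le> ennreal (C * y powr (- real N))"
      using C1 B2 a by (intro ennreal_leI mult_right_mono) (auto simp: C_def)
    finally show ?thesis .
  qed
  show ?thesis
  proof (intro exI[of _ C] conjI allI impI C)
    fix x :: "real ^ 'n" assume x: "x \<noteq> 0"
    have sq: "(norm x)\<^sup>2 = norm x powr 2" using x by simp
    show "(\<integral>\<^sup>+r. ennreal (?g ((norm x)\<^sup>2) r) \<partial>nu s lam) \<le> ennreal (C * kmaj a N x)"
    proof (cases "norm x \<le> 1 / 2")
      case True
      have "(norm x)\<^sup>2 \<le> (1/2)\<^sup>2" using True by (intro power_mono) auto
      then have "(\<integral>\<^sup>+r. ennreal (?g ((norm x)\<^sup>2) r) \<partial>nu s lam) \<le> ennreal (C * (((norm x)\<^sup>2) powr (- a) / (- ln ((norm x)\<^sup>2))))"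
        using x by (intro near) (auto simp: power2_eq_square)
      also have "\<dots> \<le> ennreal (C * kmaj a N x)"
      proof (intro ennreal_leI mult_left_mono C)
        have l: "0 < - ln (norm x)" using True x by simp
        have "((norm x)\<^sup>2) powr (- a) / (- ln ((norm x)\<^sup>2)) = norm x powr (- (2 * a)) / (2 * (- ln (norm x)))"
          unfolding sq using x by (simp only: powr_powr ln_powr) simp
        also have "\<dots> \<le> norm x powr (- (2 * a)) / (- ln (norm x))"
          using l by (intro divide_left_mono mult_pos_pos) auto
        finally show "((norm x)\<^sup>2) powr (- a) / (- ln ((norm x)\<^sup>2)) \<le> kmaj a N x" using True by (simp add: kmaj_def)
      qed
      finally show ?thesis .
    next
      case False
      have "(\<integral>\<^sup>+r. ennreal (?g ((norm x)\<^sup>2) r) \<partial>nu s lam) \<le> ennreal (C * ((norm x)\<^sup>2) powr (- real N))"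
        using x by (intro far) auto
      also have "((norm x)\<^sup>2) powr (- real N) = norm x powr (- (2 * real N))" unfolding sq powr_powr by simp
      finally show ?thesis using False by (simp add: kmaj_def)
    qed
  qed
qed

section \<open>Derivatives of the heat kernel\<close>

text \<open>
  The derivative along \<open>l\<close> of the heat kernel at time \<open>r\<close>, written by scaling in terms of time \<open>1\<close>.
  It is put to \<open>0\<close> for \<open>r \<le> 0\<close>, outside the support of \<open>\<nu>\<close>, so that the derivative rule holds for all
  \<open>r\<close>.
\<close>

definition Ker :: "'n list \<Rightarrow> real \<Rightarrow> real ^ 'n::finite \<Rightarrow> complex"
  where "Ker l r x = (if 0 < r then of_real (r powr (- ((real CARD('n) + real (length l)) / 2)))
    * fold partial_deriv l (heat 1) ((1 / sqrt r) *\<^sub>R x) else 0)"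

lemma Ker_Nil: "r > 0 \<Longrightarrow> Ker [] r = heat r"
  by (simp add: fun_eq_iff Ker_def heat_scale[of r])

lemma Ker_rapid: "rapid (fold partial_deriv l (heat 1))"
  by (intro all_derivs_fold heat_rapid)

lemma Ker_continuous: "continuous_on UNIV (Ker l r)"
proof -
  have "continuous_on UNIV (fold partial_deriv l (heat 1 :: real ^ 'a \<Rightarrow> complex))"
    by (rule all_derivs_base[OF rapid_smooth[OF Ker_rapid]])
  then have "continuous_on UNIV (\<lambda>x. fold partial_deriv l (heat 1 :: real ^ 'a \<Rightarrow> complex) ((1 / sqrt r) *\<^sub>R x))"
    by (rule continuous_on_compose2[where t = UNIV]) (intro continuous_on_scaleR continuous_on_const continuous_on_id, simp)
  then show ?thesis unfolding Ker_def[abs_def]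
    by (cases "0 < r") (simp_all add: continuous_on_mult_left)
qed

lemma measurable_Ker [measurable (raw)]:
  fixes f :: "'w \<Rightarrow> real" and g :: "'w \<Rightarrow> real ^ 'n::finite"
  assumes [measurable]: "f \<in> borel_measurable M" "g \<in> borel_measurable M"
  shows "(\<lambda>w. Ker l (f w) (g w)) \<in> borel_measurable M"
proof -
  have [measurable]: "fold partial_deriv l (heat 1 :: real ^ 'n \<Rightarrow> complex) \<in> borel_measurable borel"
    by (rule decay_measurable[OF all_derivs_base[OF Ker_rapid]])
  show ?thesis unfolding Ker_def by measurable
qed

lemma Ker_has_vector_derivative:
  fixes x :: "real ^ 'n::finite"
  shows "((\<lambda>t. Ker l r (x + t *\<^sub>R axis i 1)) has_vector_derivative Ker (l @ [i]) r (x + t *\<^sub>R axis i 1)) (at t)"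
proof (cases "0 < r")
  case r: True
  let ?D = "fold partial_deriv l (heat 1 :: real ^ 'n \<Rightarrow> complex)"
  let ?c = "1 / sqrt r"
  let ?E = "of_real (r powr (- ((real CARD('n) + real (length l)) / 2))) :: complex"
  have 1: "((\<lambda>\<tau>. ?D (?c *\<^sub>R x + \<tau> *\<^sub>R axis i 1)) has_vector_derivative
      partial_deriv i ?D (?c *\<^sub>R x + (?c * t) *\<^sub>R axis i 1)) (at (?c * t))"
    by (rule axis_diff_has_vector_derivative[OF all_derivs_axis_diff[OF Ker_rapid]])
  have 2: "((\<lambda>t. ?c * t) has_vector_derivative ?c) (at t)"
    by (auto intro!: derivative_eq_intros)
  have "((\<lambda>t. ?D (?c *\<^sub>R x + (?c * t) *\<^sub>R axis i 1)) has_vector_derivative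
      ?c *\<^sub>R partial_deriv i ?D (?c *\<^sub>R x + (?c * t) *\<^sub>R axis i 1)) (at t)"
    using vector_diff_chain_at[OF 2 1] by (simp add: o_def)
  from has_vector_derivative_mult_right[OF this, of ?E]
  have "((\<lambda>t. ?E * ?D (?c *\<^sub>R (x + t *\<^sub>R axis i 1))) has_vector_derivative
      ?E * (?c *\<^sub>R partial_deriv i ?D (?c *\<^sub>R (x + t *\<^sub>R axis i 1)))) (at t)"
    by (simp add: scaleR_add_right)
  moreover have "?E * (?c *\<^sub>R partial_deriv i ?D (?c *\<^sub>R (x + t *\<^sub>R axis i 1))) = Ker (l @ [i]) r (x + t *\<^sub>R axis i 1)"
  proof -
    have e: "- ((real CARD('n) + real (length (l @ [i]))) / 2) = - ((real CARD('n) + real (length l)) / 2) + (- (1/2))"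
      by (simp add: field_simps)
    have "r powr (- ((real CARD('n) + real (length (l @ [i]))) / 2)) = r powr (- ((real CARD('n) + real (length l)) / 2)) * ?c"
      unfolding e powr_add using r by (simp add: powr_minus_divide powr_half_sqrt)
    then show ?thesis unfolding Ker_def using r by (simp only: if_True of_real_mult fold_append o_apply fold_simps scaleR_conv_of_real mult.assoc)
  qed
  ultimately show ?thesis using r by (simp only: Ker_def if_True)
qed (simp add: Ker_def)

text \<open>
  Go from \<open>x\<close> to \<open>x + h\<close> along one coordinate at a time. Every point \<open>x + v\<close> on the way satisfies
  \<open>|v| \<le> |h|\<close>, and each leg is estimated by the mean value theorem.
\<close>

lemma norm_diff_le_axis:
  fixes f :: "real ^ 'n::finite \<Rightarrow> complex"
  assumes ax: "axis_diff f" and B: "\<And>i v. norm v \<le> norm h \<Longrightarrow> norm (partial_deriv i f (x + v)) \<le> B"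
  shows "norm (f (x + h) - f x) \<le> real CARD('n) * B * norm h"
proof -
  \<comment> \<open>The displacement after the coordinates in \<open>A\<close> have been dealt with.\<close>
  define P where "P A = (\<chi> i. if i \<in> A then h $ i else 0)" for A
  have B0: "0 \<le> B" using order_trans[OF norm_ge_zero B[of 0]] by simp
  have "norm (f (x + P A) - f x) \<le> real (card A) * B * norm h" for A
  proof (induction A rule: infinite_finite_induct)
    case empty
    have "P {} = 0" by (simp add: P_def vec_eq_iff)
    then show ?case by simp
  next
    case (insert j A)
    have P: "P (insert j A) = P A + (h $ j) *\<^sub>R axis j 1"
      using insert.hyps by (auto simp: P_def vec_eq_iff axis_def)
    have "norm (f (x + P A + (h $ j) *\<^sub>R axis j 1) - f (x + P A + 0 *\<^sub>R axis j 1)) \<le> B * norm (h $ j - 0)"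
    proof (rule differentiable_bound[where S = "closed_segment 0 (h $ j)" and
          f = "\<lambda>t. f (x + P A + t *\<^sub>R axis j 1)" and B = B and x = "h $ j" and y = 0 and
          f' = "\<lambda>t u. u *\<^sub>R partial_deriv j f (x + P A + t *\<^sub>R axis j 1)"])
      fix t assume t: "t \<in> closed_segment 0 (h $ j)"
      show "((\<lambda>t. f (x + P A + t *\<^sub>R axis j 1)) has_derivative
          (\<lambda>u. u *\<^sub>R partial_deriv j f (x + P A + t *\<^sub>R axis j 1))) (at t within closed_segment 0 (h $ j))"
        by (rule has_derivative_at_withinI[OF axis_diff_has_vector_derivative[OF ax, of "x + P A" j t,
                unfolded has_vector_derivative_def]])
      have "norm (P A + t *\<^sub>R axis j 1) \<le> norm h"
      proof (rule norm_le_componentwise_cart)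
        fix i
        have "\<bar>t\<bar> \<le> \<bar>h $ j\<bar>" using t by (auto simp: closed_segment_eq_real_ivl split: if_splits)
        then show "norm ((P A + t *\<^sub>R axis j 1) $ i) \<le> norm (h $ i)"
          using insert.hyps by (auto simp: P_def axis_def)
      qed
      from B[OF this, of j] have le: "norm (partial_deriv j f (x + P A + t *\<^sub>R axis j 1)) \<le> B"
        unfolding add.assoc .
      show "onorm (\<lambda>u. u *\<^sub>R partial_deriv j f (x + P A + t *\<^sub>R axis j 1)) \<le> B"
      proof (rule onorm_le)
        fix u :: real
        show "norm (u *\<^sub>R partial_deriv j f (x + P A + t *\<^sub>R axis j 1)) \<le> B * norm u"
          using mult_right_mono[OF le, of "\<bar>u\<bar>"] by (simp add: mult.commute)
      qed
    qed auto
    also have "\<dots> \<le> B * norm h" using component_le_norm_cart[of h j] B0 by (intro mult_left_mono) auto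
    finally have "norm (f (x + P (insert j A)) - f (x + P A)) \<le> B * norm h" by (simp add: P add.assoc)
    then have "norm (f (x + P (insert j A)) - f x) \<le> B * norm h + real (card A) * B * norm h"
      using insert.IH norm_triangle_ineq[of "f (x + P (insert j A)) - f (x + P A)" "f (x + P A) - f x"] by simp
    then show ?case using insert.hyps by (simp add: algebra_simps)
  qed auto
  moreover have "P UNIV = h" by (simp add: P_def vec_eq_iff)
  ultimately show ?thesis by metis
qed

lemma Ker_bound:
  "\<exists>C\<ge>0. \<forall>r>0. \<forall>x :: real ^ 'n::finite. norm (Ker l r x)
    \<le> C * (r powr (- ((real CARD('n) + real (length l)) / 2)) / (1 + (norm x)\<^sup>2 / r) ^ N)"
proof -
  obtain C where C: "C \<ge> 0" "\<And>z. norm (fold partial_deriv l (heat 1 :: real ^ 'n \<Rightarrow> complex) z) \<le> C / (1 + (norm z)\<^sup>2) ^ N"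
    using decay_bound[OF all_derivs_base[OF Ker_rapid]] by metis
  show ?thesis
  proof (intro exI[of _ C] conjI allI impI C(1))
    fix r :: real and x :: "real ^ 'n"
    assume r: "r > 0"
    show "norm (Ker l r x) \<le> C * (r powr (- ((real CARD('n) + real (length l)) / 2)) / (1 + (norm x)\<^sup>2 / r) ^ N)"
      using mult_left_mono[OF C(2)[of "(1 / sqrt r) *\<^sub>R x"], of "r powr (- ((real CARD('n) + real (length l)) / 2))"] r
      by (simp add: Ker_def norm_mult power_divide mult_ac)
  qed
qed

text \<open>
  For \<open>2|h| \<le> |x|\<close> the way from \<open>x\<close> to \<open>x + h\<close> stays at distance at least \<open>|x|/2\<close> from the origin,
  where the profile is comparable to its value at \<open>x\<close>. The additional derivative costs \<open>r\<^bsup>-1/2\<^esup>\<close>.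
\<close>

lemma Ker_diff_bound:
  "\<exists>C\<ge>0. \<forall>r>0. \<forall>(x :: real ^ 'n::finite) h. 2 * norm h \<le> norm x \<longrightarrow> norm (Ker l r (x + h) - Ker l r x)
    \<le> C * norm h * (r powr (- ((real CARD('n) + real (length l) + 1) / 2)) / (1 + (norm x)\<^sup>2 / r) ^ N)"
proof -
  let ?D = "fold partial_deriv l (heat 1 :: real ^ 'n \<Rightarrow> complex)"
  have "\<exists>C\<ge>0. \<forall>z. norm (partial_deriv i ?D z) \<le> C / (1 + (norm z)\<^sup>2) ^ N" for i
    by (rule decay_bound[OF all_derivs_base[OF all_derivs_partial[OF Ker_rapid]]])
  then obtain c where c: "\<And>i. c i \<ge> 0" "\<And>i z. norm (partial_deriv i ?D z) \<le> c i / (1 + (norm z)\<^sup>2) ^ N" by metis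
  define C where "C = (\<Sum>i\<in>UNIV. c i)"
  have C0: "C \<ge> 0" unfolding C_def by (intro sum_nonneg c)
  have cC: "c i \<le> C" for i unfolding C_def by (rule member_le_sum) (use c in auto)
  have one: "0 < (1 + (norm z)\<^sup>2) ^ N" for z :: "real ^ 'n" by (intro zero_less_power add_pos_nonneg) auto
  have D: "norm (?D (z + \<eta>) - ?D z) \<le> (real CARD('n) * 4 ^ N * C) * norm \<eta> / (1 + (norm z)\<^sup>2) ^ N"
    if zh: "2 * norm \<eta> \<le> norm z" for z \<eta>
  proof -
    have "norm (partial_deriv i ?D (z + v)) \<le> 4 ^ N * C / (1 + (norm z)\<^sup>2) ^ N" if v: "norm v \<le> norm \<eta>" for i v
    proof -
      have "norm z \<le> norm (z + v) + norm v" using norm_triangle_ineq[of "z + v" "- v"] by simp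
      then have "norm z \<le> 2 * norm (z + v)" using v zh by linarith
      then have "(norm z)\<^sup>2 \<le> (2 * norm (z + v))\<^sup>2" by (intro power_mono) auto
      then have "(1 + (norm z)\<^sup>2) ^ N \<le> (4 * (1 + (norm (z + v))\<^sup>2)) ^ N"
        by (intro power_mono) (auto simp: power_mult_distrib)
      also have "\<dots> = 4 ^ N * (1 + (norm (z + v))\<^sup>2) ^ N" by (rule power_mult_distrib)
      finally have le: "(1 + (norm z)\<^sup>2) ^ N \<le> 4 ^ N * (1 + (norm (z + v))\<^sup>2) ^ N" .
      have "norm (partial_deriv i ?D (z + v)) \<le> c i / (1 + (norm (z + v))\<^sup>2) ^ N" by (rule c)
      also have "\<dots> \<le> C / (1 + (norm (z + v))\<^sup>2) ^ N" using cC one by (intro divide_right_mono) (auto simp: less_imp_le)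
      also have "\<dots> = 4 ^ N * C / (4 ^ N * (1 + (norm (z + v))\<^sup>2) ^ N)" by simp
      also have "\<dots> \<le> 4 ^ N * C / (1 + (norm z)\<^sup>2) ^ N"
        using le C0 one by (intro divide_left_mono mult_pos_pos mult_nonneg_nonneg) auto
      finally show ?thesis .
    qed
    from norm_diff_le_axis[OF all_derivs_axis_diff[OF Ker_rapid] this] show ?thesis by (simp add: mult_ac)
  qed
  show ?thesis
  proof (intro exI[of _ "real CARD('n) * 4 ^ N * C"] conjI allI impI)
    show "0 \<le> real CARD('n) * 4 ^ N * C" using C0 by simp
    fix r :: real and x h :: "real ^ 'n"
    assume r: "r > 0" and xh: "2 * norm h \<le> norm x"
    let ?e = "r powr (- ((real CARD('n) + real (length l)) / 2))"
    have e: "- ((real CARD('n) + real (length l) + 1) / 2) = - ((real CARD('n) + real (length l)) / 2) + (- (1/2))"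
      by (simp add: field_simps)
    have e': "r powr (- ((real CARD('n) + real (length l) + 1) / 2)) = ?e * (1 / sqrt r)"
      unfolding e powr_add using r by (simp add: powr_minus_divide powr_half_sqrt)
    have "norm (Ker l r (x + h) - Ker l r x)
       = ?e * norm (?D ((1 / sqrt r) *\<^sub>R x + (1 / sqrt r) *\<^sub>R h) - ?D ((1 / sqrt r) *\<^sub>R x))"
      using r by (simp add: Ker_def scaleR_add_right norm_mult flip: right_diff_distrib)
    also have "\<dots> \<le> ?e * ((real CARD('n) * 4 ^ N * C) * norm ((1 / sqrt r) *\<^sub>R h) / (1 + (norm ((1 / sqrt r) *\<^sub>R x))\<^sup>2) ^ N)"
      using r xh by (intro mult_left_mono D) (auto simp: field_simps)
    also have "\<dots> = (real CARD('n) * 4 ^ N * C) * norm h * (r powr (- ((real CARD('n) + real (length l) + 1) / 2)) / (1 + (norm x)\<^sup>2 / r) ^ N)"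
      unfolding e' using r by (simp add: power_divide mult_ac)
    finally show "norm (Ker l r (x + h) - Ker l r x)
      \<le> real CARD('n) * 4 ^ N * C * norm h * (r powr (- ((real CARD('n) + real (length l) + 1) / 2)) / (1 + (norm x)\<^sup>2 / r) ^ N)" .
  qed
qed

section \<open>Kernel estimates at the critical exponent\<close>

lemma nn_integral_tail:
  fixes f :: "real ^ 'n::finite \<Rightarrow> ennreal"
  assumes [measurable]: "f \<in> borel_measurable borel" and fin: "(\<integral>\<^sup>+x. f x \<partial>lborel) < \<infinity>" and \<epsilon>: "\<epsilon> > 0"
  shows "\<exists>R>0. (\<integral>\<^sup>+x. indicator {R..} (norm x) * f x \<partial>lborel) \<le> ennreal \<epsilon>"
proof -
  have "(\<lambda>k. \<integral>\<^sup>+x. indicator {real k..} (norm x) * f x \<partial>lborel) \<longlonglongrightarrow> (\<integral>\<^sup>+x. 0 \<partial>(lborel :: (real ^ 'n) measure))"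
  proof (rule nn_integral_dominated_convergence[where w = f])
    show "AE x in lborel. indicator {real k..} (norm x) * f x \<le> f x" for k
      by (auto simp: indicator_def)
    show "AE x in lborel. (\<lambda>k. indicator {real k..} (norm x) * f x) \<longlonglongrightarrow> 0"
    proof (rule AE_I2)
      fix x :: "real ^ 'n"
      obtain k0 :: nat where k0: "norm x < real k0" using reals_Archimedean2 by blast
      have "eventually (\<lambda>k. indicator {real k..} (norm x) * f x = 0) sequentially"
        using eventually_ge_at_top[of k0] by eventually_elim (use k0 in \<open>auto simp: indicator_def\<close>)
      then show "(\<lambda>k. indicator {real k..} (norm x) * f x) \<longlonglongrightarrow> 0" by (rule tendsto_eventually)
    qed
  qed (use fin in auto)
  then have "eventually (\<lambda>k. (\<integral>\<^sup>+x. indicator {real k..} (norm x) * f x \<partial>lborel) < ennreal \<epsilon>) sequentially"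
    using \<epsilon> by (intro order_tendstoD(2)) auto
  then have "eventually (\<lambda>k. (\<integral>\<^sup>+x. indicator {real k..} (norm x) * f x \<partial>lborel) < ennreal \<epsilon> \<and> 0 < k) sequentially"
    by (intro eventually_conj eventually_gt_at_top)
  then obtain k :: nat where "(\<integral>\<^sup>+x. indicator {real k..} (norm x) * f x \<partial>lborel) < ennreal \<epsilon>" "0 < k"
    by (auto simp: eventually_sequentially)
  then show ?thesis by (intro exI[of _ "real k"]) auto
qed

text \<open>
  The hypotheses of the embedding, with the conjugate exponent \<open>q\<close> of \<open>p\<close> as a parameter.
\<close>

locale critical_exponent =
  fixes s lam p q :: real and m :: nat and ty :: "'n::finite itself"
  assumes s: "s > 0" and lam: "lam > 1" and p: "p > 1" and q: "q > 1" and pq: "1 / q + 1 / p = 1"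
    and s_eq: "s = 1 / 2 * (real CARD('n) / p + real m)"
begin

text \<open>
  The function \<open>|x|\<^bsup>-2a\<^esup>\<close> is at the borderline of \<open>q\<close>-integrability in dimension \<open>n\<close> for \<open>a = n/(2q)\<close>.
  The exponent \<open>cN\<close> is large enough for the decay of the kernel and of its first difference.
\<close>

definition ca :: real where "ca = real CARD('n) / (2 * q)"
definition cN :: nat where "cN = CARD('n) + m + 2"

lemma ca_pos: "ca > 0" using q by (simp add: ca_def)

lemma ca_le: "ca \<le> real CARD('n) / 2"
  unfolding ca_def using q by (intro divide_left_mono) auto

text \<open>
  The critical relation between \<open>s\<close>, \<open>p\<close> and \<open>m\<close>: the scale integral for derivatives of order \<open>m\<close> is
  \<open>\<integral> r\<^bsup>s-1-(n+m)/2\<^esup> \<dots> dr = \<integral> r\<^bsup>-a-1\<^esup> \<dots> dr\<close> exactly at the borderline exponent.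
\<close>

lemma ca_s: "ca + s = (real CARD('n) + real m) / 2"
proof -
  have "ca + s = real CARD('n) / 2 * (1 / q + 1 / p) + real m / 2"
    using p q by (simp add: ca_def s_eq field_simps)
  then show ?thesis unfolding pq by simp
qed

abbreviation \<nu> where "\<nu> \<equiv> nu s lam"

lemma nu_sigma_finite: "sigma_finite_measure \<nu>"
  using finite_measure_nu[OF s lam] by (simp add: finite_measure_def)

lemma powr_int_1q: "A \<ge> 0 \<Longrightarrow> L > 0 \<Longrightarrow> (A * L powr (1 - q)) powr (1 / q) = A powr (1 / q) * L powr (- (1 / p))"
proof -
  assume "A \<ge> 0" "L > 0"
  moreover have "(1 - q) / q = - (1 / p)" using pq q by (simp add: field_simps)
  ultimately show ?thesis by (simp add: powr_mult powr_powr)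
qed

lemma kmaj_powr_near: "norm x \<le> 1 / 2 \<Longrightarrow> x \<noteq> 0 \<Longrightarrow>
  kmaj a N x powr q = norm x powr (- (2 * a * q)) * (- ln (norm x)) powr (- q)"
proof -
  assume x: "norm x \<le> 1 / 2" "x \<noteq> 0"
  have "(A / L) powr q = A powr q * L powr (- q)" if "L > 0" "A \<ge> 0" for A L :: real
    using that by (simp add: powr_divide powr_minus_divide)
  moreover have "0 < - ln (norm x)" using x by simp
  moreover have "kmaj a N x = norm x powr (- (2 * a)) / (- ln (norm x))"
    unfolding kmaj_def using x(1) by (simp only: if_True)
  ultimately have "kmaj a N x powr q = (norm x powr (- (2 * a))) powr q * (- ln (norm x)) powr (- q)"
    by (simp only: powr_ge_zero)
  then show ?thesis by (simp add: powr_powr)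
qed

lemma kmaj_outer: "\<exists>A\<ge>0. shell_integral {1/2<..} (\<lambda>x :: real ^ 'n. kmaj a cN x powr q) \<le> ennreal A"
proof -
  define b where "b = 2 * real cN * q - real CARD('n)"
  have "real CARD('n) < 2 * real cN * 1" by (simp add: cN_def)
  also have "\<dots> \<le> 2 * real cN * q" using q by (intro mult_left_mono) auto
  finally have b: "b > 0" by (simp add: b_def)
  obtain C where C: "C \<ge> 0" "\<And>\<delta>. \<delta> > 0 \<Longrightarrow> shell_integral {\<delta>..} (\<lambda>x :: real ^ 'n. norm x powr (- real CARD('n) - b))
     \<le> ennreal (C * \<delta> powr (- b))"
    using radial_power_far[OF b, where 'n = 'n] by blast
  have "shell_integral {1/2<..} (\<lambda>x :: real ^ 'n. kmaj a cN x powr q)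
     \<le> shell_integral {1/2..} (\<lambda>x :: real ^ 'n. norm x powr (- real CARD('n) - b))"
    by (intro nn_integral_mono) (auto simp: indicator_def kmaj_def powr_powr b_def)
  also have "\<dots> \<le> ennreal (C * (1/2) powr (- b))" by (rule C(2)) simp
  finally show ?thesis using C(1) by (intro exI[of _ "C * (1/2) powr (- b)"]) auto
qed

text \<open>
  Here \<open>2aq = n\<close>, and only the logarithm makes the \<open>q\<close>-th power \<open>|x|\<^bsup>-n\<^esup> |ln |x||\<^bsup>-q\<^esup>\<close> integrable.
\<close>

lemma kmaj_near:
  "\<exists>C\<ge>0. \<forall>\<delta>. 0 < \<delta> \<and> \<delta> \<le> 1 / 2 \<longrightarrow>
    shell_integral {0<..\<delta>} (\<lambda>x :: real ^ 'n. kmaj ca cN x powr q)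
     \<le> ennreal (C * (- ln \<delta>) powr (1 - q))"
proof -
  obtain C where C: "C \<ge> 0" "\<And>\<delta>. 0 < \<delta> \<Longrightarrow> \<delta> < 1 \<Longrightarrow>
    shell_integral {0<..\<delta>} (\<lambda>x :: real ^ 'n. norm x powr (- real CARD('n)) * (- ln (norm x)) powr (- q))
     \<le> ennreal (C * (- ln \<delta>) powr (1 - q))"
    using radial_log_near[OF q, where 'n = 'n] by blast
  have e: "2 * ca * q = real CARD('n)" using q by (simp add: ca_def)
  show ?thesis
  proof (intro exI[of _ C] conjI allI impI C(1))
    fix \<delta> :: real assume \<delta>: "0 < \<delta> \<and> \<delta> \<le> 1 / 2"
    have "shell_integral {0<..\<delta>} (\<lambda>x :: real ^ 'n. kmaj ca cN x powr q)
      = shell_integral {0<..\<delta>} (\<lambda>x :: real ^ 'n. norm x powr (- real CARD('n)) * (- ln (norm x)) powr (- q))"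
      using \<delta> by (intro nn_integral_cong) (auto simp: indicator_def kmaj_powr_near e)
    also have "\<dots> \<le> ennreal (C * (- ln \<delta>) powr (1 - q))" using \<delta> by (intro C(2)) auto
    finally show "shell_integral {0<..\<delta>} (\<lambda>x :: real ^ 'n. kmaj ca cN x powr q)
      \<le> ennreal (C * (- ln \<delta>) powr (1 - q))" .
  qed
qed

text \<open>
  One more derivative raises the order of the singularity by \<open>1\<close>, which corresponds to \<open>a + 1/2\<close>. The
  \<open>q\<close>-th power is no longer integrable at the origin but grows only like \<open>\<delta>\<^bsup>-q\<^esup> |ln \<delta>|\<^bsup>-q\<^esup>\<close> outside the
  ball of radius \<open>\<delta>\<close>.
\<close>

lemma kmaj_far:
  "\<exists>C\<ge>0. \<forall>\<delta>. 0 < \<delta> \<and> \<delta> \<le> 1 / 2 \<longrightarrow>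
    shell_integral {\<delta>..} (\<lambda>x :: real ^ 'n. kmaj (ca + 1/2) cN x powr q)
     \<le> ennreal (C * \<delta> powr (- q) * (- ln \<delta>) powr (- q) + C)"
proof -
  obtain C where C: "C \<ge> 0" "\<And>\<delta>. 0 < \<delta> \<Longrightarrow> \<delta> \<le> 1 / 2 \<Longrightarrow>
    shell_integral {\<delta>..1/2} (\<lambda>x :: real ^ 'n. norm x powr (- real CARD('n) - q) * (- ln (norm x)) powr (- q))
     \<le> ennreal (C * \<delta> powr (- q) * (- ln \<delta>) powr (- q))"
    using radial_log_far[OF q, where 'n = 'n] by blast
  obtain A where A: "A \<ge> 0" "shell_integral {1/2<..} (\<lambda>x :: real ^ 'n. kmaj (ca + 1/2) cN x powr q) \<le> ennreal A"
    using kmaj_outer by blast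
  have e: "2 * (ca + 1/2) * q = real CARD('n) + q" using q by (simp add: ca_def field_simps)
  show ?thesis
  proof (intro exI[of _ "C + A"] conjI allI impI)
    show "0 \<le> C + A" using C A by simp
    fix \<delta> :: real assume \<delta>: "0 < \<delta> \<and> \<delta> \<le> 1 / 2"
    have "shell_integral {\<delta>..} (\<lambda>x :: real ^ 'n. kmaj (ca + 1/2) cN x powr q)
      \<le> (\<integral>\<^sup>+x. indicator {\<delta>..1/2} (norm (x :: real ^ 'n)) * ennreal (norm x powr (- real CARD('n) - q) * (- ln (norm x)) powr (- q))
          + indicator {1/2<..} (norm x) * ennreal (kmaj (ca + 1/2) cN x powr q) \<partial>lborel)"
    proof (rule nn_integral_mono)
      fix x :: "real ^ 'n"
      have "kmaj (ca + 1/2) cN x powr q = norm x powr (- real CARD('n) - q) * (- ln (norm x)) powr (- q)"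
        if "\<delta> \<le> norm x" "norm x \<le> 1 / 2"
      proof -
        have "x \<noteq> 0" using that \<delta> by auto
        from kmaj_powr_near[OF that(2) this, of "ca + 1/2" cN] show ?thesis unfolding e by simp
      qed
      then show "indicator {\<delta>..} (norm x) * ennreal (kmaj (ca + 1/2) cN x powr q)
        \<le> indicator {\<delta>..1/2} (norm x) * ennreal (norm x powr (- real CARD('n) - q) * (- ln (norm x)) powr (- q))
          + indicator {1/2<..} (norm x) * ennreal (kmaj (ca + 1/2) cN x powr q)"
        by (cases "norm x \<le> 1 / 2") (auto simp: indicator_def)
    qed
    also have "\<dots> = shell_integral {\<delta>..1/2} (\<lambda>x :: real ^ 'n. norm x powr (- real CARD('n) - q) * (- ln (norm x)) powr (- q))
       + shell_integral {1/2<..} (\<lambda>x :: real ^ 'n. kmaj (ca + 1/2) cN x powr q)"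
      by (rule nn_integral_add) measurable
    also have "\<dots> \<le> ennreal (C * \<delta> powr (- q) * (- ln \<delta>) powr (- q)) + ennreal A"
      using \<delta> by (intro add_mono C A) auto
    also have "\<dots> = ennreal (C * \<delta> powr (- q) * (- ln \<delta>) powr (- q) + A)"
      using C A by (intro ennreal_plus[symmetric] mult_nonneg_nonneg) auto
    also have "\<dots> \<le> ennreal ((C + A) * \<delta> powr (- q) * (- ln \<delta>) powr (- q) + (C + A))"
      using C A by (intro ennreal_leI add_mono mult_right_mono) auto
    finally show "shell_integral {\<delta>..} (\<lambda>x :: real ^ 'n. kmaj (ca + 1/2) cN x powr q)
      \<le> ennreal ((C + A) * \<delta> powr (- q) * (- ln \<delta>) powr (- q) + (C + A))" .
  qed
qed

lemma AE_neq: "AE x in (lborel :: (real ^ 'n) measure). x \<noteq> c"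
  by (rule AE_lborel_singleton)

lemma kmaj_total: "\<exists>A\<ge>0. (\<integral>\<^sup>+x. ennreal (kmaj ca cN (x :: real ^ 'n) powr q) \<partial>lborel) \<le> ennreal A"
proof -
  obtain C where "C \<ge> 0" and near: "\<And>\<delta>. 0 < \<delta> \<and> \<delta> \<le> 1 / 2 \<Longrightarrow>
     shell_integral {0<..\<delta>} (\<lambda>x :: real ^ 'n. kmaj ca cN x powr q)
     \<le> ennreal (C * (- ln \<delta>) powr (1 - q))"
    using kmaj_near by blast
  note C = \<open>C \<ge> 0\<close> near[of "1/2", simplified]
  obtain A where A: "A \<ge> 0" "shell_integral {1/2<..} (\<lambda>x :: real ^ 'n. kmaj ca cN x powr q) \<le> ennreal A"
    using kmaj_outer by blast
  have "(\<integral>\<^sup>+x. ennreal (kmaj ca cN (x :: real ^ 'n) powr q) \<partial>lborel)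
    \<le> (\<integral>\<^sup>+x. indicator {0<..1/2} (norm (x :: real ^ 'n)) * ennreal (kmaj ca cN x powr q) + indicator {1/2<..} (norm x) * ennreal (kmaj ca cN x powr q) \<partial>lborel)"
    by (rule nn_integral_mono_AE, use AE_neq[of 0] in eventually_elim) (auto simp: indicator_def)
  also have "\<dots> = shell_integral {0<..1/2} (\<lambda>x :: real ^ 'n. kmaj ca cN x powr q)
     + shell_integral {1/2<..} (\<lambda>x :: real ^ 'n. kmaj ca cN x powr q)"
    by (rule nn_integral_add) measurable
  also have "\<dots> \<le> ennreal (C * (- ln (1/2)) powr (1 - q)) + ennreal A" by (intro add_mono near A) simp
  also have "\<dots> = ennreal (C * (- ln (1/2)) powr (1 - q) + A)" using C A by (intro ennreal_plus[symmetric]) auto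
  finally show ?thesis using C A by (intro exI[of _ "C * (- ln (1/2)) powr (1 - q) + A"]) auto
qed

text \<open>
  Derivatives of order below \<open>m\<close> have a milder power of \<open>r\<close> near \<open>0\<close>, and the majorant for order \<open>m\<close>
  serves for all of them.
\<close>

lemma Ker_majorant:
  assumes l: "length l \<le> m"
  shows "\<exists>C\<ge>0. \<forall>x :: real ^ 'n. x \<noteq> 0 \<longrightarrow> (\<integral>\<^sup>+r. norm (Ker l r x) \<partial>\<nu>) \<le> ennreal (C * kmaj ca cN x)"
proof -
  define b where "b = (real CARD('n) + real (length l)) / 2"
  have b: "b \<le> ca + s" "real cN \<ge> ca + 1" "real cN \<ge> b"
    using l ca_le ca_s by (auto simp: b_def cN_def)
  obtain C1 where C1: "C1 \<ge> 0" "\<And>x :: real ^ 'n. x \<noteq> 0 \<Longrightarrow>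
    (\<integral>\<^sup>+r. ennreal (r powr (- b) / (1 + (norm x)\<^sup>2 / r) ^ cN) \<partial>\<nu>) \<le> ennreal (C1 * kmaj ca cN x)"
    using nu_gauss_majorant[where 'n = 'n, OF s lam ca_pos b] by blast
  obtain C2 where C2: "C2 \<ge> 0" "\<And>r (x :: real ^ 'n). r > 0 \<Longrightarrow> norm (Ker l r x) \<le> C2 * (r powr (- b) / (1 + (norm x)\<^sup>2 / r) ^ cN)"
    using Ker_bound[of l cN] unfolding b_def by blast
  show ?thesis
  proof (intro exI[of _ "C2 * C1"] conjI allI impI)
    show "0 \<le> C2 * C1" using C1 C2 by simp
    fix x :: "real ^ 'n" assume x: "x \<noteq> 0"
    have "(\<integral>\<^sup>+r. norm (Ker l r x) \<partial>\<nu>) \<le> (\<integral>\<^sup>+r. ennreal C2 * ennreal (r powr (- b) / (1 + (norm x)\<^sup>2 / r) ^ cN) \<partial>\<nu>)"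
      by (rule nn_integral_mono_AE, use AE_nu_pos in eventually_elim)
         (use C2 in \<open>auto simp: less_imp_le add_pos_nonneg simp flip: ennreal_mult intro!: ennreal_leI\<close>)
    also have "\<dots> = ennreal C2 * (\<integral>\<^sup>+r. ennreal (r powr (- b) / (1 + (norm x)\<^sup>2 / r) ^ cN) \<partial>\<nu>)"
      by (rule nn_integral_cmult) measurable
    also have "\<dots> \<le> ennreal C2 * ennreal (C1 * kmaj ca cN x)" by (intro mult_left_mono C1 x) auto
    also have "\<dots> = ennreal (C2 * C1 * kmaj ca cN x)"
      using C1(1) C2(1) kmaj_nonneg[of ca cN x] by (simp add: mult.assoc flip: ennreal_mult)
    finally show "(\<integral>\<^sup>+r. norm (Ker l r x) \<partial>\<nu>) \<le> ennreal (C2 * C1 * kmaj ca cN x)" .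
  qed
qed

lemma Ker_diff_majorant:
  assumes l: "length l \<le> m"
  shows "\<exists>C\<ge>0. \<forall>(x :: real ^ 'n) h. x \<noteq> 0 \<longrightarrow> 2 * norm h \<le> norm x \<longrightarrow>
    (\<integral>\<^sup>+r. norm (Ker l r (x + h) - Ker l r x) \<partial>\<nu>) \<le> ennreal (C * (norm h * kmaj (ca + 1/2) cN x))"
proof -
  define b where "b = (real CARD('n) + real (length l) + 1) / 2"
  have b: "b \<le> (ca + 1/2) + s" "real cN \<ge> (ca + 1/2) + 1" "real cN \<ge> b" "ca + 1/2 > 0"
    using l ca_le ca_s ca_pos by (auto simp: b_def cN_def)
  obtain C1 where C1: "C1 \<ge> 0" "\<And>x :: real ^ 'n. x \<noteq> 0 \<Longrightarrow>
    (\<integral>\<^sup>+r. ennreal (r powr (- b) / (1 + (norm x)\<^sup>2 / r) ^ cN) \<partial>\<nu>) \<le> ennreal (C1 * kmaj (ca + 1/2) cN x)"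
    using nu_gauss_majorant[where 'n = 'n, OF s lam b(4) b(1) b(2) b(3)] by blast
  obtain C2 where C2: "C2 \<ge> 0" "\<And>r (x :: real ^ 'n) h. r > 0 \<Longrightarrow> 2 * norm h \<le> norm x \<Longrightarrow>
     norm (Ker l r (x + h) - Ker l r x) \<le> C2 * norm h * (r powr (- b) / (1 + (norm x)\<^sup>2 / r) ^ cN)"
    using Ker_diff_bound[of l cN] unfolding b_def by blast
  show ?thesis
  proof (intro exI[of _ "C2 * C1"] conjI allI impI)
    show "0 \<le> C2 * C1" using C1 C2 by simp
    fix x h :: "real ^ 'n" assume x: "x \<noteq> 0" "2 * norm h \<le> norm x"
    have "(\<integral>\<^sup>+r. norm (Ker l r (x + h) - Ker l r x) \<partial>\<nu>) \<le> (\<integral>\<^sup>+r. ennreal (C2 * norm h) * ennreal (r powr (- b) / (1 + (norm x)\<^sup>2 / r) ^ cN) \<partial>\<nu>)"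
      by (rule nn_integral_mono_AE, use AE_nu_pos in eventually_elim)
         (use C2 x in \<open>auto simp: less_imp_le add_pos_nonneg simp flip: ennreal_mult intro!: ennreal_leI\<close>)
    also have "\<dots> = ennreal (C2 * norm h) * (\<integral>\<^sup>+r. ennreal (r powr (- b) / (1 + (norm x)\<^sup>2 / r) ^ cN) \<partial>\<nu>)"
      by (rule nn_integral_cmult) measurable
    also have "\<dots> \<le> ennreal (C2 * norm h) * ennreal (C1 * kmaj (ca + 1/2) cN x)" by (intro mult_left_mono C1 x) auto
    also have "\<dots> = ennreal (C2 * C1 * (norm h * kmaj (ca + 1/2) cN x))"
      using C1(1) C2(1) kmaj_nonneg[of "ca + 1/2" cN x] by (simp add: mult_ac flip: ennreal_mult)
    finally show "(\<integral>\<^sup>+r. norm (Ker l r (x + h) - Ker l r x) \<partial>\<nu>) \<le> ennreal (C2 * C1 * (norm h * kmaj (ca + 1/2) cN x))" .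
  qed
qed

lemma conv_Holder:
  fixes u :: "real ^ 'n \<Rightarrow> real" and g :: "real ^ 'n \<Rightarrow> complex"
  assumes [measurable]: "u \<in> borel_measurable borel" "g \<in> borel_measurable borel"
    and nn: "\<And>x. 0 \<le> u x"
    and A: "(\<integral>\<^sup>+x. ennreal (u x powr q) \<partial>lborel) \<le> ennreal A" "0 \<le> A"
    and G: "(\<integral>\<^sup>+x. ennreal (norm (g x) powr p) \<partial>lborel) \<le> ennreal G" "0 \<le> G"
  shows "(\<integral>\<^sup>+y. ennreal (u (x - y) * norm (g y)) \<partial>lborel) \<le> ennreal (A powr (1 / q) * G powr (1 / p))"
proof (rule nn_integral_Holder[OF p q pq])
  have "(\<integral>\<^sup>+y. ennreal (u (x - y) powr q) \<partial>lborel) = (\<integral>\<^sup>+y. ennreal (u y powr q) \<partial>lborel)"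
    by (rule lborel_nn_integral_minus[where f = "\<lambda>y. ennreal (u y powr q)"]) measurable
  with A show "(\<integral>\<^sup>+y. ennreal (u (x - y) powr q) \<partial>lborel) \<le> ennreal A" by simp
qed (use nn G A in auto)

lemma AE_sub_neq: "AE y in (lborel :: (real ^ 'n) measure). x - y \<noteq> 0"
  using AE_neq[of x] by eventually_elim auto

lemma kernel_conv_le:
  fixes g :: "real ^ 'n \<Rightarrow> complex" and k :: "real \<Rightarrow> real ^ 'n \<Rightarrow> complex"
  assumes [measurable]: "(\<lambda>z. k (fst z) (snd z)) \<in> borel_measurable (borel \<Otimes>\<^sub>M borel)"
    and AE: "AE y in lborel. (\<integral>\<^sup>+r. norm (k r y) \<partial>\<nu>) \<le> ennreal (u y)"
    and nn: "\<And>y. 0 \<le> u y"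
  shows "(\<integral>\<^sup>+y. \<integral>\<^sup>+r. norm (k r y * g y) \<partial>\<nu> \<partial>lborel) \<le> (\<integral>\<^sup>+y. ennreal (u y * norm (g y)) \<partial>lborel)"
proof (rule nn_integral_mono_AE, use AE in eventually_elim)
  case (elim y)
  have [measurable]: "(\<lambda>r. k r y) \<in> borel_measurable borel"
    using measurable_compose[OF _ assms(1), of "\<lambda>r. (r, y)" borel] by simp
  have "(\<integral>\<^sup>+r. norm (k r y * g y) \<partial>\<nu>) = (\<integral>\<^sup>+r. norm (k r y) \<partial>\<nu>) * norm (g y)"
    by (simp add: norm_mult ennreal_mult nn_integral_multc)
  also have "\<dots> \<le> ennreal (u y) * norm (g y)" using elim by (intro mult_right_mono) auto
  also have "\<dots> = ennreal (u y * norm (g y))" using nn by (simp add: ennreal_mult)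
  finally show ?case .
qed

abbreviation conv_mass :: "'n list \<Rightarrow> (real ^ 'n \<Rightarrow> complex) \<Rightarrow> real ^ 'n \<Rightarrow> ennreal"
  where "conv_mass l g x \<equiv> \<integral>\<^sup>+y. \<integral>\<^sup>+r. norm (Ker l r (x - y) * g y) \<partial>\<nu> \<partial>lborel"

abbreviation diff_mass :: "'n list \<Rightarrow> (real ^ 'n \<Rightarrow> complex) \<Rightarrow> real ^ 'n \<Rightarrow> real ^ 'n \<Rightarrow> ennreal"
  where "diff_mass l g x h
    \<equiv> \<integral>\<^sup>+y. \<integral>\<^sup>+r. norm ((Ker l r (x + h - y) - Ker l r (x - y)) * g y) \<partial>\<nu> \<partial>lborel"

lemma conv_bound:
  assumes l: "length l \<le> m"
  shows "\<exists>C\<ge>0. \<forall>(g :: real ^ 'n \<Rightarrow> complex) G x. g \<in> borel_measurable borel \<longrightarrow> 0 \<le> G \<longrightarrow>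
    (\<integral>\<^sup>+x. ennreal (norm (g x) powr p) \<partial>lborel) \<le> ennreal G \<longrightarrow>
    conv_mass l g x \<le> ennreal (C * G powr (1 / p))"
proof -
  obtain C where C: "C \<ge> 0" "\<And>x :: real ^ 'n. x \<noteq> 0 \<Longrightarrow> (\<integral>\<^sup>+r. norm (Ker l r x) \<partial>\<nu>) \<le> ennreal (C * kmaj ca cN x)"
    using Ker_majorant[OF l] by blast
  obtain A where A: "A \<ge> 0" "(\<integral>\<^sup>+x. ennreal (kmaj ca cN (x :: real ^ 'n) powr q) \<partial>lborel) \<le> ennreal A"
    using kmaj_total by blast
  show ?thesis
  proof (intro exI[of _ "C * A powr (1 / q)"] conjI allI impI)
    show "0 \<le> C * A powr (1 / q)" using C by simp
    fix g :: "real ^ 'n \<Rightarrow> complex" and G x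
    assume [measurable]: "g \<in> borel_measurable borel" and G: "0 \<le> G" "(\<integral>\<^sup>+x. ennreal (norm (g x) powr p) \<partial>lborel) \<le> ennreal G"
    have "conv_mass l g x \<le> (\<integral>\<^sup>+y. ennreal ((C * kmaj ca cN (x - y)) * norm (g y)) \<partial>lborel)"
    proof (rule kernel_conv_le)
      show "AE y in lborel. (\<integral>\<^sup>+r. norm (Ker l r (x - y)) \<partial>\<nu>) \<le> ennreal (C * kmaj ca cN (x - y))"
        using AE_sub_neq[of x] by eventually_elim (rule C(2))
    qed (use mult_nonneg_nonneg[OF C(1) kmaj_nonneg] in auto)
    also have "\<dots> = (\<integral>\<^sup>+y. ennreal C * ennreal (kmaj ca cN (x - y) * norm (g y)) \<partial>lborel)"
      using C(1) kmaj_nonneg[of ca cN] by (simp add: mult.assoc ennreal_mult')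
    also have "\<dots> = ennreal C * (\<integral>\<^sup>+y. ennreal (kmaj ca cN (x - y) * norm (g y)) \<partial>lborel)"
      by (rule nn_integral_cmult) measurable
    also have "\<dots> \<le> ennreal C * ennreal (A powr (1 / q) * G powr (1 / p))"
      by (intro mult_left_mono conv_Holder A G kmaj_nonneg) auto
    also have "\<dots> = ennreal (C * A powr (1 / q) * G powr (1 / p))"
      using C(1) by (simp add: mult.assoc ennreal_mult')
    finally show "conv_mass l g x \<le> ennreal (C * A powr (1 / q) * G powr (1 / p))" .
  qed
qed

text \<open>
  If \<open>|x| \<ge> R\<^sub>1 + R\<^sub>2\<close> then \<open>|x - y| \<ge> R\<^sub>1\<close> or \<open>|y| \<ge> R\<^sub>2\<close>, so that in Hoelder's inequality one of the two
  factors may be restricted to its tail.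
\<close>

lemma conv_tail:
  fixes g :: "real ^ 'n \<Rightarrow> complex"
  assumes l: "length l \<le> m" and [measurable]: "g \<in> borel_measurable borel"
    and g: "(\<integral>\<^sup>+x. ennreal (norm (g x) powr p) \<partial>lborel) < \<infinity>" and \<epsilon>: "\<epsilon> > 0"
  shows "\<exists>R. \<forall>x. R \<le> norm x \<longrightarrow> conv_mass l g x \<le> ennreal \<epsilon>"
proof -
  obtain C where C: "C \<ge> 0" "\<And>x :: real ^ 'n. x \<noteq> 0 \<Longrightarrow> (\<integral>\<^sup>+r. norm (Ker l r x) \<partial>\<nu>) \<le> ennreal (C * kmaj ca cN x)"
    using Ker_majorant[OF l] by blast
  obtain A where A: "A \<ge> 0" "(\<integral>\<^sup>+x. ennreal (kmaj ca cN (x :: real ^ 'n) powr q) \<partial>lborel) \<le> ennreal A"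
    using kmaj_total by blast
  define G where "G = enn2real (\<integral>\<^sup>+x. ennreal (norm (g x) powr p) \<partial>lborel)"
  have G: "0 \<le> G" "(\<integral>\<^sup>+x. ennreal (norm (g x) powr p) \<partial>lborel) \<le> ennreal G"
    using g by (auto simp: G_def)
  \<comment> \<open>The two tails are made so small that their contributions add up to at most \<open>\<epsilon>/2\<close>; the summands \<open>1\<close> avoid a division by zero.\<close>
  define D where "D = (C + 1) * (A powr (1 / q) + G powr (1 / p) + 1)"
  define \<eta> where "\<eta> = \<epsilon> / (2 * D)"
  have D: "0 < D"
    unfolding D_def using C by (intro mult_pos_pos add_nonneg_pos add_nonneg_nonneg) auto
  have \<eta>: "\<eta> > 0" using \<epsilon> D by (simp add: \<eta>_def)
  have "(\<integral>\<^sup>+x. ennreal (kmaj ca cN (x :: real ^ 'n) powr q) \<partial>lborel) < \<infinity>" using A by (simp add: le_less_trans)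
  then obtain R1 where R1: "R1 > 0" "shell_integral {R1..} (\<lambda>x :: real ^ 'n. kmaj ca cN x powr q) \<le> ennreal (\<eta> powr q)"
    using nn_integral_tail[of "\<lambda>x. ennreal (kmaj ca cN x powr q)" "\<eta> powr q"] \<eta> by auto
  obtain R2 where R2: "R2 > 0" "(\<integral>\<^sup>+x. indicator {R2..} (norm x) * ennreal (norm (g x) powr p) \<partial>lborel) \<le> ennreal (\<eta> powr p)"
    using nn_integral_tail[of "\<lambda>x. ennreal (norm (g x) powr p)" "\<eta> powr p"] \<eta> g by auto
  define u where "u x = indicator {R1..} (norm x) * kmaj ca cN x" for x :: "real ^ 'n"
  define f where "f x = indicator {R2..} (norm x) * g x" for x
  have [measurable]: "u \<in> borel_measurable borel" "f \<in> borel_measurable borel" unfolding u_def f_def by measurable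
  have u: "(\<integral>\<^sup>+x. ennreal (u x powr q) \<partial>lborel) \<le> ennreal (\<eta> powr q)" "\<And>x. 0 \<le> u x"
  proof -
    have "(\<integral>\<^sup>+x. ennreal (u x powr q) \<partial>lborel) = shell_integral {R1..} (\<lambda>x :: real ^ 'n. kmaj ca cN x powr q)"
      by (intro nn_integral_cong) (auto simp: u_def indicator_def)
    with R1 show "(\<integral>\<^sup>+x. ennreal (u x powr q) \<partial>lborel) \<le> ennreal (\<eta> powr q)" by simp
  qed (simp add: u_def kmaj_nonneg)
  have f: "(\<integral>\<^sup>+x. ennreal (norm (f x) powr p) \<partial>lborel) \<le> ennreal (\<eta> powr p)"
  proof -
    have "(\<integral>\<^sup>+x. ennreal (norm (f x) powr p) \<partial>lborel) = (\<integral>\<^sup>+x. indicator {R2..} (norm x) * ennreal (norm (g x) powr p) \<partial>lborel)"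
      by (intro nn_integral_cong) (auto simp: f_def indicator_def)
    with R2 show ?thesis by simp
  qed
  show ?thesis
  proof (intro exI[of _ "R1 + R2"] allI impI)
    fix x :: "real ^ 'n" assume x: "R1 + R2 \<le> norm x"
    have "conv_mass l g x \<le> (\<integral>\<^sup>+y. ennreal ((C * kmaj ca cN (x - y)) * norm (g y)) \<partial>lborel)"
    proof (rule kernel_conv_le)
      show "AE y in lborel. (\<integral>\<^sup>+r. norm (Ker l r (x - y)) \<partial>\<nu>) \<le> ennreal (C * kmaj ca cN (x - y))"
        using AE_sub_neq[of x] by eventually_elim (rule C(2))
    qed (use mult_nonneg_nonneg[OF C(1) kmaj_nonneg] in auto)
    also have "\<dots> \<le> (\<integral>\<^sup>+y. ennreal C * (ennreal (u (x - y) * norm (g y)) + ennreal (kmaj ca cN (x - y) * norm (f y))) \<partial>lborel)"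
    proof (rule nn_integral_mono)
      fix y :: "real ^ 'n"
      have "norm x \<le> norm (x - y) + norm y" using norm_triangle_ineq[of "x - y" y] by simp
      then have "R1 \<le> norm (x - y) \<or> R2 \<le> norm y" using x by linarith
      then have "kmaj ca cN (x - y) * norm (g y) \<le> u (x - y) * norm (g y) + kmaj ca cN (x - y) * norm (f y)"
        using kmaj_nonneg[of ca cN "x - y"] by (auto simp: u_def f_def indicator_def)
      then have "C * kmaj ca cN (x - y) * norm (g y) \<le> C * (u (x - y) * norm (g y) + kmaj ca cN (x - y) * norm (f y))"
        using mult_left_mono[OF _ C(1)] by (simp add: mult.assoc)
      then have "ennreal (C * kmaj ca cN (x - y) * norm (g y)) \<le> ennreal (C * (u (x - y) * norm (g y) + kmaj ca cN (x - y) * norm (f y)))"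
        by (rule ennreal_leI)
      also have "\<dots> = ennreal C * (ennreal (u (x - y) * norm (g y)) + ennreal (kmaj ca cN (x - y) * norm (f y)))"
        using C(1) u(2) kmaj_nonneg[of ca cN "x - y"] by (simp add: ennreal_mult' ennreal_plus)
      finally show "ennreal (C * kmaj ca cN (x - y) * norm (g y)) \<le> \<dots>" .
    qed
    also have "\<dots> = ennreal C * ((\<integral>\<^sup>+y. ennreal (u (x - y) * norm (g y)) \<partial>lborel) + (\<integral>\<^sup>+y. ennreal (kmaj ca cN (x - y) * norm (f y)) \<partial>lborel))"
      by (simp add: nn_integral_cmult nn_integral_add)
    also have "\<dots> \<le> ennreal C * (ennreal ((\<eta> powr q) powr (1 / q) * G powr (1 / p)) + ennreal (A powr (1 / q) * (\<eta> powr p) powr (1 / p)))"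
      by (intro mult_left_mono add_mono conv_Holder A G u f kmaj_nonneg) auto
    also have "(\<eta> powr q) powr (1 / q) = \<eta>" using \<eta> q by (simp add: powr_powr)
    also have "(\<eta> powr p) powr (1 / p) = \<eta>" using \<eta> p by (simp add: powr_powr)
    also have "ennreal C * (ennreal (\<eta> * G powr (1 / p)) + ennreal (A powr (1 / q) * \<eta>)) = ennreal (C * (\<eta> * G powr (1 / p) + A powr (1 / q) * \<eta>))"
      using C(1) \<eta> by (simp add: ennreal_mult' ennreal_plus)
    also have "\<dots> \<le> ennreal \<epsilon>"
    proof (rule ennreal_leI)
      have "C * (\<eta> * G powr (1 / p) + A powr (1 / q) * \<eta>) \<le> \<eta> * D"
      proof -
        have "C * (A powr (1 / q) + G powr (1 / p)) \<le> D"
          unfolding D_def using C(1) by (intro mult_mono) auto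
        from mult_left_mono[OF this, of \<eta>] \<eta> show ?thesis by (simp add: algebra_simps)
      qed
      also have "\<dots> = \<epsilon> / 2" using D by (simp add: \<eta>_def)
      also have "\<dots> \<le> \<epsilon>" using \<epsilon> by simp
      finally show "C * (\<eta> * G powr (1 / p) + A powr (1 / q) * \<eta>) \<le> \<epsilon>" .
    qed
    finally show "conv_mass l g x \<le> ennreal \<epsilon>" .
  qed
qed

section \<open>The logarithmic modulus of continuity\<close>

text \<open>
  Let \<open>\<delta> = |h|\<close> and \<open>L = |ln \<delta>|\<close>. For \<open>|z| < 2\<delta>\<close> the two kernels are estimated separately, by the
  majorant at \<open>z\<close> and at \<open>z + h\<close>, both points lying in the ball of radius \<open>3\<delta>\<close>. For \<open>|z| \<ge> 2\<delta>\<close> the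
  difference is at most \<open>\<delta>\<close> times the majorant with one more derivative. The \<open>q\<close>-th powers of the
  three pieces have integrals bounded by a multiple of \<open>L\<^bsup>1-q\<^esup>\<close>, and \<open>(1 - q)/q = -1/p\<close>.
\<close>

lemma conv_diff_bound:
  assumes l: "length l \<le> m"
  shows "\<exists>C\<ge>0. \<forall>(g :: real ^ 'n \<Rightarrow> complex) G x h. g \<in> borel_measurable borel \<longrightarrow> 0 \<le> G \<longrightarrow>
    (\<integral>\<^sup>+x. ennreal (norm (g x) powr p) \<partial>lborel) \<le> ennreal G \<longrightarrow> 0 < norm h \<longrightarrow> norm h < 1 / 16 \<longrightarrow>
    diff_mass l g x h
      \<le> ennreal (C * G powr (1 / p) * (- ln (norm h)) powr (- (1 / p)))"
proof -
  obtain C1 where C1: "C1 \<ge> 0" "\<And>x :: real ^ 'n. x \<noteq> 0 \<Longrightarrow> (\<integral>\<^sup>+r. norm (Ker l r x) \<partial>\<nu>) \<le> ennreal (C1 * kmaj ca cN x)"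
    using Ker_majorant[OF l] by blast
  obtain C2 where C2: "C2 \<ge> 0" "\<And>(x :: real ^ 'n) h. x \<noteq> 0 \<Longrightarrow> 2 * norm h \<le> norm x \<Longrightarrow>
    (\<integral>\<^sup>+r. norm (Ker l r (x + h) - Ker l r x) \<partial>\<nu>) \<le> ennreal (C2 * (norm h * kmaj (ca + 1/2) cN x))"
    using Ker_diff_majorant[OF l] by blast
  obtain A1 where A1: "A1 \<ge> 0" "\<And>\<delta>. 0 < \<delta> \<and> \<delta> \<le> 1 / 2 \<Longrightarrow>
    shell_integral {0<..\<delta>} (\<lambda>x :: real ^ 'n. kmaj ca cN x powr q)
     \<le> ennreal (A1 * (- ln \<delta>) powr (1 - q))"
    using kmaj_near by blast
  obtain A2 where A2: "A2 \<ge> 0" "\<And>\<delta>. 0 < \<delta> \<and> \<delta> \<le> 1 / 2 \<Longrightarrow>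
    shell_integral {\<delta>..} (\<lambda>x :: real ^ 'n. kmaj (ca + 1/2) cN x powr q)
     \<le> ennreal (A2 * \<delta> powr (- q) * (- ln \<delta>) powr (- q) + A2)"
    using kmaj_far by blast
  define C where "C = C1 + C2"
  define A where "A = A1 * 2 powr (q - 1) + 2 * A2"
  have C: "C \<ge> 0" and A: "A \<ge> 0" using C1 C2 A1 A2 by (simp_all add: C_def A_def)
  show ?thesis
  proof (intro exI[of _ "3 * C * A powr (1 / q)"] conjI allI impI)
    show "0 \<le> 3 * C * A powr (1 / q)" using C by simp
    fix g :: "real ^ 'n \<Rightarrow> complex" and G and x h :: "real ^ 'n"
    assume [measurable]: "g \<in> borel_measurable borel"
      and G: "0 \<le> G" "(\<integral>\<^sup>+x. ennreal (norm (g x) powr p) \<partial>lborel) \<le> ennreal G"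
      and h: "0 < norm h" "norm h < 1 / 16"
    define \<delta> where "\<delta> = norm h"
    define L where "L = - ln \<delta>"
    have \<delta>: "0 < \<delta>" "\<delta> < 1 / 16" using h by (simp_all add: \<delta>_def)
    have L16: "ln 16 \<le> L"
    proof -
      have "ln \<delta> \<le> ln (1 / 16)" using \<delta> by simp
      then show ?thesis by (simp add: L_def ln_div)
    qed
    have ln16: "ln (16::real) = 2 * ln 4" using ln_realpow[of "4::real" 2] by simp
    have ln4: "1 \<le> 2 * ln (4::real)"
    proof -
      have "ln (1 / 4 :: real) \<le> 1 / 4 - 1" by (rule ln_le_minus_one) simp
      then show ?thesis by (simp add: ln_div)
    qed
    have L1: "1 \<le> L" using L16 ln16 ln4 by linarith
    \<comment> \<open>\<open>\<delta> < 1/16\<close> and \<open>c \<le> 4\<close> give \<open>c \<le> \<delta>\<^bsup>-1/2\<^esup>\<close>.\<close>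
    have half: "L / 2 \<le> - ln (c * \<delta>)" if "0 < c" "c \<le> 4" for c
    proof -
      have "ln c \<le> ln 4" using that by simp
      moreover have "ln (c * \<delta>) = ln c - L" using that \<delta> by (simp add: ln_mult L_def)
      ultimately show ?thesis using L16 ln16 by linarith
    qed
    have Lpow: "0 \<le> A * L powr (1 - q)" using A by simp
    define u1 where "u1 c z = indicator {0<..c * \<delta>} (norm z) * kmaj ca cN z" for c and z :: "real ^ 'n"
    define u3 where "u3 z = indicator {2 * \<delta>..} (norm z) * (\<delta> * kmaj (ca + 1/2) cN z)" for z :: "real ^ 'n"
    have [measurable]: "u1 c \<in> borel_measurable borel" "u3 \<in> borel_measurable borel" for c
      unfolding u1_def[abs_def] u3_def[abs_def] by measurable
    have nn: "0 \<le> u1 c z" "0 \<le> u3 z" for c z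
      unfolding u1_def u3_def using \<delta> by (auto intro!: mult_nonneg_nonneg kmaj_nonneg)
    have u1: "(\<integral>\<^sup>+z. ennreal (u1 c z powr q) \<partial>lborel) \<le> ennreal (A * L powr (1 - q))" if c: "0 < c" "c \<le> 4" for c
    proof -
      have "(\<integral>\<^sup>+z. ennreal (u1 c z powr q) \<partial>lborel) = (\<integral>\<^sup>+z. indicator {0<..c * \<delta>} (norm (z :: real ^ 'n)) * ennreal (kmaj ca cN z powr q) \<partial>lborel)"
        by (intro nn_integral_cong) (auto simp: u1_def indicator_def)
      also have "\<dots> \<le> ennreal (A1 * (- ln (c * \<delta>)) powr (1 - q))"
      proof (rule A1(2))
        have "c * \<delta> \<le> 4 * (1 / 16)" using c \<delta> by (intro mult_mono) auto
        then show "0 < c * \<delta> \<and> c * \<delta> \<le> 1 / 2" using c \<delta> by simp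
      qed
      also have "\<dots> \<le> ennreal (A * L powr (1 - q))"
      proof (rule ennreal_leI)
        have "(- ln (c * \<delta>)) powr (1 - q) \<le> (L / 2) powr (1 - q)"
          using half[OF c] L1 q by (intro powr_mono2') auto
        also have "\<dots> = 2 powr (q - 1) * L powr (1 - q)"
        proof -
          have "2 powr (q - 1) = 1 / 2 powr (1 - q)" using powr_minus_divide[of 2 "1 - q"] by simp
          then show ?thesis using L1 by (simp add: powr_divide)
        qed
        finally have "A1 * (- ln (c * \<delta>)) powr (1 - q) \<le> A1 * (2 powr (q - 1) * L powr (1 - q))"
          by (rule mult_left_mono) (rule A1(1))
        also have "\<dots> \<le> A * L powr (1 - q)"
          unfolding A_def using A2(1) by (simp add: distrib_right mult.assoc)
        finally show "A1 * (- ln (c * \<delta>)) powr (1 - q) \<le> A * L powr (1 - q)" .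
      qed
      finally show ?thesis .
    qed
    \<comment> \<open>The additive constant of \<open>kmaj_far\<close> is harmless: it comes with \<open>\<delta>\<^sup>q \<le> L\<^bsup>-q\<^esup>\<close>.\<close>
    have u3: "(\<integral>\<^sup>+z. ennreal (u3 z powr q) \<partial>lborel) \<le> ennreal (A * L powr (1 - q))"
    proof -
      have "(\<integral>\<^sup>+z. ennreal (u3 z powr q) \<partial>lborel)
        = (\<integral>\<^sup>+z. ennreal (\<delta> powr q) * (indicator {2 * \<delta>..} (norm (z :: real ^ 'n)) * ennreal (kmaj (ca + 1/2) cN z powr q)) \<partial>lborel)"
        using \<delta> kmaj_nonneg by (intro nn_integral_cong) (auto simp: u3_def indicator_def powr_mult ennreal_mult)
      also have "\<dots> = ennreal (\<delta> powr q) * (\<integral>\<^sup>+z. indicator {2 * \<delta>..} (norm (z :: real ^ 'n)) * ennreal (kmaj (ca + 1/2) cN z powr q) \<partial>lborel)"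
        by (rule nn_integral_cmult) measurable
      also have "\<dots> \<le> ennreal (\<delta> powr q) * ennreal (A2 * (2 * \<delta>) powr (- q) * (- ln (2 * \<delta>)) powr (- q) + A2)"
        using \<delta> by (intro mult_left_mono A2(2)) auto
      also have "\<dots> = ennreal (\<delta> powr q * (A2 * (2 * \<delta>) powr (- q) * (- ln (2 * \<delta>)) powr (- q) + A2))"
        using A2(1) by (intro ennreal_mult[symmetric]) auto
      also have "\<dots> \<le> ennreal (A * L powr (1 - q))"
      proof (rule ennreal_leI)
        have "L \<le> 1 / \<delta>"
        proof -
          have "ln (1 / \<delta>) \<le> 1 / \<delta> - 1" using \<delta> by (intro ln_le_minus_one) auto
          then show ?thesis using \<delta> by (simp add: L_def ln_div)
        qed
        then have "\<delta> \<le> 1 / L" using \<delta> L1 by (simp add: field_simps)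
        then have "\<delta> powr q \<le> (1 / L) powr q" using \<delta> q by (intro powr_mono2) auto
        also have "\<dots> = L powr (- q)" using L1 by (simp add: powr_divide powr_minus_divide)
        finally have 1: "\<delta> powr q \<le> L powr (- q)" .
        have "(2 * \<delta>) powr (- q) * (- ln (2 * \<delta>)) powr (- q) \<le> (2 * \<delta>) powr (- q) * (L / 2) powr (- q)"
          using half[of 2] L1 q by (intro mult_left_mono powr_mono2') auto
        also have "\<dots> = (\<delta> * L) powr (- q)" using \<delta> L1 by (simp flip: powr_mult)
        also have "\<dots> = \<delta> powr (- q) * L powr (- q)" using \<delta> L1 by (simp add: powr_mult)
        finally have "\<delta> powr q * ((2 * \<delta>) powr (- q) * (- ln (2 * \<delta>)) powr (- q)) \<le> \<delta> powr q * (\<delta> powr (- q) * L powr (- q))"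
          by (rule mult_left_mono) simp
        also have "\<dots> = (\<delta> powr q * \<delta> powr (- q)) * L powr (- q)" by simp
        also have "\<delta> powr q * \<delta> powr (- q) = 1" using \<delta> by (simp add: powr_minus)
        finally have 2: "\<delta> powr q * ((2 * \<delta>) powr (- q) * (- ln (2 * \<delta>)) powr (- q)) \<le> L powr (- q)" by simp
        have "\<delta> powr q * (A2 * (2 * \<delta>) powr (- q) * (- ln (2 * \<delta>)) powr (- q) + A2)
          = A2 * (\<delta> powr q * ((2 * \<delta>) powr (- q) * (- ln (2 * \<delta>)) powr (- q))) + A2 * \<delta> powr q"
          by (simp add: algebra_simps)
        also have "\<dots> \<le> A2 * L powr (- q) + A2 * L powr (- q)" by (intro add_mono mult_left_mono 1 2 A2(1))
        also have "\<dots> = 2 * A2 * L powr (- q)" by simp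
        also have "\<dots> \<le> 2 * A2 * L powr (1 - q)" using A2(1) L1 by (intro mult_left_mono powr_mono) auto
        also have "\<dots> \<le> A * L powr (1 - q)" unfolding A_def using A1(1) by (simp add: distrib_right)
        finally show "\<delta> powr q * (A2 * (2 * \<delta>) powr (- q) * (- ln (2 * \<delta>)) powr (- q) + A2) \<le> A * L powr (1 - q)" .
      qed
      finally show ?thesis .
    qed
    let ?H = "(A * L powr (1 - q)) powr (1 / q) * G powr (1 / p)"
    define U where "U y = C * (u1 2 (x - y) + u1 3 (x + h - y) + u3 (x - y))" for y
    have "diff_mass l g x h \<le> (\<integral>\<^sup>+y. ennreal (U y * norm (g y)) \<partial>lborel)"
    proof (rule kernel_conv_le)
      show "(\<lambda>z. Ker l (fst z) (x + h - snd z) - Ker l (fst z) (x - snd z)) \<in> borel_measurable (borel \<Otimes>\<^sub>M borel)" by measurable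
      show "0 \<le> U y" for y unfolding U_def by (intro mult_nonneg_nonneg add_nonneg_nonneg nn C)
      show "AE y in lborel. (\<integral>\<^sup>+r. norm (Ker l r (x + h - y) - Ker l r (x - y)) \<partial>\<nu>) \<le> ennreal (U y)"
        using AE_sub_neq[of x] AE_sub_neq[of "x + h"]
      proof eventually_elim
        case (elim y)
        define z where "z = x - y"
        have z: "z \<noteq> 0" "z + h \<noteq> 0" "x + h - y = z + h" using elim by (simp_all add: z_def algebra_simps)
        show ?case
        proof (cases "2 * \<delta> \<le> norm z")
          case True
          have "(\<integral>\<^sup>+r. norm (Ker l r (z + h) - Ker l r z) \<partial>\<nu>) \<le> ennreal (C2 * (norm h * kmaj (ca + 1/2) cN z))"
            using True z by (intro C2) (auto simp: \<delta>_def)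
          also have "\<dots> \<le> ennreal (U y)"
          proof (rule ennreal_leI)
            have "C2 * (norm h * kmaj (ca + 1/2) cN z) = C2 * u3 z" using True by (simp add: u3_def \<delta>_def)
            also have "\<dots> \<le> C * (u1 2 z + u1 3 (z + h) + u3 z)"
              using nn C1(1) C2(1) by (intro mult_mono) (auto simp: C_def)
            finally show "C2 * (norm h * kmaj (ca + 1/2) cN z) \<le> U y" by (simp add: U_def z_def algebra_simps)
          qed
          finally show ?thesis by (simp only: z(3) z_def[symmetric])
        next
          case False
          have zh: "norm (z + h) \<le> 3 * \<delta>" using norm_triangle_ineq[of z h] False by (simp add: \<delta>_def)
          have "(\<integral>\<^sup>+r. norm (Ker l r (z + h) - Ker l r z) \<partial>\<nu>) \<le> (\<integral>\<^sup>+r. ennreal (norm (Ker l r (z + h))) + ennreal (norm (Ker l r z)) \<partial>\<nu>)"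
            by (intro nn_integral_mono) (auto simp flip: ennreal_plus intro!: ennreal_leI norm_triangle_ineq4)
          also have "\<dots> = (\<integral>\<^sup>+r. norm (Ker l r (z + h)) \<partial>\<nu>) + (\<integral>\<^sup>+r. norm (Ker l r z) \<partial>\<nu>)"
            by (rule nn_integral_add) measurable
          also have "\<dots> \<le> ennreal (C1 * kmaj ca cN (z + h)) + ennreal (C1 * kmaj ca cN z)"
            by (intro add_mono C1 z)
          also have "\<dots> = ennreal (C1 * (kmaj ca cN (z + h) + kmaj ca cN z))"
            unfolding distrib_left by (intro ennreal_plus[symmetric] mult_nonneg_nonneg C1(1) kmaj_nonneg)
          also have "\<dots> \<le> ennreal (U y)"
          proof (rule ennreal_leI)
            have "C1 * (kmaj ca cN (z + h) + kmaj ca cN z) = C1 * (u1 2 z + u1 3 (z + h))"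
              using False z zh by (simp add: u1_def)
            also have "\<dots> \<le> C * (u1 2 z + u1 3 (z + h) + u3 z)"
              using nn C1(1) C2(1) by (intro mult_mono add_nonneg_nonneg) (auto simp: C_def)
            finally show "C1 * (kmaj ca cN (z + h) + kmaj ca cN z) \<le> U y" by (simp add: U_def z_def algebra_simps)
          qed
          finally show ?thesis by (simp only: z(3) z_def[symmetric])
        qed
      qed
    qed
    also have "\<dots> = (\<integral>\<^sup>+y. ennreal C * (ennreal (u1 2 (x - y) * norm (g y)) + ennreal (u1 3 (x + h - y) * norm (g y)) + ennreal (u3 (x - y) * norm (g y))) \<partial>lborel)"
    proof (rule nn_integral_cong)
      fix y
      have "U y * norm (g y) = C * (u1 2 (x - y) * norm (g y) + u1 3 (x + h - y) * norm (g y) + u3 (x - y) * norm (g y))"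
        by (simp add: U_def algebra_simps)
      then show "ennreal (U y * norm (g y)) = ennreal C * (ennreal (u1 2 (x - y) * norm (g y)) + ennreal (u1 3 (x + h - y) * norm (g y)) + ennreal (u3 (x - y) * norm (g y)))"
        using C nn by (simp add: ennreal_mult' ennreal_plus)
    qed
    also have "\<dots> = ennreal C * ((\<integral>\<^sup>+y. ennreal (u1 2 (x - y) * norm (g y)) \<partial>lborel)
       + (\<integral>\<^sup>+y. ennreal (u1 3 (x + h - y) * norm (g y)) \<partial>lborel) + (\<integral>\<^sup>+y. ennreal (u3 (x - y) * norm (g y)) \<partial>lborel))"
      by (simp add: nn_integral_cmult nn_integral_add)
    also have "\<dots> \<le> ennreal C * (ennreal ?H + ennreal ?H + ennreal ?H)"
      by (intro mult_left_mono add_mono conv_Holder u1 u3 nn Lpow G) auto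
    also have "\<dots> = ennreal (C * (?H + ?H + ?H))"
    proof -
      have "ennreal C * (ennreal X + ennreal X + ennreal X) = ennreal (C * (X + X + X))" if "0 \<le> X" for X
        using C that by (simp flip: ennreal_mult ennreal_plus)
      moreover have "0 \<le> ?H" by simp
      ultimately show ?thesis .
    qed
    also have "C * (?H + ?H + ?H) = 3 * C * A powr (1 / q) * G powr (1 / p) * L powr (- (1 / p))"
      using powr_int_1q[OF A, of L] L1 by simp
    finally show "diff_mass l g x h
      \<le> ennreal (3 * C * A powr (1 / q) * G powr (1 / p) * (- ln (norm h)) powr (- (1 / p)))"
      by (simp add: L_def \<delta>_def)
  qed
qed

end

section \<open>Powers of the symbol\<close>

text \<open>
  The functions \<open>\<mu>\<^sup>b (ln \<mu>)\<^sup>c\<close> with \<open>\<mu> = \<lambda> + 4\<pi>\<^sup>2|x|\<^sup>2\<close>. Real exponents are allowed, because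
  differentiation lowers both of them; \<open>(b, c) = (s, 1)\<close> is the symbol, and \<open>(-s, -1)\<close> its inverse.
\<close>

definition mu :: "real \<Rightarrow> real ^ 'n::finite \<Rightarrow> real"
  where "mu lam x = lam + 4 * pi\<^sup>2 * (norm x)\<^sup>2"

definition symb :: "real \<Rightarrow> real \<Rightarrow> real \<Rightarrow> real ^ 'n::finite \<Rightarrow> real"
  where "symb lam b c x = mu lam x powr b * ln (mu lam x) powr c"

lemma mu_ge: "lam \<le> mu lam x" by (simp add: mu_def)

lemma symb_bound:
  assumes lam: "lam > 1"
  shows "\<exists>k C. 0 \<le> C \<and> (\<forall>x :: real ^ 'n::finite. \<bar>symb lam b c x\<bar> \<le> C * (1 + (norm x)\<^sup>2) ^ k)"
proof -
  \<comment> \<open>As \<open>\<mu> > 1\<close> and \<open>ln \<lambda> \<le> ln \<mu> \<le> \<mu>\<close>, a negative power of \<open>ln \<mu>\<close> costs a constant, and everything else at most a power of \<open>\<mu>\<close>.\<close>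
  define k where "k = nat \<lceil>\<bar>b\<bar> + \<bar>c\<bar>\<rceil>"
  define K where "K = lam + 4 * pi\<^sup>2"
  have l0: "0 < ln lam" using lam by simp
  have K: "K \<ge> 0" using lam by (simp add: K_def)
  have "\<bar>symb lam b c x\<bar> \<le> (1 + ln lam powr c) * K ^ k * (1 + (norm x)\<^sup>2) ^ k" for x :: "real ^ 'n"
  proof -
    have m: "1 < mu lam x" "lam \<le> mu lam x" using lam mu_ge[of lam x] by auto
    have l: "0 < ln (mu lam x)" "ln lam \<le> ln (mu lam x)" "ln (mu lam x) \<le> mu lam x"
      using m lam ln_le_minus_one[of "mu lam x"] by auto
    have "ln (mu lam x) powr c \<le> (1 + ln lam powr c) * mu lam x powr \<bar>c\<bar>"
    proof (cases "0 \<le> c")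
      case True
      have "ln (mu lam x) powr c \<le> mu lam x powr c" using True by (intro powr_mono2 l(3) less_imp_le[OF l(1)])
      also have "\<dots> \<le> (1 + ln lam powr c) * mu lam x powr c" by (simp add: distrib_right)
      finally show ?thesis using True by simp
    next
      case False
      have "ln (mu lam x) powr c \<le> ln lam powr c" using False l l0 by (intro powr_mono2') auto
      also have "\<dots> \<le> (1 + ln lam powr c) * 1" by simp
      also have "\<dots> \<le> (1 + ln lam powr c) * mu lam x powr \<bar>c\<bar>"
        using m by (intro mult_left_mono ge_one_powr_ge_zero add_nonneg_nonneg) auto
      finally show ?thesis .
    qed
    moreover have "mu lam x powr b \<le> mu lam x powr \<bar>b\<bar>" using m by (intro powr_mono) auto
    ultimately have "symb lam b c x \<le> mu lam x powr \<bar>b\<bar> * ((1 + ln lam powr c) * mu lam x powr \<bar>c\<bar>)"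
      unfolding symb_def by (intro mult_mono) auto
    also have "\<dots> = (1 + ln lam powr c) * mu lam x powr (\<bar>b\<bar> + \<bar>c\<bar>)" by (simp add: powr_add)
    also have "mu lam x powr (\<bar>b\<bar> + \<bar>c\<bar>) \<le> mu lam x powr real k"
      using m by (intro powr_mono) (auto simp: k_def intro: order_trans[OF le_of_int_ceiling])
    also have "mu lam x powr real k = mu lam x ^ k" using m by (intro powr_realpow) auto
    also have "mu lam x ^ k \<le> (K * (1 + (norm x)\<^sup>2)) ^ k"
    proof (intro power_mono)
      show "mu lam x \<le> K * (1 + (norm x)\<^sup>2)"
        using lam by (simp add: mu_def K_def algebra_simps)
      show "0 \<le> mu lam x" using m by simp
    qed
    finally have "symb lam b c x \<le> (1 + ln lam powr c) * (K * (1 + (norm x)\<^sup>2)) ^ k"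
      by (simp add: mult_left_mono add_nonneg_nonneg)
    moreover have "0 \<le> symb lam b c x" by (simp add: symb_def)
    ultimately show ?thesis by (simp add: power_mult_distrib mult.assoc)
  qed
  moreover have "0 \<le> (1 + ln lam powr c) * K ^ k" using K by simp
  ultimately show ?thesis by blast
qed

lemma symb_continuous: "lam > 1 \<Longrightarrow> continuous_on UNIV (symb lam b c)"
proof -
  assume lam: "lam > 1"
  have "1 < mu lam x" for x :: "real ^ 'n" using lam mu_ge[of lam x] by linarith
  then have "mu lam x \<noteq> 0" "ln (mu lam x) \<noteq> 0" for x :: "real ^ 'n" by (metis less_irrefl not_one_less_zero, metis less_irrefl ln_gt_zero)
  then show ?thesis
    unfolding symb_def[abs_def] mu_def by (intro continuous_intros) auto
qed

lemma symb_has_vector_derivative: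
  fixes x :: "real ^ 'n::finite"
  assumes lam: "lam > 1"
  shows "((\<lambda>t. complex_of_real (symb lam b c (x + t *\<^sub>R axis i 1))) has_vector_derivative
    complex_of_real (8 * pi\<^sup>2 * x $ i * (b * symb lam (b - 1) c x + c * symb lam (b - 1) (c - 1) x))) (at 0)"
proof -
  have *: "mu lam (x + t *\<^sub>R axis i 1) = mu lam x + 4 * pi\<^sup>2 * (2 * t * x $ i + t\<^sup>2)" for t
  proof -
    have "(norm (x + t *\<^sub>R axis i 1))\<^sup>2 = (norm x)\<^sup>2 + 2 * t * x $ i + t\<^sup>2"
      unfolding power2_norm_eq_inner
      by (simp add: inner_add_left inner_add_right inner_axis inner_axis' power2_eq_square algebra_simps)
    then show ?thesis by (simp add: mu_def algebra_simps)
  qed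
  have m: "1 < mu lam x" using lam mu_ge[of lam x] by linarith
  then have l: "0 < ln (mu lam x)" by simp
  define D where "D = 8 * pi\<^sup>2 * x $ i"
  have 1: "((\<lambda>t. mu lam x + 4 * pi\<^sup>2 * (2 * t * x $ i + t\<^sup>2)) has_real_derivative D) (at 0)"
    by (auto intro!: derivative_eq_intros simp: D_def)
  have 2: "((\<lambda>t. (mu lam x + 4 * pi\<^sup>2 * (2 * t * x $ i + t\<^sup>2)) powr b) has_real_derivative b * mu lam x powr (b - 1) * D) (at 0)"
    using DERIV_fun_powr[OF 1, of b] m by simp
  have "((\<lambda>t. ln (mu lam x + 4 * pi\<^sup>2 * (2 * t * x $ i + t\<^sup>2))) has_real_derivative D / mu lam x) (at 0)"
    using m by (auto intro!: derivative_eq_intros simp: D_def)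
  from DERIV_fun_powr[OF this, of c]
  have 3: "((\<lambda>t. ln (mu lam x + 4 * pi\<^sup>2 * (2 * t * x $ i + t\<^sup>2)) powr c) has_real_derivative
      c * ln (mu lam x) powr (c - 1) * (D / mu lam x)) (at 0)" using l by simp
  from DERIV_mult[OF 2 3]
  have "((\<lambda>t. symb lam b c (x + t *\<^sub>R axis i 1)) has_real_derivative
     b * mu lam x powr (b - 1) * D * ln (mu lam x) powr c + c * ln (mu lam x) powr (c - 1) * (D / mu lam x) * mu lam x powr b) (at 0)"
    by (simp add: symb_def *)
  also have "b * mu lam x powr (b - 1) * D * ln (mu lam x) powr c + c * ln (mu lam x) powr (c - 1) * (D / mu lam x) * mu lam x powr b
    = D * (b * symb lam (b - 1) c x + c * symb lam (b - 1) (c - 1) x)"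
  proof -
    have "mu lam x powr b / mu lam x = mu lam x powr (b - 1)" using m by (simp add: powr_diff)
    moreover have "c * ln (mu lam x) powr (c - 1) * (D / mu lam x) * mu lam x powr b
        = D * (c * ((mu lam x powr b / mu lam x) * ln (mu lam x) powr (c - 1)))" by simp
    ultimately have "c * ln (mu lam x) powr (c - 1) * (D / mu lam x) * mu lam x powr b = D * (c * (mu lam x powr (b - 1) * ln (mu lam x) powr (c - 1)))"
      by (simp only:)
    then show ?thesis by (simp add: symb_def algebra_simps)
  qed
  finally show ?thesis
    unfolding D_def by (intro has_vector_derivative_of_real) (simp add: has_real_derivative_iff_has_vector_derivative)
qed

text \<open>
  The products \<open>\<mu>\<^sup>b (ln \<mu>)\<^sup>c f\<close>, for all \<open>b\<close>, \<open>c\<close> and all rapidly decreasing \<open>f\<close>, generate a hull that is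
  closed under differentiation, since \<open>\<partial>\<^sub>i \<mu> = 8\<pi>\<^sup>2x\<^sub>i\<close>.
\<close>

lemma rapid_symb_mult:
  fixes f :: "real ^ 'n::finite \<Rightarrow> complex"
  assumes lam: "lam > 1" and f: "rapid f"
  shows "rapid (\<lambda>x. complex_of_real (symb lam b c x) * f x)"
proof (rule rapid_poly_span)
  let ?A = "\<lambda>F. \<exists>b c f. rapid f \<and> F = (\<lambda>x :: real ^ 'n. complex_of_real (symb lam b c x) * f x)"
  show "poly_span ?A (\<lambda>x. complex_of_real (symb lam b c x) * f x)" using f by (intro poly_span.base) blast
  have D: "((\<lambda>t. complex_of_real (symb lam b c (x + t *\<^sub>R axis i 1)) * f (x + t *\<^sub>R axis i 1)) has_vector_derivative
     ((of_real (8 * pi\<^sup>2 * b) * (of_real (x $ i) * (complex_of_real (symb lam (b - 1) c x) * f x))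
     + of_real (8 * pi\<^sup>2 * c) * (of_real (x $ i) * (complex_of_real (symb lam (b - 1) (c - 1) x) * f x)))
     + complex_of_real (symb lam b c x) * partial_deriv i f x)) (at 0)"
    if "rapid f" for b c f i and x :: "real ^ 'n"
    using has_vector_derivative_mult[OF symb_has_vector_derivative[OF lam, of b c x i]
      axis_diff_has_vector_derivative_0[OF all_derivs_axis_diff[OF that], of x i]]
    by (simp add: algebra_simps)
  show "decay F" if FA: "?A F" for F
  proof -
    obtain b c f where f: "rapid f" and F: "F = (\<lambda>x. complex_of_real (symb lam b c x) * f x)" using FA by blast
    obtain k C where C: "0 \<le> C" "\<And>x :: real ^ 'n. \<bar>symb lam b c x\<bar> \<le> C * (1 + (norm x)\<^sup>2) ^ k"
      using symb_bound[OF lam] by metis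
    show ?thesis unfolding decay_def
    proof (intro conjI allI)
      have "continuous_on UNIV f" by (rule all_derivs_base[OF rapid_smooth[OF f]])
      then show "continuous_on UNIV F" unfolding F by (intro continuous_intros symb_continuous lam)
      fix j
      obtain B where B: "0 \<le> B" "\<And>x. norm (f x) \<le> B / (1 + (norm x)\<^sup>2) ^ (k + j)"
        using decay_bound[OF all_derivs_base[OF f]] by metis
      have "norm x ^ j * norm (F x) \<le> C * B" for x
      proof -
        have 1: "0 < 1 + (norm x)\<^sup>2" by (simp add: add_pos_nonneg)
        have "2 * norm x \<le> 1 + (norm x)\<^sup>2"
          using zero_le_power2[of "norm x - 1"] by (simp add: power2_eq_square algebra_simps)
        then have "norm x \<le> 1 + (norm x)\<^sup>2" using norm_ge_zero[of x] by linarith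
        then have "norm x ^ j \<le> (1 + (norm x)\<^sup>2) ^ j" by (intro power_mono) auto
        then have "norm x ^ j * norm (F x) \<le> (1 + (norm x)\<^sup>2) ^ j * ((C * (1 + (norm x)\<^sup>2) ^ k) * (B / (1 + (norm x)\<^sup>2) ^ (k + j)))"
          unfolding F norm_mult norm_of_real using C B 1 by (intro mult_mono mult_nonneg_nonneg) auto
        also have "\<dots> = C * B" using 1 by (simp add: power_add field_simps)
        finally show ?thesis .
      qed
      then show "\<exists>C. \<forall>x. norm x ^ j * norm (F x) \<le> C" by blast
    qed
  qed
  show "axis_diff F" if FA: "?A F" for F
  proof -
    obtain b c f where f: "rapid f" and F: "F = (\<lambda>x. complex_of_real (symb lam b c x) * f x)" using FA by blast
    show ?thesis unfolding F by (rule axis_diffI(1)[OF D[OF f]])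
  qed
  show "poly_span ?A (partial_deriv i F)" if FA: "?A F" for F i
  proof -
    obtain b c f where f: "rapid f" and F: "F = (\<lambda>x. complex_of_real (symb lam b c x) * f x)" using FA by blast
    have b: "poly_span ?A (\<lambda>x. complex_of_real (symb lam b c x) * f x)" if "rapid f" for b c f
      using that by (intro poly_span.base) blast
    show ?thesis unfolding F axis_diffI(2)[OF D[OF f]]
      by (intro poly_span.add poly_span.scale poly_span.coord b f all_derivs_partial[OF f])
  qed
qed

context critical_exponent
begin

section \<open>The convolution operators\<close>

text \<open>
  The convolution of \<open>g\<close> with the derivative of the kernel along \<open>l\<close>, kept as an integral over the pair
  of the point \<open>y\<close> and the time \<open>r\<close>. In this form it is differentiated through the smooth heat kernels,
  whereas the integrated kernel is singular at the origin.
\<close>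

definition convK :: "'n list \<Rightarrow> (real ^ 'n \<Rightarrow> complex) \<Rightarrow> real ^ 'n \<Rightarrow> complex"
  where "convK l g x = (\<integral>w. Ker l (snd w) (x - fst w) * g (fst w) \<partial>(lborel \<Otimes>\<^sub>M \<nu>))"

definition Lp_fun :: "(real ^ 'n \<Rightarrow> complex) \<Rightarrow> real \<Rightarrow> bool"
  where "Lp_fun g G \<longleftrightarrow> g \<in> borel_measurable borel \<and> 0 \<le> G \<and> (\<integral>\<^sup>+x. ennreal (norm (g x) powr p) \<partial>lborel) \<le> ennreal G"

lemma Lp_funD: "Lp_fun g G \<Longrightarrow> g \<in> borel_measurable borel" by (simp add: Lp_fun_def)

lemma measurable_pair_nu:
  assumes "f \<in> borel_measurable (borel \<Otimes>\<^sub>M borel)"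
  shows "f \<in> borel_measurable (lborel \<Otimes>\<^sub>M \<nu>)"
  using assms by (simp cong: measurable_cong_sets sets_pair_measure_cong)

lemma measurable_conv_integrand:
  assumes [measurable]: "g \<in> borel_measurable borel"
  shows "(\<lambda>(y, r). Ker l r (x - y) * g y) \<in> borel_measurable (lborel \<Otimes>\<^sub>M \<nu>)"
  by (rule measurable_pair_nu) measurable

lemma conv_integrable:
  assumes l: "length l \<le> m" and g: "Lp_fun g G"
  shows "integrable (lborel \<Otimes>\<^sub>M \<nu>) (\<lambda>w. Ker l (snd w) (x - fst w) * g (fst w))"
proof -
  obtain C where "conv_mass l g x \<le> ennreal (C * G powr (1 / p))"
    using conv_bound[OF l] g unfolding Lp_fun_def by blast
  then have "conv_mass l g x < \<infinity>" by (simp add: le_less_trans)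
  from integrable_pairI[OF nu_sigma_finite measurable_conv_integrand[OF Lp_funD[OF g]] this]
  show ?thesis by (simp add: case_prod_unfold)
qed

lemma nn_integral_pair_nu:
  assumes "f \<in> borel_measurable (borel \<Otimes>\<^sub>M borel)"
  shows "(\<integral>\<^sup>+w. f w \<partial>(lborel \<Otimes>\<^sub>M \<nu>)) = (\<integral>\<^sup>+y. \<integral>\<^sup>+r. f (y, r) \<partial>\<nu> \<partial>lborel)"
proof -
  interpret sigma_finite_measure \<nu> by (rule nu_sigma_finite)
  have "f \<in> borel_measurable (lborel \<Otimes>\<^sub>M \<nu>)" using assms by (simp cong: measurable_cong_sets sets_pair_measure_cong)
  then show ?thesis by (rule nn_integral_fst[symmetric])
qed

lemma convK_norm_le:
  assumes l: "length l \<le> m" and g: "Lp_fun g G"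
  shows "ennreal (norm (convK l g x)) \<le> conv_mass l g x"
proof -
  have [measurable]: "g \<in> borel_measurable borel" by (rule Lp_funD[OF g])
  have "ennreal (norm (convK l g x)) \<le> (\<integral>\<^sup>+w. norm (Ker l (snd w) (x - fst w) * g (fst w)) \<partial>(lborel \<Otimes>\<^sub>M \<nu>))"
    unfolding convK_def by (rule integral_norm_bound_ennreal[OF conv_integrable[OF l g]])
  also have "\<dots> = conv_mass l g x"
    by (subst nn_integral_pair_nu) simp_all
  finally show ?thesis .
qed

lemma convK_bound:
  assumes l: "length l \<le> m"
  shows "\<exists>C\<ge>0. \<forall>g G x. Lp_fun g G \<longrightarrow> norm (convK l g x) \<le> C * G powr (1 / p)"
proof -
  obtain C where C: "C \<ge> 0" "\<And>(g :: real ^ 'n \<Rightarrow> complex) G x. Lp_fun g G \<Longrightarrow>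
     conv_mass l g x \<le> ennreal (C * G powr (1 / p))"
    using conv_bound[OF l] unfolding Lp_fun_def by blast
  have "norm (convK l g x) \<le> C * G powr (1 / p)" if g: "Lp_fun g G" for g G x
    using order_trans[OF convK_norm_le[OF l g] C(2)[OF g]] C(1) by (simp add: ennreal_le_iff)
  then show ?thesis using C(1) by blast
qed

lemma convK_diff_bound:
  assumes l: "length l \<le> m"
  shows "\<exists>C\<ge>0. \<forall>g G x h. Lp_fun g G \<longrightarrow> 0 < norm h \<longrightarrow> norm h < 1 / 16 \<longrightarrow>
     norm (convK l g (x + h) - convK l g x) \<le> C * G powr (1 / p) * (- ln (norm h)) powr (- (1 / p))"
proof -
  obtain C where C: "C \<ge> 0" "\<And>(g :: real ^ 'n \<Rightarrow> complex) G x h. Lp_fun g G \<Longrightarrow> 0 < norm h \<Longrightarrow> norm h < 1 / 16 \<Longrightarrow>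
     diff_mass l g x h
      \<le> ennreal (C * G powr (1 / p) * (- ln (norm h)) powr (- (1 / p)))"
    using conv_diff_bound[OF l] unfolding Lp_fun_def by blast
  have "norm (convK l g (x + h) - convK l g x) \<le> C * G powr (1 / p) * (- ln (norm h)) powr (- (1 / p))"
    if g: "Lp_fun g G" and h: "0 < norm h" "norm h < 1 / 16" for g G x h
  proof -
    have [measurable]: "g \<in> borel_measurable borel" by (rule Lp_funD[OF g])
    have "convK l g (x + h) - convK l g x
      = (\<integral>w. Ker l (snd w) (x + h - fst w) * g (fst w) - Ker l (snd w) (x - fst w) * g (fst w) \<partial>(lborel \<Otimes>\<^sub>M \<nu>))"
      unfolding convK_def by (rule Bochner_Integration.integral_diff[symmetric]) (rule conv_integrable[OF l g])+
    also have "ennreal (norm \<dots>) \<le> (\<integral>\<^sup>+w. norm (Ker l (snd w) (x + h - fst w) * g (fst w) - Ker l (snd w) (x - fst w) * g (fst w)) \<partial>(lborel \<Otimes>\<^sub>M \<nu>))"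
      by (intro integral_norm_bound_ennreal Bochner_Integration.integrable_diff conv_integrable[OF l g])
    also have "\<dots> = diff_mass l g x h"
      by (subst nn_integral_pair_nu) (simp_all add: left_diff_distrib)
    also have "\<dots> \<le> ennreal (C * G powr (1 / p) * (- ln (norm h)) powr (- (1 / p)))" by (rule C(2)[OF g h])
    finally show ?thesis using C(1) by (simp add: ennreal_le_iff)
  qed
  then show ?thesis using C(1) by blast
qed

text \<open>
  The modulus of continuity tends to \<open>0\<close> with \<open>|h|\<close>.
\<close>

lemma convK_continuous:
  assumes l: "length l \<le> m" and g: "Lp_fun g G"
  shows "continuous_on UNIV (convK l g)"
proof -
  obtain C where C: "C \<ge> 0" "\<And>x h. 0 < norm h \<Longrightarrow> norm h < 1 / 16 \<Longrightarrow>
     norm (convK l g (x + h) - convK l g x) \<le> C * G powr (1 / p) * (- ln (norm h)) powr (- (1 / p))"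
    using convK_diff_bound[OF l] g by blast
  have lim: "((\<lambda>t. C * G powr (1 / p) * (- ln t) powr (- (1 / p))) \<longlongrightarrow> 0) (at_right 0)"
  proof -
    have "((\<lambda>t::real. (- ln t) powr (- (1 / p))) \<longlongrightarrow> 0) (at_right 0)"
    proof (rule tendsto_neg_powr)
      show "filterlim (\<lambda>t::real. - ln t) at_top (at_right 0)"
        using ln_at_0 by (simp add: filterlim_uminus_at_top)
    qed (use p in auto)
    from tendsto_mult_right_zero[OF this] show ?thesis .
  qed
  have "isCont (convK l g) x" for x
    unfolding LIM_eq[of "convK l g" "convK l g x" x, folded isCont_def]
  proof (intro allI impI)
    fix e :: real assume e: "0 < e"
    from order_tendstoD(2)[OF lim e] obtain d where d: "d > 0" "\<And>t. 0 < t \<Longrightarrow> t < d \<Longrightarrow> C * G powr (1 / p) * (- ln t) powr (- (1 / p)) < e"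
      by (auto simp: eventually_at_right_field)
    show "\<exists>\<delta>>0. \<forall>y. y \<noteq> x \<and> norm (y - x) < \<delta> \<longrightarrow> norm (convK l g y - convK l g x) < e"
    proof (intro exI[of _ "min d (1 / 16)"] conjI allI impI; (elim conjE)?)
      show "0 < min d (1 / 16)" using d by simp
      fix y assume y: "y \<noteq> x" "norm (y - x) < min d (1 / 16)"
      then have "norm (convK l g (x + (y - x)) - convK l g x) \<le> C * G powr (1 / p) * (- ln (norm (y - x))) powr (- (1 / p))"
        by (intro C(2)) auto
      also have "\<dots> < e" using y by (intro d(2)) auto
      finally show "norm (convK l g y - convK l g x) < e" by simp
    qed
  qed
  then show ?thesis by (simp add: continuous_at_imp_continuous_on)
qed

lemma convK_C0:
  assumes l: "length l \<le> m" and g: "Lp_fun g G"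
  shows "convK l g \<in> C0"
proof -
  have "(convK l g \<longlongrightarrow> 0) at_infinity"
    unfolding Lim_at_infinity
  proof (intro allI impI)
    fix e :: real assume e: "0 < e"
    have "(\<integral>\<^sup>+x. ennreal (norm (g x) powr p) \<partial>lborel) < \<infinity>"
      using g by (auto simp: Lp_fun_def intro: le_less_trans[OF _ ennreal_less_top])
    from conv_tail[OF l Lp_funD[OF g] this, of "e / 2"] e
    obtain R where R: "\<And>x. R \<le> norm x \<Longrightarrow> conv_mass l g x \<le> ennreal (e / 2)" by auto
    have "dist (convK l g x) 0 < e" if "R \<le> norm x" for x
    proof -
      have "ennreal (norm (convK l g x)) \<le> ennreal (e / 2)" by (rule order_trans[OF convK_norm_le[OF l g] R[OF that]])
      then have "norm (convK l g x) \<le> e / 2" using e by (simp add: ennreal_le_iff)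
      then show ?thesis using e by simp
    qed
    then show "\<exists>b. \<forall>x. b \<le> norm x \<longrightarrow> dist (convK l g x) 0 < e" by blast
  qed
  then show ?thesis using convK_continuous[OF l g] by (simp add: C0_def)
qed

text \<open>
  The increments of the heat kernels along an axis are integrals of the next derivative, and the
  absolute integrability of the latter for orders up to \<open>m\<close> permits differentiation under the integral.
\<close>

lemma convK_has_vector_derivative:
  assumes l: "length l < m" and g: "Lp_fun g G"
  shows "((\<lambda>t. convK l g (x + t *\<^sub>R axis i 1)) has_vector_derivative convK (l @ [i]) g x) (at 0)"
proof -
  have l': "length (l @ [i]) \<le> m" "length l \<le> m" using l by auto
  have [measurable]: "g \<in> borel_measurable borel" by (rule Lp_funD[OF g])
  obtain C where C: "C \<ge> 0" "\<And>x. (\<integral>\<^sup>+y. \<integral>\<^sup>+r. norm (Ker (l @ [i]) r (x - y) * g y) \<partial>\<nu> \<partial>lborel) \<le> ennreal (C * G powr (1 / p))"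
    using conv_bound[OF l'(1)] g unfolding Lp_fun_def by blast
  interpret pair_sigma_finite lborel \<nu>
    using nu_sigma_finite by (simp add: pair_sigma_finite_def sigma_finite_lborel)
  let ?k' = "\<lambda>t w. Ker (l @ [i]) (snd w) (x + t *\<^sub>R axis i 1 - fst w) * g (fst w)"
  have "((\<lambda>t. \<integral>w. Ker l (snd w) (x + t *\<^sub>R axis i 1 - fst w) * g (fst w) \<partial>(lborel \<Otimes>\<^sub>M \<nu>)) has_vector_derivative
     (\<integral>w. ?k' 0 w \<partial>(lborel \<Otimes>\<^sub>M \<nu>))) (at 0)"
  proof (rule has_vector_derivative_lebesgue_integral[where k' = ?k' and B = "C * G powr (1 / p)"])
    show "sigma_finite_measure (lborel \<Otimes>\<^sub>M \<nu>)" by (rule P.sigma_finite_measure_axioms)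
    have "(\<lambda>(t, w). ?k' t w) \<in> borel_measurable (borel \<Otimes>\<^sub>M (borel \<Otimes>\<^sub>M borel))" by measurable
    then show "(\<lambda>(t, w). ?k' t w) \<in> borel_measurable (borel \<Otimes>\<^sub>M (lborel \<Otimes>\<^sub>M \<nu>))"
      by (simp cong: measurable_cong_sets sets_pair_measure_cong)
    show "integrable (lborel \<Otimes>\<^sub>M \<nu>) (\<lambda>w. Ker l (snd w) (x + t *\<^sub>R axis i 1 - fst w) * g (fst w))" for t
      by (rule conv_integrable[OF l'(2) g])
    show "((\<lambda>t. Ker l (snd w) (x + t *\<^sub>R axis i 1 - fst w) * g (fst w)) has_vector_derivative ?k' t w) (at t)" for t w
      using has_vector_derivative_mult_left[OF Ker_has_vector_derivative[of l "snd w" "x - fst w" i t], of "g (fst w)"]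
      by (simp add: algebra_simps)
    show "continuous_on UNIV (\<lambda>t. ?k' t w)" for w
      using continuous_on_axis[OF Ker_continuous[of "l @ [i]" "snd w"], of UNIV "x - fst w" i]
      by (intro continuous_on_mult_right) (simp add: algebra_simps)
    show "(\<integral>\<^sup>+w. norm (?k' t w) \<partial>(lborel \<Otimes>\<^sub>M \<nu>)) \<le> ennreal (C * G powr (1 / p))" for t
      using C(2)[of "x + t *\<^sub>R axis i 1"] by (subst nn_integral_pair_nu) simp_all
    have "continuous_on UNIV (\<lambda>t::real. convK (l @ [i]) g (x + t *\<^sub>R axis i 1))"
      by (rule continuous_on_axis[OF convK_continuous[OF l'(1) g]])
    then show "continuous_on UNIV (\<lambda>t. \<integral>w. ?k' t w \<partial>(lborel \<Otimes>\<^sub>M \<nu>))" by (simp only: convK_def)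
  qed
  then show ?thesis by (simp add: convK_def)
qed

lemma convK_axis_diff:
  assumes "length l < m" "Lp_fun g G"
  shows "axis_diff (convK l g)" "partial_deriv i (convK l g) = convK (l @ [i]) g"
  using axis_diffI[OF convK_has_vector_derivative[OF assms]] by auto

lemma fold_partial_deriv_convK:
  assumes g: "Lp_fun g G"
  shows "length (l @ l') \<le> m \<Longrightarrow> fold partial_deriv l' (convK l g) = convK (l @ l') g"
proof (induction l' arbitrary: l)
  case (Cons i l')
  then have "fold partial_deriv (i # l') (convK l g) = fold partial_deriv l' (convK (l @ [i]) g)"
    using convK_axis_diff(2)[OF _ g, of l i] by simp
  also have "\<dots> = convK ((l @ [i]) @ l') g" using Cons.prems by (intro Cons.IH) auto
  finally show ?case by simp
qed simp

lemma mderiv_convK: "Lp_fun g G \<Longrightarrow> mi_order \<gamma> \<le> m \<Longrightarrow> mderiv \<gamma> (convK [] g) = convK (mi_list \<gamma>) g"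
  using fold_partial_deriv_convK[of g G "[]" "mi_list \<gamma>"] by (simp add: mderiv_eq_fold length_mi_list)

lemma Cm_convK:
  assumes g: "Lp_fun g G"
  shows "length l + k \<le> m \<Longrightarrow> Cm k (convK l g)"
proof (induction k arbitrary: l)
  case 0
  then show ?case using convK_continuous[OF _ g, of l] by simp
next
  case (Suc k)
  then have "length l < m" by simp
  note ax = convK_axis_diff[OF this g]
  have "Cm k (convK (l @ [i]) g)" for i using Suc.prems by (intro Suc.IH) auto
  then show ?case using ax convK_continuous[OF _ g, of l] Suc.prems by (auto simp: axis_diff_def)
qed

lemma convK_C0m: "Lp_fun g G \<Longrightarrow> convK [] g \<in> C0m m"
  using Cm_convK[of g G "[]" m] by (auto simp: C0m_def mderiv_convK length_mi_list intro!: convK_C0)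

lemma rapid_Lp_fun:
  assumes \<psi>: "rapid \<psi>"
  shows "\<exists>G. Lp_fun \<psi> G"
proof -
  obtain C where C: "\<And>x. norm (\<psi> x) \<le> C" using decay_bounded[OF all_derivs_base[OF \<psi>]] by metis
  have C0: "0 \<le> C" using order_trans[OF norm_ge_zero C] .
  have i: "integrable lborel \<psi>" by (rule rapid_integrable[OF \<psi>])
  have "(\<integral>\<^sup>+x. ennreal (norm (\<psi> x) powr p) \<partial>lborel) \<le> (\<integral>\<^sup>+x. ennreal (C powr (p - 1) * norm (\<psi> x)) \<partial>lborel)"
  proof (rule nn_integral_mono, rule ennreal_leI)
    fix x
    show "norm (\<psi> x) powr p \<le> C powr (p - 1) * norm (\<psi> x)"
    proof (cases "\<psi> x = 0")
      case False
      have "norm (\<psi> x) powr p = norm (\<psi> x) powr (p - 1) * norm (\<psi> x)" using False by (simp add: powr_diff)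
      also have "\<dots> \<le> C powr (p - 1) * norm (\<psi> x)" using C p by (intro mult_right_mono powr_mono2) auto
      finally show ?thesis .
    qed simp
  qed
  also have "\<dots> = ennreal (\<integral>x. C powr (p - 1) * norm (\<psi> x) \<partial>lborel)"
    using i by (intro nn_integral_eq_integral) auto
  finally have "Lp_fun \<psi> (\<integral>x. C powr (p - 1) * norm (\<psi> x) \<partial>lborel)"
    using decay_measurable[OF all_derivs_base[OF \<psi>]] by (simp add: Lp_fun_def)
  then show ?thesis by blast
qed

lemma convK_mult_rapid_integrable:
  assumes l: "length l \<le> m" and g: "Lp_fun g G" and \<psi>: "integrable lborel \<psi>"
  shows "integrable lborel (\<lambda>x. convK l g x * \<psi> x)"
proof -
  obtain C where C: "\<And>x. norm (convK l g x) \<le> C * G powr (1 / p)" using convK_bound[OF l] g by blast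
  have [measurable]: "convK l g \<in> borel_measurable borel"
    by (rule borel_measurable_continuous_onI[OF convK_continuous[OF l g]])
  have [measurable]: "\<psi> \<in> borel_measurable borel" using borel_measurable_integrable[OF \<psi>] by simp
  show ?thesis
  proof (rule Bochner_Integration.integrable_bound)
    show "integrable lborel (\<lambda>x. (C * G powr (1 / p)) * norm (\<psi> x))" using \<psi> by (intro integrable_mult_right integrable_norm)
    show "AE x in lborel. norm (convK l g x * \<psi> x) \<le> norm ((C * G powr (1 / p)) * norm (\<psi> x))"
    proof (rule AE_I2)
      fix x
      have "norm (convK l g x * \<psi> x) \<le> (C * G powr (1 / p)) * norm (\<psi> x)"
        unfolding norm_mult by (intro mult_right_mono C) auto
      also have "\<dots> \<le> norm ((C * G powr (1 / p)) * norm (\<psi> x))" by simp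
      finally show "norm (convK l g x * \<psi> x) \<le> norm ((C * G powr (1 / p)) * norm (\<psi> x))" .
    qed
  qed measurable
qed

lemma convK_parts:
  assumes l: "length l < m" and g: "Lp_fun g G" and \<phi>: "rapid \<phi>"
  shows "(\<integral>x. convK l g x * partial_deriv i \<phi> x \<partial>lborel) = - (\<integral>x. convK (l @ [i]) g x * \<phi> x \<partial>lborel)"
proof -
  have l': "length l \<le> m" "length (l @ [i]) \<le> m" using l by auto
  let ?F = "\<lambda>x. convK l g x * \<phi> x"
  have \<phi>': "rapid (partial_deriv i \<phi>)" by (rule all_derivs_partial[OF \<phi>])
  have D: "((\<lambda>t. ?F (x + t *\<^sub>R axis j 1)) has_vector_derivative
      (convK l g x * partial_deriv j \<phi> x + convK (l @ [j]) g x * \<phi> x)) (at 0)" for j x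
    using has_vector_derivative_mult[OF convK_has_vector_derivative[OF l g, of x j]
        axis_diff_has_vector_derivative_0[OF all_derivs_axis_diff[OF \<phi>], of x j]] by simp
  note pd = axis_diffI(2)[OF D]
  have i1: "integrable lborel (\<lambda>x. convK l g x * partial_deriv i \<phi> x)"
    by (rule convK_mult_rapid_integrable[OF l'(1) g rapid_integrable[OF \<phi>']])
  have i2: "integrable lborel (\<lambda>x. convK (l @ [i]) g x * \<phi> x)"
    by (rule convK_mult_rapid_integrable[OF l'(2) g rapid_integrable[OF \<phi>]])
  have "(\<integral>x. partial_deriv i ?F x \<partial>lborel) = 0"
  proof (rule integral_partial_deriv)
    show "axis_diff ?F" by (rule axis_diffI(1)[OF D])
    show "integrable lborel ?F" by (rule convK_mult_rapid_integrable[OF l'(1) g rapid_integrable[OF \<phi>]])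
    show "integrable lborel (partial_deriv i ?F)" unfolding pd by (intro Bochner_Integration.integrable_add i1 i2)
    have "continuous_on UNIV \<phi>" "continuous_on UNIV (partial_deriv i \<phi>)"
      using \<phi> \<phi>' all_derivs_base[OF rapid_smooth] by blast+
    then show "continuous_on UNIV (partial_deriv i ?F)"
      unfolding pd using convK_continuous[OF l'(1) g] convK_continuous[OF l'(2) g] by (intro continuous_intros)
  qed
  then have "(\<integral>x. convK l g x * partial_deriv i \<phi> x \<partial>lborel) + (\<integral>x. convK (l @ [i]) g x * \<phi> x \<partial>lborel) = 0"
    unfolding pd by (subst (asm) Bochner_Integration.integral_add[OF i1 i2])
  then show ?thesis by (simp add: add_eq_0_iff2)
qed

text \<open>
  The derivatives are moved from the test function one by one, the outermost first; by the symmetry of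
  derivatives of \<open>\<phi>\<close> they arrive on the convolution in the order of the list.
\<close>

lemma convK_parts_iterated:
  assumes g: "Lp_fun g G" and \<phi>: "rapid \<phi>"
  shows "length (l @ l') \<le> m \<Longrightarrow> (\<integral>x. convK l g x * fold partial_deriv l' \<phi> x \<partial>lborel)
    = (-1) ^ length l' * (\<integral>x. convK (l @ l') g x * \<phi> x \<partial>lborel)"
proof (induction l' arbitrary: l)
  case (Cons i l')
  have "fold partial_deriv (i # l') \<phi> = partial_deriv i (fold partial_deriv l' \<phi>)"
    using fold_partial_deriv_commute[OF rapid_smooth[OF \<phi>], of l' i] by simp
  then have "(\<integral>x. convK l g x * fold partial_deriv (i # l') \<phi> x \<partial>lborel) = - (\<integral>x. convK (l @ [i]) g x * fold partial_deriv l' \<phi> x \<partial>lborel)"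
    using Cons.prems convK_parts[OF _ g all_derivs_fold[OF \<phi>], of l i l'] by simp
  also have "(\<integral>x. convK (l @ [i]) g x * fold partial_deriv l' \<phi> x \<partial>lborel)
     = (-1) ^ length l' * (\<integral>x. convK ((l @ [i]) @ l') g x * \<phi> x \<partial>lborel)"
    using Cons.prems by (intro Cons.IH) auto
  finally show ?case by simp
qed simp

text \<open>
  The integrated kernel is even, so the convolution is symmetric for the pairing; Fubini's theorem
  applies because the convolution of \<open>|g|\<close> with the absolute kernel is bounded and \<open>\<psi>\<close> is integrable.
\<close>

lemma convK_adjoint:
  assumes g: "Lp_fun g G" and \<psi>: "rapid \<psi>"
  shows "(\<integral>x. g x * convK [] \<psi> x \<partial>lborel) = (\<integral>x. convK [] g x * \<psi> x \<partial>lborel)"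
proof -
  have [measurable]: "g \<in> borel_measurable borel" by (rule Lp_funD[OF g])
  have [measurable]: "\<psi> \<in> borel_measurable borel" by (rule decay_measurable[OF all_derivs_base[OF \<psi>]])
  obtain H where H: "Lp_fun \<psi> H" using rapid_Lp_fun[OF \<psi>] by blast
  interpret pair_sigma_finite "lborel :: (real ^ 'n) measure" \<nu>
    using nu_sigma_finite by (simp add: pair_sigma_finite_def sigma_finite_lborel)
  \<comment> \<open>The kernel \<open>K\<close> itself, as a function.\<close>
  define \<kappa> where "\<kappa> z = (\<integral>r. Ker [] r z \<partial>\<nu>)" for z :: "real ^ 'n"
  have [measurable]: "\<kappa> \<in> borel_measurable borel"
  proof -
    have "(\<lambda>(z, r). Ker [] r z) \<in> borel_measurable ((borel :: (real ^ 'n) measure) \<Otimes>\<^sub>M borel)" by measurable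
    then have "(\<lambda>(z, r). Ker [] r z) \<in> borel_measurable ((borel :: (real ^ 'n) measure) \<Otimes>\<^sub>M \<nu>)"
      by (simp cong: measurable_cong_sets sets_pair_measure_cong)
    from M2.borel_measurable_lebesgue_integral[OF this] show ?thesis unfolding \<kappa>_def by simp
  qed
  have conv: "convK [] f x = (\<integral>y. \<kappa> (x - y) * f y \<partial>lborel)" if f: "Lp_fun f F" for f F x
  proof -
    have "convK [] f x = (\<integral>y. \<integral>r. Ker [] r (x - y) * f y \<partial>\<nu> \<partial>lborel)"
      unfolding convK_def using integral_fst'[OF conv_integrable[of "[]", OF _ f, of x]] by simp
    then show ?thesis by (simp add: \<kappa>_def)
  qed
  have "Ker [] r (- z) = Ker [] r z" for r and z :: "real ^ 'n"
  proof (cases "0 < r")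
    case True
    then show ?thesis by (simp add: Ker_Nil heat_minus)
  qed (simp add: Ker_def)
  then have even: "\<kappa> (- z) = \<kappa> z" for z by (simp add: \<kappa>_def)
  obtain C where C: "C \<ge> 0" "\<And>y. (\<integral>\<^sup>+x. \<integral>\<^sup>+r. norm (Ker [] r (y - x) * g x) \<partial>\<nu> \<partial>lborel) \<le> ennreal (C * G powr (1 / p))"
    using conv_bound[of "[]"] g unfolding Lp_fun_def by auto
  have \<kappa>le: "ennreal (norm (\<kappa> z)) \<le> (\<integral>\<^sup>+r. norm (Ker [] r z) \<partial>\<nu>)" for z
  proof (cases "integrable \<nu> (\<lambda>r. Ker [] r z)")
    case True
    then show ?thesis unfolding \<kappa>_def by (rule integral_norm_bound_ennreal)
  qed (simp add: \<kappa>_def not_integrable_integral_eq)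
  have fin: "(\<integral>\<^sup>+y. \<integral>\<^sup>+x. norm (\<kappa> (y - x) * g x * \<psi> y) \<partial>lborel \<partial>lborel) < \<infinity>"
  proof -
    have "(\<integral>\<^sup>+y. \<integral>\<^sup>+x. norm (\<kappa> (y - x) * g x * \<psi> y) \<partial>lborel \<partial>lborel) \<le> (\<integral>\<^sup>+y. ennreal (C * G powr (1 / p)) * norm (\<psi> y) \<partial>lborel)"
    proof (rule nn_integral_mono)
      fix y
      have "(\<integral>\<^sup>+x. norm (\<kappa> (y - x) * g x * \<psi> y) \<partial>lborel) = (\<integral>\<^sup>+x. norm (\<kappa> (y - x) * g x) \<partial>lborel) * norm (\<psi> y)"
        unfolding norm_mult[of _ "\<psi> y"] by (simp add: ennreal_mult nn_integral_multc)
      also have "(\<integral>\<^sup>+x. norm (\<kappa> (y - x) * g x) \<partial>lborel) \<le> (\<integral>\<^sup>+x. \<integral>\<^sup>+r. norm (Ker [] r (y - x) * g x) \<partial>\<nu> \<partial>lborel)"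
      proof (rule nn_integral_mono)
        fix x
        have "ennreal (norm (\<kappa> (y - x) * g x)) \<le> (\<integral>\<^sup>+r. norm (Ker [] r (y - x)) \<partial>\<nu>) * norm (g x)"
          using \<kappa>le[of "y - x"] by (simp add: norm_mult ennreal_mult mult_right_mono)
        also have "\<dots> = (\<integral>\<^sup>+r. norm (Ker [] r (y - x) * g x) \<partial>\<nu>)"
          by (simp add: norm_mult ennreal_mult nn_integral_multc)
        finally show "ennreal (norm (\<kappa> (y - x) * g x)) \<le> (\<integral>\<^sup>+r. norm (Ker [] r (y - x) * g x) \<partial>\<nu>)" .
      qed
      also have "\<dots> \<le> ennreal (C * G powr (1 / p))" by (rule C)
      finally show "(\<integral>\<^sup>+x. norm (\<kappa> (y - x) * g x * \<psi> y) \<partial>lborel) \<le> ennreal (C * G powr (1 / p)) * norm (\<psi> y)"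
        by (simp add: mult_right_mono)
    qed
    also have "\<dots> = ennreal (C * G powr (1 / p)) * (\<integral>\<^sup>+y. norm (\<psi> y) \<partial>lborel)"
      by (rule nn_integral_cmult) measurable
    also have "\<dots> < \<infinity>" using rapid_integrable[OF \<psi>] by (auto simp: integrable_iff_bounded ennreal_mult_less_top)
    finally show ?thesis .
  qed
  have "(\<integral>x. convK [] g x * \<psi> x \<partial>lborel) = (\<integral>y. \<integral>x. \<kappa> (y - x) * g x * \<psi> y \<partial>lborel \<partial>lborel)"
    by (simp add: conv[OF g])
  also have "\<dots> = (\<integral>x. \<integral>y. \<kappa> (y - x) * g x * \<psi> y \<partial>lborel \<partial>lborel)"
    by (rule integral_swap[OF sigma_finite_lborel sigma_finite_lborel _ fin]) measurable
  also have "\<dots> = (\<integral>x. \<integral>y. g x * (\<kappa> (x - y) * \<psi> y) \<partial>lborel \<partial>lborel)"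
  proof (intro Bochner_Integration.integral_cong refl)
    fix x y
    show "\<kappa> (y - x) * g x * \<psi> y = g x * (\<kappa> (x - y) * \<psi> y)" using even[of "x - y"] by simp
  qed
  also have "\<dots> = (\<integral>x. g x * convK [] \<psi> x \<partial>lborel)" by (simp add: conv[OF H])
  finally show ?thesis by simp
qed

text \<open>
  Replace \<open>1/a(\<xi>)\<close> by its representation as an integral of Gaussians against \<open>\<nu>\<close>, exchange the
  integrals, and use the convolution identity for each Gaussian.
\<close>

lemma convK_eq_fourier_multiplier:
  assumes \<psi>: "rapid \<psi>"
  shows "convK [] \<psi> = FT (-1) (\<lambda>\<xi>. of_real (symb lam (- s) (- 1) \<xi>) * FT 1 \<psi> \<xi>)"
proof
  fix x
  have [measurable]: "\<psi> \<in> borel_measurable borel" by (rule decay_measurable[OF all_derivs_base[OF \<psi>]])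
  obtain H where H: "Lp_fun \<psi> H" using rapid_Lp_fun[OF \<psi>] by blast
  let ?F = "FT 1 \<psi>"
  have Fi: "integrable lborel ?F" by (intro rapid_integrable FT_rapid \<psi>) simp
  have [measurable]: "?F \<in> borel_measurable borel" using borel_measurable_integrable[OF Fi] by simp
  interpret pair_sigma_finite "lborel :: (real ^ 'n) measure" \<nu>
    using nu_sigma_finite by (simp add: pair_sigma_finite_def sigma_finite_lborel)
  let ?e = "\<lambda>r (\<xi> :: real ^ 'n). exp (- (4 * pi\<^sup>2 * r * (norm \<xi>)\<^sup>2))"
  let ?k = "\<lambda>r \<xi>. of_real (?e r \<xi>) * ?F \<xi> * cis (2 * pi * (- 1) * (\<xi> \<bullet> x))"
  have nn: "(\<integral>\<^sup>+r. ennreal (?e r \<xi>) \<partial>\<nu>) = ennreal (symb lam (- s) (- 1) \<xi>)" for \<xi>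
  proof -
    have m: "1 < mu lam \<xi>" using lam mu_ge[of lam \<xi>] by linarith
    then have "lam + 4 * pi\<^sup>2 * (norm \<xi>)\<^sup>2 > 1" by (simp add: mu_def)
    from nn_integral_nu_exp[OF s this]
    have "(\<integral>\<^sup>+r. ennreal (?e r \<xi>) \<partial>\<nu>) = ennreal (1 / (mu lam \<xi> powr s * ln (mu lam \<xi>)))"
      by (simp add: mu_def mult_ac)
    also have "1 / (mu lam \<xi> powr s * ln (mu lam \<xi>)) = symb lam (- s) (- 1) \<xi>"
      using m by (simp add: symb_def powr_minus_divide)
    finally show ?thesis .
  qed
  have nn0: "0 \<le> symb lam (- s) (- 1) \<xi>" for \<xi> :: "real ^ 'n" by (simp add: symb_def)
  have int: "(\<integral>r. complex_of_real (?e r \<xi>) \<partial>\<nu>) = of_real (symb lam (- s) (- 1) \<xi>)" for \<xi>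
  proof -
    have "(\<integral>r. ?e r \<xi> \<partial>\<nu>) = symb lam (- s) (- 1) \<xi>"
      by (rule integral_eq_nn_integral[THEN trans]) (simp_all add: nn nn0)
    then show ?thesis by simp
  qed
  obtain K where K: "\<And>\<xi> :: real ^ 'n. symb lam (- s) (- 1) \<xi> \<le> K" "0 \<le> K"
  proof
    define K where "K = lam powr (- s) * ln lam powr (- 1)"
    show "symb lam (- s) (- 1) \<xi> \<le> K" for \<xi> :: "real ^ 'n"
      unfolding symb_def K_def using lam s mu_ge[of lam \<xi>] by (intro mult_mono powr_mono2') auto
    show "0 \<le> K" by (simp add: K_def)
  qed
  have "FT (-1) (\<lambda>\<xi>. of_real (symb lam (- s) (- 1) \<xi>) * ?F \<xi>) x
     = (\<integral>\<xi>. \<integral>r. ?k r \<xi> \<partial>\<nu> \<partial>lborel)"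
    unfolding FT_def by (simp add: int[symmetric] del: of_real_exp)
  also have "\<dots> = (\<integral>r. \<integral>\<xi>. ?k r \<xi> \<partial>lborel \<partial>\<nu>)"
  proof (rule integral_swap[OF sigma_finite_lborel nu_sigma_finite])
    show "(\<lambda>(\<xi>, r). ?k r \<xi>) \<in> borel_measurable (lborel \<Otimes>\<^sub>M \<nu>)"
      by (rule measurable_pair_nu) measurable
    have "(\<integral>\<^sup>+\<xi>. \<integral>\<^sup>+r. norm (?k r \<xi>) \<partial>\<nu> \<partial>lborel)
       = (\<integral>\<^sup>+\<xi>. ennreal (symb lam (- s) (- 1) \<xi>) * norm (?F \<xi>) \<partial>lborel)"
      by (simp add: norm_mult ennreal_mult nn_integral_multc nn del: of_real_exp)
    also have "\<dots> \<le> (\<integral>\<^sup>+\<xi>. ennreal K * norm (?F \<xi>) \<partial>lborel)"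
      by (intro nn_integral_mono mult_right_mono ennreal_leI K) auto
    also have "\<dots> = ennreal K * (\<integral>\<^sup>+\<xi>. norm (?F \<xi>) \<partial>lborel)" by (rule nn_integral_cmult) measurable
    also have "\<dots> < \<infinity>" using Fi by (auto simp: integrable_iff_bounded ennreal_mult_less_top)
    finally show "(\<integral>\<^sup>+\<xi>. \<integral>\<^sup>+r. norm (?k r \<xi>) \<partial>\<nu> \<partial>lborel) < \<infinity>" .
  qed
  also have "\<dots> = (\<integral>r. \<integral>y. Ker [] r (x - y) * \<psi> y \<partial>lborel \<partial>\<nu>)"
  proof (rule integral_cong_AE)
    show "AE r in \<nu>. (\<integral>\<xi>. ?k r \<xi> \<partial>lborel) = (\<integral>y. Ker [] r (x - y) * \<psi> y \<partial>lborel)"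
      using AE_nu_pos
    proof eventually_elim
      case (elim r)
      then show ?case
        using FT_heat_conv[OF rapid_integrable[OF \<psi>] elim, of 1 x] by (simp add: Ker_Nil mult.commute)
    qed
    show "(\<lambda>r. \<integral>\<xi>. ?k r \<xi> \<partial>lborel) \<in> borel_measurable \<nu>" by measurable
    show "(\<lambda>r. \<integral>y. Ker [] r (x - y) * \<psi> y \<partial>lborel) \<in> borel_measurable \<nu>" by measurable
  qed
  also have "\<dots> = convK [] \<psi> x"
  proof -
    have i: "integrable (lborel \<Otimes>\<^sub>M \<nu>) (\<lambda>(y, r). Ker [] r (x - y) * \<psi> y)"
      using conv_integrable[of "[]", OF _ H, of x] by (simp add: case_prod_unfold)
    show ?thesis unfolding convK_def Fubini_integral[OF i] integral_fst[OF i] by (simp add: case_prod_unfold)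
  qed
  finally show "convK [] \<psi> x = FT (-1) (\<lambda>\<xi>. of_real (symb lam (- s) (- 1) \<xi>) * FT 1 \<psi> \<xi>) x" by simp
qed

end

context critical_exponent
begin

section \<open>Representation of the distributions and embedding\<close>

lemma sln_symbol_eq: "sln_symbol s lam = (symb lam s 1 :: real ^ 'n \<Rightarrow> real)"
proof
  fix \<xi> :: "real ^ 'n"
  have "1 < mu lam \<xi>" using lam mu_ge[of lam \<xi>] by linarith
  then show "sln_symbol s lam \<xi> = symb lam s 1 \<xi>" by (simp add: sln_symbol_def symb_def mu_def)
qed

lemma symb_inverse: "symb lam s 1 \<xi> * symb lam (- s) (- 1) \<xi> = 1" for \<xi> :: "real ^ 'n"
proof -
  have "1 < mu lam \<xi>" using lam mu_ge[of lam \<xi>] by linarith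
  then show ?thesis by (simp add: symb_def powr_minus_divide)
qed

text \<open>
  On the Fourier side \<open>\<psi>\<close> is divided by the symbol and then multiplied by it. All intermediate
  functions are Schwartz functions, as the functionals take their meaningful values only there.
\<close>

lemma sln_op_convK:
  fixes u :: "'n functional"
  assumes \<psi>: "rapid \<psi>"
  shows "convK [] \<psi> \<in> schwartz" "sln_op s lam u (convK [] \<psi>) = u \<psi>"
proof -
  \<comment> \<open>The inverse transform of \<open>\<psi>\<close> divided by the symbol.\<close>
  define h where "h = (\<lambda>\<xi>. complex_of_real (symb lam (- s) (- 1) \<xi>) * FT 1 \<psi> \<xi>)"
  have h: "rapid h" unfolding h_def by (intro rapid_symb_mult lam FT_rapid \<psi>) simp
  have c: "convK [] \<psi> = FT (-1) h" unfolding h_def by (rule convK_eq_fourier_multiplier[OF \<psi>])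
  have rc: "rapid (convK [] \<psi>)" unfolding c by (intro FT_rapid h) simp
  then show sc: "convK [] \<psi> \<in> schwartz" by (simp add: schwartz_iff_rapid)
  have inv: "inv_fourier (convK [] \<psi>) = h"
    using FT_inversion[OF h, of "-1"] by (simp add: inv_fourier_eq_FT c)
  have ah: "(\<lambda>\<xi>. complex_of_real (sln_symbol s lam \<xi>) * h \<xi>) = FT 1 \<psi>"
  proof
    fix \<xi>
    have "complex_of_real (sln_symbol s lam \<xi>) * h \<xi>
        = complex_of_real (symb lam s 1 \<xi> * symb lam (- s) (- 1) \<xi>) * FT 1 \<psi> \<xi>"
      by (simp add: h_def sln_symbol_eq)
    then show "complex_of_real (sln_symbol s lam \<xi>) * h \<xi> = FT 1 \<psi> \<xi>" by (simp only: symb_inverse of_real_1 mult_1)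
  qed
  have F: "FT 1 \<psi> \<in> schwartz" unfolding schwartz_iff_rapid by (intro FT_rapid \<psi>) simp
  have "fourier (FT 1 \<psi>) = \<psi>" using FT_inversion[OF \<psi>, of 1] by (simp add: fourier_eq_FT)
  then show "sln_op s lam u (convK [] \<psi>) = u \<psi>"
    using sc h F by (simp add: sln_op_def fourier_multiplier_def dist_inv_fourier_def dist_mult_def dist_fourier_def
        inv ah schwartz_iff_rapid[of h])
qed

text \<open>
  The function \<open>g\<close> is the representative that the norm itself selects, so that the norm of \<open>u\<close> is the
  \<open>L\<^sup>p\<close> norm of \<open>g\<close> by definition. Testing with \<open>\<psi>\<close>, one writes \<open>u(\<psi>)\<close> as the value of the multiplied
  distribution at \<open>K * \<psi>\<close> and moves the convolution to \<open>g\<close>.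
\<close>

lemma Lsln_representation:
  fixes u :: "'n functional"
  assumes u: "u \<in> Lsln p s lam"
  obtains g G where "Lp_fun g G" "Lsln_norm p s lam u = G powr (1 / p)" "u = dist_of (convK [] g)"
proof -
  define g where "g = (SOME g. g \<in> Lp p \<and> sln_op s lam u = dist_of g)"
  have "\<exists>g. g \<in> Lp p \<and> sln_op s lam u = dist_of g" using u by (auto simp: Lsln_def)
  from someI_ex[OF this] have g: "g \<in> Lp p" "sln_op s lam u = dist_of g" by (simp_all add: g_def)
  define G where "G = (\<integral>x. norm (g x) powr p \<partial>lborel)"
  have gm: "g \<in> borel_measurable borel" and gi: "integrable lborel (\<lambda>x. norm (g x) powr p)"
    using g(1) by (auto simp: Lp_def)
  have L: "Lp_fun g G"
    unfolding Lp_fun_def G_def using gm gi by (simp add: nn_integral_eq_integral)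
  have n: "Lsln_norm p s lam u = G powr (1 / p)"
    by (simp add: Lsln_norm_def dist_Lp_norm_def Lp_norm_def G_def flip: g_def)
  have "u = dist_of (convK [] g)"
  proof
    fix \<psi>
    show "u \<psi> = dist_of (convK [] g) \<psi>"
    proof (cases "\<psi> \<in> schwartz")
      case True
      then have \<psi>: "rapid \<psi>" by (simp add: schwartz_iff_rapid)
      have "u \<psi> = sln_op s lam u (convK [] \<psi>)" by (rule sln_op_convK(2)[OF \<psi>, symmetric])
      also have "\<dots> = (\<integral>x. g x * convK [] \<psi> x \<partial>lborel)"
        using sln_op_convK(1)[OF \<psi>] by (simp add: g(2) dist_of_def)
      also have "\<dots> = (\<integral>x. convK [] g x * \<psi> x \<partial>lborel)" by (rule convK_adjoint[OF L \<psi>])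
      finally show ?thesis using True by (simp add: dist_of_def)
    next
      case False
      have "u \<in> extensional schwartz" using u by (simp add: Lsln_def tempered_distributions_def)
      then show ?thesis using False by (simp add: dist_of_def extensional_def)
    qed
  qed
  then show thesis using that L n by blast
qed

lemma dist_deriv_convK:
  assumes g: "Lp_fun g G" and \<gamma>: "mi_order \<gamma> \<le> m"
  shows "dist_deriv \<gamma> (dist_of (convK [] g)) = dist_of (convK (mi_list \<gamma>) g)"
proof
  fix \<phi> :: "real ^ 'n \<Rightarrow> complex"
  show "dist_deriv \<gamma> (dist_of (convK [] g)) \<phi> = dist_of (convK (mi_list \<gamma>) g) \<phi>"
  proof (cases "\<phi> \<in> schwartz")
    case True
    then have \<phi>: "rapid \<phi>" by (simp add: schwartz_iff_rapid)
    have d: "mderiv \<gamma> \<phi> \<in> schwartz"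
      unfolding schwartz_iff_rapid mderiv_eq_fold by (rule all_derivs_fold[OF \<phi>])
    have "(\<integral>x. convK [] g x * mderiv \<gamma> \<phi> x \<partial>lborel)
        = (-1) ^ mi_order \<gamma> * (\<integral>x. convK (mi_list \<gamma>) g x * \<phi> x \<partial>lborel)"
      using convK_parts_iterated[OF g \<phi>, of "[]" "mi_list \<gamma>"] \<gamma> by (simp add: mderiv_eq_fold length_mi_list)
    then show ?thesis using True d by (simp add: dist_deriv_def dist_of_def flip: mult.assoc power_mult_distrib)
  qed (simp add: dist_deriv_def dist_of_def)
qed

lemma sup_norm_le: "(\<And>x. norm (f x) \<le> B) \<Longrightarrow> sup_norm f \<le> B"
  unfolding sup_norm_def by (rule cSUP_least) auto

text \<open>
  There are finitely many derivatives of order at most \<open>m\<close>, so a constant for each of them gives a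
  common one.
\<close>

lemma uniform_over_lists:
  assumes "\<And>l :: 'n list. length l \<le> m \<Longrightarrow> \<exists>C\<ge>0. P l C"
    and mono: "\<And>l C C'. P l C \<Longrightarrow> C \<le> C' \<Longrightarrow> P l (C' :: real)"
  shows "\<exists>C>0. \<forall>l. length l \<le> m \<longrightarrow> P l C"
proof -
  define S where "S = {l :: 'n list. length l \<le> m}"
  have fin: "finite S" using finite_lists_length_le[of "UNIV :: 'n set" m] by (simp add: S_def)
  obtain c where c: "\<And>l. l \<in> S \<Longrightarrow> 0 \<le> c l" "\<And>l. l \<in> S \<Longrightarrow> P l (c l)"
    using assms(1) unfolding S_def mem_Collect_eq by metis
  have "P l (1 + sum c S)" if "l \<in> S" for l
  proof (rule mono[OF c(2)[OF that]])
    have "c l \<le> sum c S" by (rule member_le_sum[OF that]) (use c fin in auto)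
    then show "c l \<le> 1 + sum c S" by simp
  qed
  moreover have "0 < 1 + sum c S" using c by (intro add_pos_nonneg sum_nonneg) auto
  ultimately show ?thesis unfolding S_def by blast
qed

lemma embedding:
  "\<exists>C>0. \<forall>u \<in> (Lsln p s lam :: 'n functional set).
        \<exists>f \<in> C0m m. u = dist_of f \<and> C0m_norm m f \<le> C * Lsln_norm p s lam u"
proof -
  define P where "P l C \<longleftrightarrow> (\<forall>g G x. Lp_fun g G \<longrightarrow> norm (convK l g x) \<le> C * G powr (1 / p))"
    for l :: "'n list" and C
  have "P l C'" if "P l C" "C \<le> C'" for l C C'
    using that unfolding P_def by (meson mult_right_mono order_trans powr_ge_zero)
  moreover have "\<exists>C\<ge>0. P l C" if "length l \<le> m" for l
    using convK_bound[OF that] by (simp only: P_def)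
  ultimately obtain C where C: "C > 0" "\<And>l. length l \<le> m \<Longrightarrow> P l C"
    using uniform_over_lists[of P] by blast
  define K where "K = real (card {\<gamma> :: 'n \<Rightarrow> nat. mi_order \<gamma> \<le> m})"
  have "\<exists>f \<in> C0m m. u = dist_of f \<and> C0m_norm m f \<le> (K * C + 1) * Lsln_norm p s lam u"
    if "u \<in> Lsln p s lam" for u :: "'n functional"
  proof -
    obtain g G where g: "Lp_fun g G" and n: "Lsln_norm p s lam u = G powr (1 / p)" and u: "u = dist_of (convK [] g)"
      using Lsln_representation[OF \<open>u \<in> Lsln p s lam\<close>] .
    have "C0m_norm m (convK [] g) \<le> (\<Sum>\<gamma> | mi_order (\<gamma> :: 'n \<Rightarrow> nat) \<le> m. C * G powr (1 / p))"
      unfolding C0m_norm_def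
    proof (rule sum_mono)
      fix \<gamma> :: "'n \<Rightarrow> nat" assume "\<gamma> \<in> {\<gamma>. mi_order \<gamma> \<le> m}"
      then have "mi_order \<gamma> \<le> m" by simp
      then show "sup_norm (mderiv \<gamma> (convK [] g)) \<le> C * G powr (1 / p)"
        using g C(2)[of "mi_list \<gamma>"] unfolding P_def
        by (simp add: mderiv_convK length_mi_list sup_norm_le)
    qed
    also have "\<dots> = K * (C * G powr (1 / p))" by (simp add: K_def)
    also have "\<dots> \<le> (K * C + 1) * Lsln_norm p s lam u" by (simp add: n distrib_right mult.assoc)
    finally show ?thesis using convK_C0m[OF g] u by blast
  qed
  moreover have "0 < K * C + 1" using C(1) by (intro add_nonneg_pos) (auto simp: K_def)
  ultimately show ?thesis by blast
qed

lemma log_modulus: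
  "\<exists>C>0. \<exists>\<delta>>0. \<forall>u \<in> (Lsln p s lam :: 'n functional set). \<forall>\<gamma>. mi_order \<gamma> = m \<longrightarrow>
        (\<exists>g \<in> C0. dist_deriv \<gamma> u = dist_of g \<and>
           (\<forall>h. 0 < norm h \<and> norm h < \<delta> \<longrightarrow>
              sup_norm (\<lambda>x. g (x + h) - g x)
                \<le> C * Lsln_norm p s lam u * \<bar>ln (norm h)\<bar> powr (- 1 / p)))"
proof -
  define P where "P l C \<longleftrightarrow> (\<forall>g G x h. Lp_fun g G \<longrightarrow> 0 < norm h \<longrightarrow> norm h < 1 / 16 \<longrightarrow>
     norm (convK l g (x + h) - convK l g x) \<le> C * G powr (1 / p) * (- ln (norm h)) powr (- (1 / p)))"
    for l :: "'n list" and C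
  have "P l C'" if "P l C" "C \<le> C'" for l C C'
    using that unfolding P_def by (meson mult_right_mono order_trans powr_ge_zero)
  moreover have "\<exists>C\<ge>0. P l C" if "length l \<le> m" for l
    using convK_diff_bound[OF that] by (simp only: P_def)
  ultimately obtain C where C: "C > 0" "\<And>l. length l \<le> m \<Longrightarrow> P l C"
    using uniform_over_lists[of P] by blast
  show ?thesis
  proof (rule exI[of _ C], intro conjI C(1) exI[of _ "1 / 16 :: real"] ballI allI impI)
    fix u :: "'n functional" and \<gamma> :: "'n \<Rightarrow> nat"
    assume uL: "u \<in> Lsln p s lam" and \<gamma>: "mi_order \<gamma> = m"
    obtain g G where g: "Lp_fun g G" and n: "Lsln_norm p s lam u = G powr (1 / p)" and u: "u = dist_of (convK [] g)"
      using Lsln_representation[OF uL] .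
    have l: "length (mi_list \<gamma>) \<le> m" using \<gamma> by (simp add: length_mi_list)
    show "\<exists>g \<in> C0. dist_deriv \<gamma> u = dist_of g \<and>
           (\<forall>h. 0 < norm h \<and> norm h < 1 / 16 \<longrightarrow>
              sup_norm (\<lambda>x. g (x + h) - g x) \<le> C * Lsln_norm p s lam u * \<bar>ln (norm h)\<bar> powr (- 1 / p))"
    proof (intro bexI[of _ "convK (mi_list \<gamma>) g"] conjI allI impI; (elim conjE)?)
      show "convK (mi_list \<gamma>) g \<in> C0" by (rule convK_C0[OF l g])
      show "dist_deriv \<gamma> u = dist_of (convK (mi_list \<gamma>) g)" unfolding u using \<gamma> by (intro dist_deriv_convK[OF g]) simp
      fix h :: "real ^ 'n" assume h: "0 < norm h" "norm h < 1 / 16"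
      have "\<bar>ln (norm h)\<bar> = - ln (norm h)" using h by simp
      then show "sup_norm (\<lambda>x. convK (mi_list \<gamma>) g (x + h) - convK (mi_list \<gamma>) g x)
        \<le> C * Lsln_norm p s lam u * \<bar>ln (norm h)\<bar> powr (- 1 / p)"
        using C(2)[OF l] g h unfolding P_def by (intro sup_norm_le) (simp add: n)
    qed
  qed simp
qed

end

theorem theorem1p14:
  fixes s p lam :: real and m :: nat
  assumes "s > 0" and "p > 1" and "lam > 1"
    and "s = 1 / 2 * (real CARD('n::finite) / p + real m)"
  shows
    "(\<exists>C>0. \<forall>u \<in> (Lsln p s lam :: 'n functional set).
        \<exists>f \<in> C0m m. u = dist_of f \<and> C0m_norm m f \<le> C * Lsln_norm p s lam u) \<and>
     (\<exists>C>0. \<exists>\<delta>>0. \<forall>u \<in> (Lsln p s lam :: 'n functional set). \<forall>\<gamma>. mi_order \<gamma> = m \<longrightarrow>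
        (\<exists>g \<in> C0. dist_deriv \<gamma> u = dist_of g \<and>
           (\<forall>h. 0 < norm h \<and> norm h < \<delta> \<longrightarrow>
              sup_norm (\<lambda>x. g (x + h) - g x)
                \<le> C * Lsln_norm p s lam u * \<bar>ln (norm h)\<bar> powr (- 1 / p))))"
proof -
  interpret critical_exponent s lam p "p / (p - 1)" m "TYPE('n)"
  proof
    show "1 < p / (p - 1)" "1 / (p / (p - 1)) + 1 / p = 1" using assms(2) by (auto simp: field_simps)
  qed (use assms in blast)+
  show ?thesis by (intro conjI embedding log_modulus)
qed

end
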